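(* Let $k$, $\chi$, $U^+=T(V^+(\chi))/\mathcal I$, $U(\chi)$, $\tau$, $\mathbf c\in k^n$, $B_{\mathbf c}$ be as in the context. The following statements are equivalent: (1) The map $\varphi:\operatorname{gr}(B_{\mathbf c})\to H_\theta\ltimes U^-$ is an isomorphism. (2) $\mathbb N_{\mathrm{rel}}=\mathbb N$. (3) The ideal $\mathcal I\subset T(V^+(\chi))$ is generated by finitely many homogeneous noncommutative polynomials $p_j(E_1,\dots,E_n)$, $j=1,\dots,r$, of degrees $\lambda_j\in\mathbb N^n$ respectively, for which $\pi_{0,0}\circ P_{-\lambda_j}(p_j(B_1,\dots,B_n))=0$ for $j=1,\dots,r$. Moreover, if $\mathbb N_{\mathrm{rel}}\ne\mathbb N$ then there exists $\lambda\in\mathbb N^n\setminus\{0\}$ such that $K_{-\lambda}\in B_{\mathbf c}$.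
   Context: Let $k$ be a field, $\mathbb N=\{0,1,2,\dots\}$, $I=\{1,\dots,n\}$, $\{\alpha_i\}_{i\in I}$ the standard basis of $\mathbb Z^n$. Let $\chi:\mathbb Z^n\times\mathbb Z^n\to k^\times$ be a bicharacter with $q_{ij}:=\chi(\alpha_i,\alpha_j)=q_{ji}$ for all $i,j$. $H=k[K_i^{\pm1}\mid i\in I]$ is the group algebra of $\mathbb Z^n$ and $K_\lambda=K_1^{\lambda_1}\cdots K_n^{\lambda_n}$. $\widetilde U(\chi)$ is the Hopf algebra with generators $E_i,F_i,K_i^{\pm1}$, relations $K_iK_i^{-1}=1=K_i^{-1}K_i$, $K_iK_j=K_jK_i$, $K_iE_j=q_{ij}E_jK_i$, $K_iF_j=q_{ij}^{-1}F_jK_i$, $E_iF_j-F_jE_i=\delta_{ij}(K_i-K_i^{-1})$ and coproduct $\Delta(E_i)=E_i\otimes1+K_i\otimes E_i$, $\Delta(F_i)=F_i\otimes K_i^{-1}+1\otimes F_i$, $\Delta(K_i)=K_i\otimes K_i$. The subalgebras generated by the $E_i$, resp. the $F_i$, are the tensor algebras $T(V^+(\chi))$, $T(V^-(\chi))$ on $V^+(\chi)=\mathrm{span}\{E_i\}$, $V^-(\chi)=\mathrm{span}\{F_i\}$. $V^+(\chi)$ is a Yetter–Drinfeld module over $H$ with $K_i\cdot E_j=q_{ij}E_j$, $\delta(E_i)=K_i\otimes E_i$, so $T(V^+(\chi))$ is a $\mathbb Z^n$-graded braided Hopf algebra ($\deg E_i=\alpha_i$). $\omega$ is the algebra automorphism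 of $\widetilde U(\chi)$ with $\omega(E_i)=F_i$, $\omega(F_i)=E_i$, $\omega(K_i)=K_i^{-1}$. Fix a $\mathbb Z^n$-graded biideal $\mathcal I\subseteq\bigoplus_{m\ge2}T(V^+(\chi))_m$. Put $U(\chi)=\widetilde U(\chi)/(\mathcal I,\omega(\mathcal I))$, $U^+=T(V^+(\chi))/\mathcal I$ (a pre-Nichols algebra of diagonal type), $U^-=T(V^-(\chi))/\omega(\mathcal I)$. Multiplication $U^+\otimes H\otimes U^-\to U(\chi)$ is a linear isomorphism; $U^\pm$ are graded with $\deg E_i=\alpha_i$, $\deg F_i=-\alpha_i$. Let $\tau:I\to I$ be a bijection with $\tau^2=\mathrm{id}$, $q_{\tau(i)\tau(j)}=q_{ij}$, and assume $\tau(\mathcal I)=\mathcal I$ for the automorphism $E_i\mapsto E_{\tau(i)}$. $H_\theta\subset H$ is the subalgebra generated by all $K_iK_{\tau(i)}^{-1}$, and $H_\theta\ltimes U^-$ is the subalgebra of $U(\chi)$ generated by $H_\theta$ and $U^-$ (as a vector space $H_\theta\otimes U^-$). For $\mathbf c=(c_1,\dots,c_n)\in k^n$, $B_{\mathbf c}$ is the subalgebra of $U(\chi)$ generated by $H_\theta$ and $B_i=F_i+c_iE_{\tau(i)}K_i^{-1}$, $i\in I$. It has the filtration $\mathcal F$ given by $\deg(B_i)=1$, $\deg(h)=0$ for $h\in H_\theta$, and $\varphi:\operatorname{gr}(B_{\mathbf c})\to H_\theta\ltimes U^-$ is the surjective graded algebra homomorphism sending the class of $B_i$ to $F_i$ and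 $h\in H_\theta$ to $h$. $\mathbb N_{\mathrm{rel}}$ is the set of all $l\in\mathbb N$ such that every noncommutative polynomial $p\in k\langle x_1,\dots,x_n\rangle$ which is homogeneous of some total degree $m\le l$ satisfies: $p(F_1,\dots,F_n)=0$ implies $p(B_1,\dots,B_n)\in\mathcal F_{m-1}(B_{\mathbf c})$. Projections: let $G^-\subset U(\chi)$ be the subalgebra generated by the $F_iK_i$; $U(\chi)=\bigoplus_{\lambda\in\mathbb Z^n}U^+K_\lambda G^-$ and $P_\lambda:U(\chi)\to U^+K_\lambda G^-$ is the corresponding projection. Also $U(\chi)=\bigoplus_{\alpha,\beta\in\mathbb N^n}U^+_\alpha HU^-_{-\beta}$ and $\pi_{0,0}:U(\chi)\to H$ is the projection onto the summand $\alpha=\beta=0$. In (3), noncommutative polynomials are elements of the free algebra $k\langle x_1,\dots,x_n\rangle$ and homogeneous refers to the $\mathbb N^n$-grading $\deg x_i=\alpha_i$.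
   Formalization: The equivalence of (1) and (3) is stated for finitely generated ideals I; without this, (1) does not imply (3) (e.g. all q_ij=1, c=0, I generated by the second derived algebra of the free Lie algebra on two generators). (1)⇔(2), (3)⇒(1) and the final claim hold without it. *)

theory Defs
  imports
    "HOL-Algebra.Algebra"
    "HOL-Algebra.Algebraic_Closure_Type"
    "HOL-Library.Poly_Mapping"
    "HOL-Analysis.Finite_Cartesian_Product"
begin

section \<open>Free algebras\<close>

text \<open>
  Words form the free monoid, written additively so that the convolution product of
  \<^theory>\<open>HOL-Library.Poly_Mapping\<close> makes the finitely supported functions on words the free
  algebra \<open>k<x_g | g>\<close> of noncommutative polynomials.
\<close>

datatype 'g word = Word (letters: "'g list")

instantiation word :: (type) monoid_add
begin

definition zero_word :: "'a word" where
  "zero_word = Word []"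

definition plus_word :: "'a word \<Rightarrow> 'a word \<Rightarrow> 'a word" where
  "plus_word u v = Word (letters u @ letters v)"

instance
  by standard (simp_all add: zero_word_def plus_word_def)

end

type_synonym ('k, 'g) ncpoly = "'g word \<Rightarrow>\<^sub>0 'k"

definition ncvar :: "'g \<Rightarrow> ('k::field, 'g) ncpoly" where
  "ncvar g = Poly_Mapping.single (Word [g]) 1"

definition ncconst :: "'k \<Rightarrow> ('k::field, 'g) ncpoly" where
  "ncconst a = Poly_Mapping.single 0 a"

abbreviation free_ring :: "('k::field, 'g) ncpoly ring" where
  "free_ring \<equiv> ring_of_type_algebra"

text \<open>
  A \<open>k\<close>-algebra is a ring \<open>R\<close> together with its structure map \<open>s\<close> from \<open>k\<close> to the centre of \<open>R\<close>;
  \<open>nc_eval R s b p\<close> is then the value \<open>p(b)\<close>.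
\<close>

definition nc_eval ::
    "('r, 'm) ring_scheme \<Rightarrow> ('k::field \<Rightarrow> 'r) \<Rightarrow> ('g \<Rightarrow> 'r) \<Rightarrow> ('k, 'g) ncpoly \<Rightarrow> 'r" where
  "nc_eval R s b p =
     finsum R (\<lambda>w. s (Poly_Mapping.lookup p w) \<otimes>\<^bsub>R\<^esub>
                   foldr (\<lambda>g y. b g \<otimes>\<^bsub>R\<^esub> y) (letters w) \<one>\<^bsub>R\<^esub>)
       (Poly_Mapping.keys p)"

definition subalg :: "('r, 'm) ring_scheme \<Rightarrow> ('k \<Rightarrow> 'r) \<Rightarrow> 'r set \<Rightarrow> 'r set" where
  "subalg R s S = generate_ring R (range s \<union> S)"

text \<open>Below, all arguments of \<open>add_span\<close> are closed under multiplication by scalars, so that the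
  additive span is the \<open>k\<close>-linear span.\<close>

definition add_span :: "('r, 'm) ring_scheme \<Rightarrow> 'r set \<Rightarrow> 'r set" where
  "add_span R S = generate (add_monoid R) S"

text \<open>The projection of a direct sum of the additive subgroups \<open>W i\<close> of \<open>R\<close> onto \<open>W j\<close>.\<close>

definition component :: "('r, 'm) ring_scheme \<Rightarrow> ('j \<Rightarrow> 'r set) \<Rightarrow> 'j \<Rightarrow> 'r \<Rightarrow> 'r" where
  "component R W j x =
     (THE y. \<exists>f. (\<forall>i. f i \<in> W i) \<and> finite {i. f i \<noteq> \<zero>\<^bsub>R\<^esub>} \<and>
                 x = finsum R f {i. f i \<noteq> \<zero>\<^bsub>R\<^esub>} \<and> y = f j)"


section \<open>Gradings and graded biideals of the tensor algebra of \<open>V\<^sup>+\<close>\<close>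

text \<open>
  The index set \<open>{1,...,n}\<close> is a finite type \<open>'i\<close>, with \<open>n = CARD('i)\<close>. The tensor algebra of \<open>V\<^sup>+\<close> is the free algebra on
  \<open>'i\<close>, the variable \<open>x_i\<close> playing the role of \<open>E_i\<close>.
\<close>

definition alpha :: "'i::finite \<Rightarrow> int ^ 'i" where
  "alpha i = axis i 1"

definition wdeg :: "'i::finite word \<Rightarrow> nat ^ 'i" where
  "wdeg w = vec_lambda (\<lambda>i. count_list (letters w) i)"

definition zvec :: "nat ^ 'i::finite \<Rightarrow> int ^ 'i" where
  "zvec l = vec_lambda (\<lambda>i. int (l $ i))"

definition mhomogeneous :: "nat ^ 'i::finite \<Rightarrow> ('k::field, 'i) ncpoly \<Rightarrow> bool" where
  "mhomogeneous l p \<longleftrightarrow> (\<forall>w\<in>Poly_Mapping.keys p. wdeg w = l)"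

definition thomogeneous :: "nat \<Rightarrow> ('k::field, 'g) ncpoly \<Rightarrow> bool" where
  "thomogeneous m p \<longleftrightarrow> (\<forall>w\<in>Poly_Mapping.keys p. length (letters w) = m)"

definition hpart :: "nat ^ 'i::finite \<Rightarrow> ('k::field, 'i) ncpoly \<Rightarrow> ('k, 'i) ncpoly" where
  "hpart l p = (\<Sum>w\<in>{w\<in>Poly_Mapping.keys p. wdeg w = l}.
                  Poly_Mapping.single w (Poly_Mapping.lookup p w))"

definition bicharacter :: "(int ^ 'i::finite \<Rightarrow> int ^ 'i \<Rightarrow> 'k::field) \<Rightarrow> bool" where
  "bicharacter chi \<longleftrightarrow>
     (\<forall>a b. chi a b \<noteq> 0) \<and>
     (\<forall>a b d. chi (a + b) d = chi a d * chi b d) \<and>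
     (\<forall>a b d. chi a (b + d) = chi a b * chi a d)"

abbreviation qmat :: "(int ^ 'i::finite \<Rightarrow> int ^ 'i \<Rightarrow> 'k::field) \<Rightarrow> 'i \<Rightarrow> 'i \<Rightarrow> 'k" where
  "qmat chi i j \<equiv> chi (alpha i) (alpha j)"

text \<open>The tensor square of the free algebra, with basis the pairs of words.\<close>

type_synonym ('k, 'g) ncpoly2 = "'g word \<times> 'g word \<Rightarrow>\<^sub>0 'k"

definition tens :: "('k::field, 'g) ncpoly \<Rightarrow> ('k, 'g) ncpoly \<Rightarrow> ('k, 'g) ncpoly2" where
  "tens a b = (\<Sum>u\<in>Poly_Mapping.keys a. \<Sum>v\<in>Poly_Mapping.keys b.
     Poly_Mapping.single (u, v) (Poly_Mapping.lookup a u * Poly_Mapping.lookup b v))"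

text \<open>
  The Yetter-Drinfeld structure \<open>K_i . E_j = q_ij E_j\<close>, \<open>E_i \<mapsto> K_i \<otimes> E_i\<close> yields the product
  \<open>(a \<otimes> b) (a' \<otimes> b') = chi(deg b, deg a') a a' \<otimes> b b'\<close> of the braided tensor square.
\<close>

definition braided_mult :: "(int ^ 'i::finite \<Rightarrow> int ^ 'i \<Rightarrow> 'k::field) \<Rightarrow>
    ('k, 'i) ncpoly2 \<Rightarrow> ('k, 'i) ncpoly2 \<Rightarrow> ('k, 'i) ncpoly2" where
  "braided_mult chi s t =
     (\<Sum>(u, v)\<in>Poly_Mapping.keys s. \<Sum>(u', v')\<in>Poly_Mapping.keys t.
        Poly_Mapping.single (u + u', v + v')
          (chi (zvec (wdeg v)) (zvec (wdeg u')) *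
             Poly_Mapping.lookup s (u, v) * Poly_Mapping.lookup t (u', v')))"

text \<open>The braided coproduct: the algebra homomorphism into the braided tensor square with
  \<open>x_i \<mapsto> x_i \<otimes> 1 + 1 \<otimes> x_i\<close>.\<close>

primrec word_coproduct ::
    "(int ^ 'i::finite \<Rightarrow> int ^ 'i \<Rightarrow> 'k::field) \<Rightarrow> 'i list \<Rightarrow> ('k, 'i) ncpoly2" where
  "word_coproduct chi [] = tens 1 1"
| "word_coproduct chi (i # w) =
     braided_mult chi (tens (ncvar i) 1 + tens 1 (ncvar i)) (word_coproduct chi w)"

definition braided_coproduct ::
    "(int ^ 'i::finite \<Rightarrow> int ^ 'i \<Rightarrow> 'k::field) \<Rightarrow> ('k, 'i) ncpoly \<Rightarrow> ('k, 'i) ncpoly2" where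
  "braided_coproduct chi p = (\<Sum>w\<in>Poly_Mapping.keys p.
     Poly_Mapping.map ((*) (Poly_Mapping.lookup p w)) (word_coproduct chi (letters w)))"

text \<open>
  \<open>\<int>\<^sup>n\<close>-graded biideals contained in the part of degree at least two. The second last
  condition says that the coproduct of \<open>I\<close> lies in \<open>I \<otimes> T + T \<otimes> I\<close>; the counit vanishes on \<open>I\<close>
  by the last condition.
\<close>

definition graded_biideal ::
    "(int ^ 'i::finite \<Rightarrow> int ^ 'i \<Rightarrow> 'k::field) \<Rightarrow> ('k, 'i) ncpoly set \<Rightarrow> bool" where
  "graded_biideal chi I \<longleftrightarrow>
     ideal I free_ring \<and>
     (\<forall>p\<in>I. \<forall>l. hpart l p \<in> I) \<and>
     (\<forall>p\<in>I. \<exists>zs. (\<forall>(a, b)\<in>set zs. a \<in> I \<or> b \<in> I) \<and>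
        braided_coproduct chi p = (\<Sum>(a, b)\<leftarrow>zs. tens a b)) \<and>
     (\<forall>p\<in>I. \<forall>w\<in>Poly_Mapping.keys p. 2 \<le> length (letters w))"

text \<open>The algebra automorphism \<open>x_i \<mapsto> x_(tau i)\<close>.\<close>

definition tau_hom :: "('i \<Rightarrow> 'i) \<Rightarrow> ('k::field, 'i) ncpoly \<Rightarrow> ('k, 'i) ncpoly" where
  "tau_hom tau = nc_eval free_ring ncconst (\<lambda>i. ncvar (tau i))"


section \<open>The algebra \<open>U(chi)\<close>\<close>

datatype 'i gen = GenE 'i | GenF 'i | GenK 'i | GenKinv 'i

text \<open>The defining relations of \<open>U~(chi)\<close>; the differences listed are to become zero.\<close>

definition U_tilde_relations ::
    "(int ^ 'i::finite \<Rightarrow> int ^ 'i \<Rightarrow> 'k::field) \<Rightarrow> ('k, 'i gen) ncpoly set" where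
  "U_tilde_relations chi =
     (let e = (\<lambda>i. ncvar (GenE i)); f = (\<lambda>i. ncvar (GenF i));
          k = (\<lambda>i. ncvar (GenK i)); k' = (\<lambda>i. ncvar (GenKinv i))
      in (\<Union>i. {k i * k' i - 1, k' i * k i - 1}) \<union>
         (\<Union>i j. {k i * k j - k j * k i,
                  k i * e j - ncconst (qmat chi i j) * e j * k i,
                  k i * f j - ncconst (inverse (qmat chi i j)) * f j * k i,
                  e i * f j - f j * e i - (if i = j then k i - k' i else 0)}))"

text \<open>
  \<open>U(chi)\<close> is presented by the relations of \<open>U~(chi)\<close> together with \<open>p(E)\<close> and
  \<open>\<omega>(p(E)) = p(F)\<close> for \<open>p\<close> in \<open>I\<close>.
\<close>

definition U_ideal :: "(int ^ 'i::finite \<Rightarrow> int ^ 'i \<Rightarrow> 'k::field) \<Rightarrow> ('k, 'i) ncpoly set \<Rightarrow>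
    ('k, 'i gen) ncpoly set" where
  "U_ideal chi I = genideal free_ring
     (U_tilde_relations chi \<union>
      nc_eval free_ring ncconst (\<lambda>i. ncvar (GenE i)) ` I \<union>
      nc_eval free_ring ncconst (\<lambda>i. ncvar (GenF i)) ` I)"

definition U_alg :: "(int ^ 'i::finite \<Rightarrow> int ^ 'i \<Rightarrow> 'k::field) \<Rightarrow> ('k, 'i) ncpoly set \<Rightarrow>
    ('k, 'i gen) ncpoly set ring" where
  "U_alg chi I = free_ring Quot U_ideal chi I"

type_synonym ('k, 'i) U_elt = "('k, 'i gen) ncpoly set"

context
  fixes chi :: "int ^ 'i::finite \<Rightarrow> int ^ 'i \<Rightarrow> 'k::field"
    and I :: "('k, 'i) ncpoly set"
begin

definition U_class :: "('k, 'i gen) ncpoly \<Rightarrow> ('k, 'i) U_elt" where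
  "U_class x = U_ideal chi I +>\<^bsub>free_ring\<^esub> x"

definition U_scalar :: "'k \<Rightarrow> ('k, 'i) U_elt" where
  "U_scalar a = U_class (ncconst a)"

definition U_E :: "'i \<Rightarrow> ('k, 'i) U_elt" where
  "U_E i = U_class (ncvar (GenE i))"

definition U_F :: "'i \<Rightarrow> ('k, 'i) U_elt" where
  "U_F i = U_class (ncvar (GenF i))"

definition U_K :: "'i \<Rightarrow> ('k, 'i) U_elt" where
  "U_K i = U_class (ncvar (GenK i))"

definition U_Kinv :: "'i \<Rightarrow> ('k, 'i) U_elt" where
  "U_Kinv i = U_class (ncvar (GenKinv i))"

abbreviation eval_U :: "('i \<Rightarrow> ('k, 'i) U_elt) \<Rightarrow> ('k, 'i) ncpoly \<Rightarrow> ('k, 'i) U_elt" where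
  "eval_U \<equiv> nc_eval (U_alg chi I) U_scalar"

abbreviation subalg_U :: "('k, 'i) U_elt set \<Rightarrow> ('k, 'i) U_elt set" where
  "subalg_U \<equiv> subalg (U_alg chi I) U_scalar"

definition U_H :: "('k, 'i) U_elt set" where
  "U_H = subalg_U (range U_K \<union> range U_Kinv)"

text \<open>\<open>K_lambda = K_1^(lambda_1) \<cdots> K_n^(lambda_n)\<close>, a product in the commutative ring \<open>H\<close>.\<close>

definition U_Kpow :: "int ^ 'i \<Rightarrow> ('k, 'i) U_elt" where
  "U_Kpow l = finprod (U_alg chi I\<lparr>carrier := U_H\<rparr>)
     (\<lambda>i. if 0 \<le> l $ i then U_K i [^]\<^bsub>U_alg chi I\<^esub> nat (l $ i)
          else U_Kinv i [^]\<^bsub>U_alg chi I\<^esub> nat (- (l $ i))) UNIV"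

definition U_plus :: "('k, 'i) U_elt set" where
  "U_plus = subalg_U (range U_E)"

definition U_minus :: "('k, 'i) U_elt set" where
  "U_minus = subalg_U (range U_F)"

definition G_minus :: "('k, 'i) U_elt set" where
  "G_minus = subalg_U (range (\<lambda>i. U_F i \<otimes>\<^bsub>U_alg chi I\<^esub> U_K i))"

text \<open>\<open>U_minus_deg b\<close> is the homogeneous component of \<open>U\<^sup>-\<close> of degree \<open>-b\<close>.\<close>

definition U_plus_deg :: "nat ^ 'i \<Rightarrow> ('k, 'i) U_elt set" where
  "U_plus_deg a = eval_U U_E ` {p. mhomogeneous a p}"

definition U_minus_deg :: "nat ^ 'i \<Rightarrow> ('k, 'i) U_elt set" where
  "U_minus_deg b = eval_U U_F ` {p. mhomogeneous b p}"

text \<open>The projections belonging to the decompositions of \<open>U(chi)\<close> into the subspaces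
  \<open>U\<^sup>+ K_lambda G\<^sup>-\<close> and \<open>U\<^sup>+_a H U\<^sup>-_(-b)\<close>, respectively.\<close>

definition proj_P :: "int ^ 'i \<Rightarrow> ('k, 'i) U_elt \<Rightarrow> ('k, 'i) U_elt" where
  "proj_P = component (U_alg chi I)
     (\<lambda>l. add_span (U_alg chi I)
       {x \<otimes>\<^bsub>U_alg chi I\<^esub> U_Kpow l \<otimes>\<^bsub>U_alg chi I\<^esub> y | x y. x \<in> U_plus \<and> y \<in> G_minus})"

definition proj_pi :: "(nat ^ 'i) \<times> (nat ^ 'i) \<Rightarrow> ('k, 'i) U_elt \<Rightarrow> ('k, 'i) U_elt" where
  "proj_pi = component (U_alg chi I)
     (\<lambda>(a, b). add_span (U_alg chi I)
       {x \<otimes>\<^bsub>U_alg chi I\<^esub> h \<otimes>\<^bsub>U_alg chi I\<^esub> y | x h y.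
          x \<in> U_plus_deg a \<and> h \<in> U_H \<and> y \<in> U_minus_deg b})"


section \<open>The coideal subalgebra, its filtration and its associated graded algebra\<close>

definition H_theta :: "('i \<Rightarrow> 'i) \<Rightarrow> ('k, 'i) U_elt set" where
  "H_theta tau = subalg_U (range (\<lambda>i. U_K i \<otimes>\<^bsub>U_alg chi I\<^esub> U_Kinv (tau i)))"

definition H_theta_U_minus :: "('i \<Rightarrow> 'i) \<Rightarrow> ('k, 'i) U_elt ring" where
  "H_theta_U_minus tau = U_alg chi I\<lparr>carrier := subalg_U (H_theta tau \<union> U_minus)\<rparr>"

context
  fixes tau :: "'i \<Rightarrow> 'i"
    and c :: "'k ^ 'i"
begin

definition B_gen :: "'i \<Rightarrow> ('k, 'i) U_elt" where
  "B_gen i = U_F i \<oplus>\<^bsub>U_alg chi I\<^esub>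
     (U_scalar (c $ i) \<otimes>\<^bsub>U_alg chi I\<^esub> U_E (tau i) \<otimes>\<^bsub>U_alg chi I\<^esub> U_Kinv i)"

definition B_alg :: "('k, 'i) U_elt set" where
  "B_alg = subalg_U (H_theta tau \<union> range B_gen)"

text \<open>The filtration of \<open>B\<close> with \<open>B_i\<close> in degree \<open>1\<close> and \<open>H_theta\<close> in degree \<open>0\<close>: the
  smallest one that is multiplicative. It consists of \<open>k\<close>-subspaces because \<open>H_theta\<close>
  contains the scalars.\<close>

inductive_set fil_pairs :: "(nat \<times> ('k, 'i) U_elt) set" where
  "h \<in> H_theta tau \<Longrightarrow> (m, h) \<in> fil_pairs"
| "(Suc m, B_gen i) \<in> fil_pairs"
| "(m, x) \<in> fil_pairs \<Longrightarrow> (m, y) \<in> fil_pairs \<Longrightarrow> (m, x \<oplus>\<^bsub>U_alg chi I\<^esub> y) \<in> fil_pairs"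
| "(l, x) \<in> fil_pairs \<Longrightarrow> (m, y) \<in> fil_pairs \<Longrightarrow> (l + m, x \<otimes>\<^bsub>U_alg chi I\<^esub> y) \<in> fil_pairs"

definition Fil :: "nat \<Rightarrow> ('k, 'i) U_elt set" where
  "Fil m = {x. (m, x) \<in> fil_pairs}"

text \<open>\<open>Fil_pred m\<close> is the filtration step \<open>m - 1\<close>, step \<open>-1\<close> being zero.\<close>

definition Fil_pred :: "nat \<Rightarrow> ('k, 'i) U_elt set" where
  "Fil_pred m = (if m = 0 then {\<zero>\<^bsub>U_alg chi I\<^esub>} else Fil (m - 1))"

text \<open>
  An element of \<open>gr B\<close> is the family of its homogeneous components, the component in degree
  \<open>m\<close> being a coset in \<open>Fil m / Fil (m - 1)\<close>, almost all of them zero.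
  \<open>gr_class m x\<close> is the class of \<open>x\<close> in degree \<open>m\<close>.
\<close>

definition gr_class :: "nat \<Rightarrow> ('k, 'i) U_elt \<Rightarrow> nat \<Rightarrow> ('k, 'i) U_elt set" where
  "gr_class m x = (\<lambda>l. if l = m then Fil_pred m +>\<^bsub>U_alg chi I\<^esub> x else Fil_pred l)"

definition gr_B :: "(nat \<Rightarrow> ('k, 'i) U_elt set) ring" where
  "gr_B =
     \<lparr>carrier = {g. (\<forall>m. \<exists>x\<in>Fil m. g m = Fil_pred m +>\<^bsub>U_alg chi I\<^esub> x) \<and>
                   finite {m. g m \<noteq> Fil_pred m}},
      monoid.mult = (\<lambda>g h m.
        {z \<oplus>\<^bsub>U_alg chi I\<^esub> finsum (U_alg chi I) (\<lambda>l. x l \<otimes>\<^bsub>U_alg chi I\<^esub> y (m - l)) {..m} | x y z.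
           (\<forall>l\<le>m. x l \<in> g l \<and> y l \<in> h l) \<and> z \<in> Fil_pred m}),
      one = gr_class 0 \<one>\<^bsub>U_alg chi I\<^esub>,
      ring.zero = Fil_pred,
      add = (\<lambda>g h m. g m <+>\<^bsub>U_alg chi I\<^esub> h m)\<rparr>"

text \<open>
  As \<open>gr B\<close> is generated by the classes of the \<open>B_i\<close> and of the elements of \<open>H_theta\<close>, the
  conditions determine the map uniquely. It is \<open>k\<close>-linear because \<open>H_theta\<close> contains
  the scalars.
\<close>

definition gr_map :: "(nat \<Rightarrow> ('k, 'i) U_elt set) \<Rightarrow> ('k, 'i) U_elt" where
  "gr_map = (THE phi.
     phi \<in> extensional (carrier gr_B) \<and>
     phi \<in> ring_hom gr_B (H_theta_U_minus tau) \<and>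
     (\<forall>i. phi (gr_class 1 (B_gen i)) = U_F i) \<and>
     (\<forall>h\<in>H_theta tau. phi (gr_class 0 h) = h))"

definition N_rel :: "nat set" where
  "N_rel = {l. \<forall>m\<le>l. \<forall>p. thomogeneous m p \<longrightarrow>
     eval_U U_F p = \<zero>\<^bsub>U_alg chi I\<^esub> \<longrightarrow> eval_U B_gen p \<in> Fil_pred m}"

end

end

end

theory Submission
  imports Defs
begin

text \<open>
  The algebra \<open>U(chi)\<close> acts on the free module with basis \<open>E_u K_m F_v\<close>, and an element is zero in
  \<open>U(chi)\<close> if and only if it maps \<open>1\<close> into the submodule generated by the relations in \<open>I\<close>. Leading
  terms for the filtration of \<open>B\<close> can be read off there: \<open>phi\<close> is injective in degree \<open>n\<close> if and
  only if \<open>p(B)\<close> has filtration degree less than \<open>n\<close> for all \<open>p\<close> in \<open>I\<close> of degree \<open>n\<close>.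

  Write \<open>B_i = B*_i - d_i\<close>, where \<open>B*_i\<close> is the part that lowers the degree of the projections \<open>P\<close> by
  \<open>alpha_i\<close>. Then \<open>P_(- deg w)(B_w) = B*_w\<close> on the vacuum, and skew commutation of the \<open>d_i\<close> with the \<open>B*_k\<close>
  shows that \<open>B*_w\<close> and \<open>B_w\<close> agree up to lower filtration degree. Let \<open>kappa(p) K_(- deg p)\<close> be the
  Cartan part of \<open>B*_p\<close>. A Wick formula expands \<open>B*_w\<close> along the iterated braided coproduct of \<open>w\<close>
  with \<open>kappa\<close> in the middle factor. So if \<open>kappa\<close> vanishes on \<open>I\<close> in degrees below that of \<open>p\<close>, a relation
  \<open>p\<close> yields \<open>B*_p = kappa(p) K_(- deg p)\<close> in \<open>U(chi)\<close>. If \<open>kappa(p) = 0\<close>, then \<open>p(B)\<close> drops in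
  filtration degree. Otherwise \<open>K_(- deg p)\<close> lies in \<open>B\<close>, and \<open>p(B)\<close> cannot drop: then
  \<open>K_(- deg p)\<close>, having no leading terms in the degrees where \<open>phi\<close> is injective, would lie in
  \<open>H_theta\<close>, whose elements have weights of height zero.
\<close>

section \<open>Linear extension\<close>

text \<open>\<open>kappa\<close> is not multiplicative, so its vanishing on generators of
  \<open>I\<close> gives no direct information about the ideal they generate, whereas dropping in
  filtration degree is stable under products. The two conditions are therefore compared degree by
  degree: \<open>kappa_below n\<close> is what the Wick argument needs in degree n, and the drop in
  degrees below n gives it back. The Wick sum is truncated at length n, because only below n is
  \<open>kappa\<close> known to vanish on \<open>I\<close>. The splitting of \<open>B_i\<close> is
  chosen so that the skew commutators of \<open>d_i\<close> with the \<open>B*_k\<close> are scalars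
  times K_i K_k^{-1} with i = tau(k), hence elements of \<open>H_theta\<close>; no error terms
  outside the filtration arise. Invariance of \<open>I\<close> under tau enters through products of
  the terms c_i E_(tau i) K_i^{-1}: these give multiples of E_(tau w), and the last factor of the
  Wick formula consists of them. Condition (3) contains finite generation of \<open>I\<close>, which
  (1) cannot supply: for c = 0 the map phi is an isomorphism for every \<open>I\<close>. Hence the
  equivalence with (3) is stated for finitely generated \<open>I\<close>.\<close>

abbreviation coef :: "('a \<Rightarrow>\<^sub>0 'k::zero) \<Rightarrow> 'a \<Rightarrow> 'k" where "coef \<equiv> Poly_Mapping.lookup"
abbreviation keys :: "('a \<Rightarrow>\<^sub>0 'k::zero) \<Rightarrow> 'a set" where "keys \<equiv> Poly_Mapping.keys"
abbreviation bas :: "'a \<Rightarrow> ('a \<Rightarrow>\<^sub>0 'k::zero_neq_one)" where "bas a \<equiv> Poly_Mapping.single a 1"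

definition smul :: "'k::field \<Rightarrow> ('a \<Rightarrow>\<^sub>0 'k) \<Rightarrow> ('a \<Rightarrow>\<^sub>0 'k)" where
  "smul a p = Poly_Mapping.map ((*) a) p"

lemma coef_smul [simp]: "coef (smul a p) x = a * coef p x"
  by (simp add: smul_def Poly_Mapping.map.rep_eq when_def)

lemma smul_add: "smul a (p + q) = smul a p + smul a q"
  and smul_diff: "smul a (p - q) = smul a p - smul a q"
  and smul_add_left: "smul (a + b) p = smul a p + smul b p"
  and smul_smul [simp]: "smul a (smul b p) = smul (a * b) p"
  and smul_0 [simp]: "smul a 0 = 0"
  and smul_0_left [simp]: "smul 0 p = 0"
  and smul_1 [simp]: "smul 1 p = p"
  and smul_minus_left: "smul (- a) p = - smul a p"
  by (rule poly_mapping_eqI; simp add: lookup_add lookup_minus algebra_simps)+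

lemma smul_single: "smul a (Poly_Mapping.single x b) = Poly_Mapping.single x (a * b)"
  by (rule poly_mapping_eqI) (simp add: lookup_single when_def)

lemma smul_sum: "smul a (\<Sum>x\<in>A. f x) = (\<Sum>x\<in>A. smul a (f x))"
  by (induction A rule: infinite_finite_induct) (simp_all add: smul_add)

lemma smul_mult_left: "smul a (p * q) = smul a p * q"
  and smul_mult_right: "smul a (p * q) = p * smul a q"
  for p q :: "'g word \<Rightarrow>\<^sub>0 'k::field"
proof -
  have l: "smul a p = Poly_Mapping.single 0 a * p" for p :: "'g word \<Rightarrow>\<^sub>0 'k"
    by (simp add: smul_def mult_map_scale_conv_mult)
  show "smul a (p * q) = smul a p * q"
    by (simp add: l mult.assoc)
  have c: "Poly_Mapping.single 0 a * p = p * Poly_Mapping.single 0 a"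
  proof (induction p rule: Poly_Mapping.update_induct)
    case const
    then show ?case by simp
  next
    case (update f x b)
    have "Poly_Mapping.update x b f = f + Poly_Mapping.single x b"
      using update(1)
      by (intro poly_mapping_eqI)
        (auto simp: lookup_update lookup_add lookup_single when_def in_keys_iff)
    then show ?case
      by (simp add: update ring_distribs mult_single mult.commute)
  qed
  show "smul a (p * q) = p * smul a q"
    by (simp add: l c mult.assoc [symmetric])
qed

definition lin :: "('a \<Rightarrow> ('b \<Rightarrow>\<^sub>0 'k::field)) \<Rightarrow> ('a \<Rightarrow>\<^sub>0 'k) \<Rightarrow> ('b \<Rightarrow>\<^sub>0 'k)" where
  "lin f s = (\<Sum>a\<in>keys s. smul (coef s a) (f a))"

lemma lin_superset:
  assumes "finite A" "keys s \<subseteq> A"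
  shows "lin f s = (\<Sum>a\<in>A. smul (coef s a) (f a))"
  unfolding lin_def using assms
  by (intro sum.mono_neutral_left) (auto simp: in_keys_iff)

lemma lin_single [simp]: "lin f (Poly_Mapping.single a b) = smul b (f a)"
  by (simp add: lin_def)

lemma lin_0 [simp]: "lin f 0 = 0"
  by (simp add: lin_def)

lemma lin_add: "lin f (s + t) = lin f s + lin f t"
proof -
  let ?A = "keys s \<union> keys t"
  have "lin f (s + t) = (\<Sum>a\<in>?A. smul (coef (s + t) a) (f a))"
    using Poly_Mapping.keys_add[of s t] by (intro lin_superset) auto
  also have "\<dots> = (\<Sum>a\<in>?A. smul (coef s a) (f a)) + (\<Sum>a\<in>?A. smul (coef t a) (f a))"
    by (simp add: lookup_add smul_add_left sum.distrib)
  also have "\<dots> = lin f s + lin f t"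
    using lin_superset[of ?A s f] lin_superset[of ?A t f] by simp
  finally show ?thesis .
qed

lemma lin_smul: "lin f (smul b s) = smul b (lin f s)"
proof -
  have "keys (smul b s) \<subseteq> keys s"
    by (auto simp: in_keys_iff)
  then have "lin f (smul b s) = (\<Sum>a\<in>keys s. smul (coef (smul b s) a) (f a))"
    by (intro lin_superset) auto
  then show ?thesis
    by (simp add: lin_def smul_sum)
qed

definition linmap :: "(('a \<Rightarrow>\<^sub>0 'k::field) \<Rightarrow> ('b \<Rightarrow>\<^sub>0 'k)) \<Rightarrow> bool" where
  "linmap f \<longleftrightarrow> (\<forall>x y. f (x + y) = f x + f y) \<and> (\<forall>a x. f (smul a x) = smul a (f x))"

lemma linmapI: "(\<And>x y. f (x + y) = f x + f y) \<Longrightarrow> (\<And>a x. f (smul a x) = smul a (f x)) \<Longrightarrow> linmap f"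
  by (simp add: linmap_def)

lemma linmap_add: "linmap f \<Longrightarrow> f (x + y) = f x + f y"
  and linmap_smul: "linmap f \<Longrightarrow> f (smul a x) = smul a (f x)"
  by (simp_all add: linmap_def)

lemma linmap_0: "linmap f \<Longrightarrow> f 0 = 0"
  using linmap_smul[of f 0 0] by simp

lemma linmap_uminus: "linmap f \<Longrightarrow> f (- x) = - f x"
  using linmap_smul[of f "-1" x] by (simp add: smul_minus_left)

lemma linmap_diff: "linmap f \<Longrightarrow> f (x - y) = f x - f y"
  using linmap_add[of f x "- y"] linmap_uminus[of f y] by simp

lemma linmap_sum: "linmap f \<Longrightarrow> f (\<Sum>x\<in>A. g x) = (\<Sum>x\<in>A. f (g x))"
  by (induction A rule: infinite_finite_induct) (simp_all add: linmap_0 linmap_add)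

lemma linmap_lin [simp, intro]: "linmap (lin f)"
  by (simp add: linmap_def lin_add lin_smul)

lemmas lin_diff = linmap_diff [OF linmap_lin]
  and lin_sum = linmap_sum [OF linmap_lin]

lemma linmap_lin_apply: "linmap g \<Longrightarrow> g (lin f s) = lin (\<lambda>a. g (f a)) s"
  by (simp add: lin_def linmap_sum linmap_smul)

lemma lin_lin: "lin g (lin f s) = lin (\<lambda>a. lin g (f a)) s"
  by (rule linmap_lin_apply) simp

lemma sum_coef_delta: "(\<Sum>x\<in>keys (s :: 'a \<Rightarrow>\<^sub>0 'k::field). coef s x * (if x = k then 1 else 0)) = coef s k"
proof -
  have "(\<Sum>x\<in>keys s. coef s x * (if x = k then 1 else 0)) = (\<Sum>x\<in>keys s. if x = k then coef s x else 0)"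
    by (rule sum.cong) auto
  then show ?thesis
    by (simp add: sum.delta in_keys_iff)
qed

lemma lin_bas [simp]: "lin bas s = s"
  by (rule poly_mapping_eqI) (simp add: lin_def lookup_sum lookup_single when_def sum_coef_delta)

lemma linmap_eq_lin: "linmap g \<Longrightarrow> g s = lin (\<lambda>a. g (bas a)) s"
  using linmap_lin_apply[of g bas s] by simp

lemma lin_cong: "(\<And>a. a \<in> keys s \<Longrightarrow> f a = g a) \<Longrightarrow> lin f s = lin g s"
  by (simp add: lin_def)

lemma linmap_eqI:
  "linmap f \<Longrightarrow> linmap g \<Longrightarrow> (\<And>a. a \<in> keys s \<Longrightarrow> f (bas a) = g (bas a)) \<Longrightarrow> f s = g s"
  by (subst linmap_eq_lin[of f], assumption, subst linmap_eq_lin[of g], assumption) (rule lin_cong)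

lemma lin_fun_add: "lin (\<lambda>a. f a + g a) s = lin f s + lin g s"
  by (simp add: lin_def smul_add sum.distrib)

lemma lin_fun_diff: "lin (\<lambda>a. f a - g a) s = lin f s - lin g s"
  by (simp add: lin_def smul_diff sum_subtractf)

lemma lin_fun_smul: "lin (\<lambda>a. smul b (f a)) s = smul b (lin f s)"
  by (simp add: lin_def smul_sum mult.commute)

lemma lin_fun_0 [simp]: "lin (\<lambda>a. 0) s = 0"
  by (simp add: lin_def)

lemma lin_swap: "lin (\<lambda>a. lin (f a) t) s = lin (\<lambda>b. lin (\<lambda>a. f a b) s) t"
  unfolding lin_def smul_sum by (subst sum.swap) (simp add: mult.commute)

lemma linmap_comp: "linmap f \<Longrightarrow> linmap g \<Longrightarrow> linmap (\<lambda>x. f (g x))"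
  by (simp add: linmap_def)

lemma linmap_id [intro]: "linmap (\<lambda>x. x)"
  and linmap_plus: "linmap f \<Longrightarrow> linmap g \<Longrightarrow> linmap (\<lambda>x. f x + g x)"
  and linmap_minus: "linmap f \<Longrightarrow> linmap g \<Longrightarrow> linmap (\<lambda>x. f x - g x)"
  and linmap_scale: "linmap f \<Longrightarrow> linmap (\<lambda>x. smul a (f x))"
  and linmap_zero: "linmap (\<lambda>x. 0)"
  by (auto simp add: linmap_def smul_add smul_diff mult.commute)

lemma linmap_lin_param: "(\<And>a. linmap (f a)) \<Longrightarrow> linmap (\<lambda>x. lin (\<lambda>a. f a x) s)"
  by (rule linmapI) (simp_all add: linmap_add linmap_smul lin_fun_add lin_fun_smul)

lemma linmap_times_left: "linmap (\<lambda>p. a * p)"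
  and linmap_times_right: "linmap (\<lambda>p. p * a)"
  for a :: "'g word \<Rightarrow>\<^sub>0 'k::field"
  by (simp_all add: linmap_def ring_distribs flip: smul_mult_left smul_mult_right)

lemma bas_times_bas: "bas u * bas v = (bas (u + v) :: 'g word \<Rightarrow>\<^sub>0 'k::field)"
  by (simp add: mult_single)

lemma keys_lin: "keys (lin f s) \<subseteq> (\<Union>a\<in>keys s. keys (f a))"
proof
  fix x assume "x \<in> keys (lin f s)"
  then have "(\<Sum>a\<in>keys s. coef s a * coef (f a) x) \<noteq> 0"
    by (simp add: in_keys_iff lin_def lookup_sum)
  then obtain a where "a \<in> keys s" "coef s a * coef (f a) x \<noteq> 0"
    using sum.not_neutral_contains_not_neutral by blast
  then show "x \<in> (\<Union>a\<in>keys s. keys (f a))"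
    by (auto simp: in_keys_iff)
qed

lemma keys_smul: "keys (smul a s) \<subseteq> keys s"
  by (auto simp: in_keys_iff)

definition subsp :: "('a \<Rightarrow>\<^sub>0 'k::field) set \<Rightarrow> bool" where
  "subsp S \<longleftrightarrow> 0 \<in> S \<and> (\<forall>x\<in>S. \<forall>y\<in>S. x + y \<in> S) \<and> (\<forall>a. \<forall>x\<in>S. smul a x \<in> S)"

lemma subspI: "0 \<in> S \<Longrightarrow> (\<And>x y. x \<in> S \<Longrightarrow> y \<in> S \<Longrightarrow> x + y \<in> S) \<Longrightarrow>
    (\<And>a x. x \<in> S \<Longrightarrow> smul a x \<in> S) \<Longrightarrow> subsp S"
  by (simp add: subsp_def)

lemma subsp_0: "subsp S \<Longrightarrow> 0 \<in> S"
  and subsp_add: "subsp S \<Longrightarrow> x \<in> S \<Longrightarrow> y \<in> S \<Longrightarrow> x + y \<in> S"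
  and subsp_smul: "subsp S \<Longrightarrow> x \<in> S \<Longrightarrow> smul a x \<in> S"
  by (simp_all add: subsp_def)

lemma subsp_uminus: "subsp S \<Longrightarrow> x \<in> S \<Longrightarrow> - x \<in> S"
  using subsp_smul[of S x "-1"] by (simp add: smul_minus_left)

lemma subsp_diff: "subsp S \<Longrightarrow> x \<in> S \<Longrightarrow> y \<in> S \<Longrightarrow> x - y \<in> S"
  using subsp_add[of S x "- y"] subsp_uminus[of S y] by simp

lemma subsp_sum: "subsp S \<Longrightarrow> (\<And>x. x \<in> A \<Longrightarrow> f x \<in> S) \<Longrightarrow> (\<Sum>x\<in>A. f x) \<in> S"
  by (induction A rule: infinite_finite_induct) (simp_all add: subsp_0 subsp_add)

lemma subsp_sum_list: "subsp S \<Longrightarrow> (\<And>x. x \<in> set xs \<Longrightarrow> x \<in> S) \<Longrightarrow> sum_list xs \<in> S"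
  by (induction xs) (simp_all add: subsp_0 subsp_add)

lemma lin_mem: "subsp S \<Longrightarrow> (\<And>a. a \<in> keys s \<Longrightarrow> f a \<in> S) \<Longrightarrow> lin f s \<in> S"
  unfolding lin_def by (intro subsp_sum subsp_smul)

lemma linmap_mem: "linmap g \<Longrightarrow> subsp S \<Longrightarrow> (\<And>a. a \<in> keys s \<Longrightarrow> g (bas a) \<in> S) \<Longrightarrow> g s \<in> S"
  by (subst linmap_eq_lin) (auto intro: lin_mem)

lemma subsp_image:
  assumes "linmap f" "subsp S"
  shows "subsp (f ` S)"
proof (rule subspI)
  show "0 \<in> f ` S"
    using linmap_0[OF assms(1)] subsp_0[OF assms(2)] by force
  show "x + y \<in> f ` S" if "x \<in> f ` S" "y \<in> f ` S" for x y
    using that subsp_add[OF assms(2)] by (auto simp flip: linmap_add[OF assms(1)])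
  show "smul a x \<in> f ` S" if "x \<in> f ` S" for a x
    using that subsp_smul[OF assms(2)] by (auto simp flip: linmap_smul[OF assms(1)])
qed

lemma subsp_keys: "subsp {s. keys s \<subseteq> A}"
proof (rule subspI, simp_all)
  show "keys (x + y) \<subseteq> A" if "keys x \<subseteq> A" "keys y \<subseteq> A" for x y :: "'a \<Rightarrow>\<^sub>0 'b"
    using that Poly_Mapping.keys_add[of x y] by blast
  show "keys (smul a x) \<subseteq> A" if "keys x \<subseteq> A" for a :: 'b and x :: "'a \<Rightarrow>\<^sub>0 'b"
    using that keys_smul[of a x] by blast
qed

text \<open>All projections used below keep the basis vectors from some set: homogeneous components,
  levels, and the projections \<open>proj_P\<close> and \<open>proj_pi\<close> after passage to the
  module.\<close>

definition res :: "('a \<Rightarrow> bool) \<Rightarrow> ('a \<Rightarrow>\<^sub>0 'k::field) \<Rightarrow> ('a \<Rightarrow>\<^sub>0 'k)" where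
  "res P = lin (\<lambda>a. if P a then bas a else 0)"

lemma linmap_res [simp, intro]: "linmap (res P)"
  by (simp add: res_def)

lemmas res_add = linmap_add [OF linmap_res]
  and res_diff = linmap_diff [OF linmap_res]
  and res_smul = linmap_smul [OF linmap_res]

lemma res_0 [simp]: "res P 0 = 0"
  by (simp add: res_def)

lemma res_single: "res P (Poly_Mapping.single a b) = (if P a then Poly_Mapping.single a b else 0)"
  by (simp add: res_def smul_single)

lemma coef_res [simp]: "coef (res P s) a = (if P a then coef s a else 0)"
proof -
  have "coef (res P s) a = (\<Sum>x\<in>keys s. coef s x * (if x = a then 1 else 0) * (if P a then 1 else 0))"
    unfolding res_def lin_def lookup_sum
    by (intro sum.cong refl) (auto simp: lookup_single when_def)
  then show ?thesis
    by (simp add: sum_distrib_right[symmetric] sum_coef_delta)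
qed

lemma keys_res: "keys (res P s) = {a \<in> keys s. P a}"
  by (auto simp: in_keys_iff split: if_splits)

lemma res_all: "(\<And>a. a \<in> keys s \<Longrightarrow> P a) \<Longrightarrow> res P s = s"
  by (rule poly_mapping_eqI) (auto simp: in_keys_iff)

lemma res_none: "(\<And>a. a \<in> keys s \<Longrightarrow> \<not> P a) \<Longrightarrow> res P s = 0"
  by (rule poly_mapping_eqI) (auto simp: in_keys_iff)

lemma res_lin: "res P (lin f s) = lin (\<lambda>a. res P (f a)) s"
  by (rule linmap_lin_apply) simp

lemma lin_res: "lin f (res P s) = lin (\<lambda>a. if P a then f a else 0) s"
  unfolding res_def lin_lin by (rule lin_cong) simp

lemma sum_res_partition:
  assumes "finite D" "\<And>a. a \<in> keys s \<Longrightarrow> d a \<in> D"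
  shows "s = (\<Sum>l\<in>D. res (\<lambda>a. d a = l) s)"
proof (rule poly_mapping_eqI)
  fix a
  have "coef (\<Sum>l\<in>D. res (\<lambda>a. d a = l) s) a = (\<Sum>l\<in>D. if l = d a then coef s a else 0)"
    unfolding lookup_sum by (rule sum.cong) auto
  also have "\<dots> = coef s a"
    using assms by (auto simp: sum.delta in_keys_iff)
  finally show "coef s a = coef (\<Sum>l\<in>D. res (\<lambda>a. d a = l) s) a" by simp
qed


section \<open>Words and twisted derivations\<close>

abbreviation var :: "'g \<Rightarrow> 'g word" where "var i \<equiv> Word [i]"
abbreviation wlen :: "'g word \<Rightarrow> nat" where "wlen w \<equiv> length (letters w)"

lemma letters_plus [simp]: "letters (u + v) = letters u @ letters v"
  and letters_0 [simp]: "letters 0 = []"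
  by (simp_all add: plus_word_def zero_word_def)

lemma wlen_eq_0 [simp]: "letters w = [] \<longleftrightarrow> w = 0"
  by (cases w) (simp add: zero_word_def)

lemma var_plus_ne_0 [simp]: "var i + w \<noteq> 0" "0 \<noteq> var i + w" "var i \<noteq> 0" "0 \<noteq> var i"
  by (simp_all add: zero_word_def plus_word_def)

lemma var_plus_eq [simp]: "var i + u = var j + v \<longleftrightarrow> i = j \<and> u = v"
  by (cases u; cases v) (simp add: plus_word_def)

lemma var_plus_eq_var [simp]: "var i + u = var j \<longleftrightarrow> i = j \<and> u = 0"
  using var_plus_eq[of i u j 0] by (simp del: var_plus_eq)

lemma word_induct [case_names zero step]:
  assumes "P 0" "\<And>i w. P w \<Longrightarrow> P (var i + w)"
  shows "P w"
proof (cases w)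
  case (Word l)
  have "P (Word l)"
  proof (induction l)
    case Nil
    show ?case using assms(1) unfolding zero_word_def .
  next
    case (Cons i l)
    show ?case using assms(2)[OF Cons, of i] unfolding plus_word_def by simp
  qed
  with Word show ?thesis by simp
qed

abbreviation zdeg :: "'i::finite word \<Rightarrow> int ^ 'i" where "zdeg w \<equiv> zvec (wdeg w)"

lemma zvec_0 [simp]: "zvec 0 = 0"
  and zvec_plus: "zvec (a + b) = zvec a + zvec b"
  by (simp_all add: zvec_def vec_eq_iff)

lemma zvec_inj: "zvec a = zvec b \<longleftrightarrow> a = b"
  by (simp add: zvec_def vec_eq_iff)

lemma wdeg_0 [simp]: "wdeg 0 = 0"
  and wdeg_plus: "wdeg (u + v) = wdeg u + wdeg v"
  by (simp_all add: wdeg_def vec_eq_iff)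

lemma zdeg_var [simp]: "zdeg (var i) = alpha i"
  by (simp add: wdeg_def zvec_def alpha_def axis_def vec_eq_iff)

lemma zdeg_plus [simp]: "zdeg (u + v) = zdeg u + zdeg v"
  by (simp add: wdeg_plus zvec_plus)

text \<open>Total degree. It vanishes on the weights of \<open>H_theta\<close>, and this is what
  finally keeps \<open>K_(- deg p)\<close> out of \<open>H_theta\<close>.\<close>

definition height :: "int ^ 'i::finite \<Rightarrow> int" where
  "height l = (\<Sum>i\<in>UNIV. l $ i)"

lemma height_plus: "height (a + b) = height a + height b"
  and height_minus: "height (a - b) = height a - height b"
  and height_uminus: "height (- a) = - height a"
  and height_0: "height 0 = 0"
  by (simp_all add: height_def sum.distrib sum_subtractf sum_negf)

lemma height_alpha: "height (alpha i) = 1"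
  by (simp add: height_def alpha_def axis_def)

lemma height_zdeg: "height (zdeg w) = int (wlen w)"
  by (induction w rule: word_induct) (simp_all add: height_plus height_alpha height_0)

lemma wdeg_eq_imp_wlen: "wdeg u = wdeg v \<Longrightarrow> wlen u = wlen v"
  using height_zdeg[of u] height_zdeg[of v] by simp

lemma wdeg_eq_0: "wdeg w = 0 \<Longrightarrow> w = 0"
  using wdeg_eq_imp_wlen[of w 0] by simp

lemma smul_bas: "smul a (bas x) = Poly_Mapping.single x a"
  by (simp add: smul_single)

lemma lin_times_left: "lin f (bas u * p) = lin (\<lambda>v. f (u + v)) p"
  for p :: "'g word \<Rightarrow>\<^sub>0 'k::field"
proof -
  have "bas u * p = lin (\<lambda>v. bas (u + v)) p"
    by (subst linmap_eq_lin[OF linmap_times_left]) (simp add: bas_times_bas)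
  then show ?thesis by (simp add: lin_lin)
qed

locale pre_nichols_pair =
  fixes chi :: "int ^ 'i::finite \<Rightarrow> int ^ 'i \<Rightarrow> 'k::field"
    and I :: "('k, 'i) ncpoly set"
    and tau :: "'i \<Rightarrow> 'i"
    and c :: "'k ^ 'i"
  assumes bichar: "bicharacter chi"
    and q_sym: "\<And>i j. qmat chi i j = qmat chi j i"
    and biideal: "graded_biideal chi I"
    and tau_tau: "tau \<circ> tau = id"
    and q_tau: "\<And>i j. qmat chi (tau i) (tau j) = qmat chi i j"
    and tau_I: "tau_hom tau ` I = I"
begin

lemma tau_invol [simp]: "tau (tau i) = i"
  using tau_tau by (simp add: fun_eq_iff)

lemma chi_nz [simp]: "chi a b \<noteq> 0"
  and chi_add_left: "chi (a + b) d = chi a d * chi b d"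
  and chi_add_right: "chi a (b + d) = chi a b * chi a d"
  using bichar unfolding bicharacter_def by blast+

lemma chi_0_left [simp]: "chi 0 b = 1"
  using chi_add_left[of 0 0 b] by simp

lemma chi_0_right [simp]: "chi a 0 = 1"
  using chi_add_right[of a 0 0] by simp

lemma chi_uminus_left: "chi (- a) b = inverse (chi a b)"
  using chi_add_left[of a "- a" b] by (simp add: field_simps)

lemma chi_uminus_right: "chi a (- b) = inverse (chi a b)"
  using chi_add_right[of a b "- b"] by (simp add: field_simps)

lemma chi_diff_left: "chi (a - b) d = chi a d / chi b d"
  using chi_add_left[of a "- b" d] by (simp add: chi_uminus_left field_simps)

lemma chi_diff_right: "chi a (b - d) = chi a b / chi a d"
  using chi_add_right[of a b "- d"] by (simp add: chi_uminus_right field_simps)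

lemmas chi_simps = chi_add_left chi_add_right chi_uminus_left chi_uminus_right
  chi_diff_left chi_diff_right

text \<open>The first two skew derivations describe how \<open>F_i\<close> moves past a monomial
  E_w: by \<open>gF_Ew\<close> the letters removed by the first leave K_i behind and those removed
  by the second leave its inverse. The third is a left-handed version, which the coproduct yields
  directly.\<close>

fun rdl :: "'i \<Rightarrow> 'i list \<Rightarrow> ('k, 'i) ncpoly" where
  "rdl i [] = 0"
| "rdl i (j # w) = (if i = j then smul (chi (alpha i) (zdeg (Word w))) (bas (Word w)) else 0)
     + bas (var j) * rdl i w"

fun rml :: "'i \<Rightarrow> 'i list \<Rightarrow> ('k, 'i) ncpoly" where
  "rml i [] = 0"
| "rml i (j # w) = (if i = j then smul (inverse (chi (alpha i) (zdeg (Word w)))) (bas (Word w)) else 0)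
     + bas (var j) * rml i w"

fun ldl :: "'i \<Rightarrow> 'i list \<Rightarrow> ('k, 'i) ncpoly" where
  "ldl i [] = 0"
| "ldl i (j # w) = (if i = j then bas (Word w) else 0)
     + smul (chi (alpha i) (alpha j)) (bas (var j) * ldl i w)"

text \<open>\<open>Dp i w\<close> is the sum of \<open>chi(alpha_i, w'') w' w''\<close> over all factorizations
  \<open>w = w' x_i w''\<close>; \<open>Dm i\<close> uses the inverses of these scalars, and \<open>Dl i\<close> the
  scalars \<open>chi(alpha_i, w')\<close>.\<close>

definition Dp :: "'i \<Rightarrow> 'i word \<Rightarrow> ('k, 'i) ncpoly" where "Dp i w = rdl i (letters w)"
definition Dm :: "'i \<Rightarrow> 'i word \<Rightarrow> ('k, 'i) ncpoly" where "Dm i w = rml i (letters w)"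
definition Dl :: "'i \<Rightarrow> 'i word \<Rightarrow> ('k, 'i) ncpoly" where "Dl i w = ldl i (letters w)"

lemma Dp_0 [simp]: "Dp i 0 = 0" and Dm_0 [simp]: "Dm i 0 = 0" and Dl_0 [simp]: "Dl i 0 = 0"
  by (simp_all add: Dp_def Dm_def Dl_def)

lemma Dp_step: "Dp i (var j + w) =
    (if i = j then smul (chi (alpha i) (zdeg w)) (bas w) else 0) + bas (var j) * Dp i w"
  and Dm_step: "Dm i (var j + w) =
    (if i = j then smul (inverse (chi (alpha i) (zdeg w))) (bas w) else 0) + bas (var j) * Dm i w"
  and Dl_step: "Dl i (var j + w) =
    (if i = j then bas w else 0) + smul (chi (alpha i) (alpha j)) (bas (var j) * Dl i w)"
  by (simp_all add: Dp_def Dm_def Dl_def)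

lemma keys_bas_times: "keys (bas u * p) = (\<lambda>v. u + v) ` keys p" for p :: "('k, 'g) ncpoly"
proof -
  have "keys (bas u * p) \<subseteq> (\<lambda>v. u + v) ` keys p"
    using keys_mult[of "bas u" p] by auto
  moreover have "coef (bas u * p) (u + v) = coef p v" for v
  proof -
    have "bas u * p = lin (\<lambda>v. bas (u + v)) p"
      by (subst linmap_eq_lin[OF linmap_times_left]) (simp add: bas_times_bas)
    moreover have "u + v' = u + v \<longleftrightarrow> v' = v" for v'
      by (cases u; cases v; cases v') (simp add: plus_word_def)
    ultimately show ?thesis
      using sum_coef_delta[of p v] by (simp add: lin_def lookup_sum lookup_single when_def)
  qed
  ultimately show ?thesis
    by (auto simp: in_keys_iff)
qed

lemma keys_Dm_Dl_aux:
  assumes "\<And>j w. D (var j + w) = (if i = j then smul (a w) (bas w) else 0) + smul (b j) (bas (var j) * D w)"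
    and "D 0 = (0 :: ('k, 'i) ncpoly)" and "v \<in> keys (D w)"
  shows "zdeg w = alpha i + zdeg v"
  using assms(3)
proof (induction w arbitrary: v rule: word_induct)
  case zero
  then show ?case using assms(2) by simp
next
  case (step j w)
  from step.prems have "v \<in> keys (if i = j then smul (a w) (bas w) else 0) \<or> v \<in> keys (bas (var j) * D w)"
    using Poly_Mapping.keys_add[of "if i = j then smul (a w) (bas w) else 0" "smul (b j) (bas (var j) * D w)"]
      keys_smul[of "b j" "bas (var j) * D w"] by (auto simp: assms(1))
  then show ?case
  proof
    assume "v \<in> keys (if i = j then smul (a w) (bas w) else 0)"
    then show ?thesis
      using keys_smul[of "a w" "bas w"] by (auto split: if_splits)
  next
    assume "v \<in> keys (bas (var j) * D w)"
    then show ?thesis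
      using step.IH by (auto simp: keys_bas_times)
  qed
qed

lemma keys_Dp: "v \<in> keys (Dp i w) \<Longrightarrow> zdeg w = alpha i + zdeg v"
  by (rule keys_Dm_Dl_aux[of "Dp i" i "\<lambda>w. chi (alpha i) (zdeg w)" "\<lambda>_. 1"]) (simp_all add: Dp_step)

lemma keys_Dm: "v \<in> keys (Dm i w) \<Longrightarrow> zdeg w = alpha i + zdeg v"
  by (rule keys_Dm_Dl_aux[of "Dm i" i "\<lambda>w. inverse (chi (alpha i) (zdeg w))" "\<lambda>_. 1"])
    (simp_all add: Dm_step)

text \<open>For a factorization w = w' x_i w'' bimultiplicativity gives chi(alpha_i, w) =
  chi(alpha_i, w') chi(alpha_i, alpha_i) chi(alpha_i, w''), so the two families of scalars differ by
  a factor that depends on the degree of w only. This transfers stability of graded ideals from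
  \<open>Dl\<close> to \<open>Dm\<close>.\<close>

lemma Dm_eq_Dl: "Dm i w = smul (chi (alpha i) (alpha i) / chi (alpha i) (zdeg w)) (Dl i w)"
proof (induction w rule: word_induct)
  case (step j w)
  then show ?case
    by (auto simp: Dm_step Dl_step smul_add chi_simps smul_mult_right field_simps)
qed simp


section \<open>The braided coproduct\<close>

definition cop :: "'i word \<Rightarrow> ('k, 'i) ncpoly2" where
  "cop w = word_coproduct chi (letters w)"

lemma braided_coproduct_lin: "braided_coproduct chi p = lin cop p"
  by (simp add: braided_coproduct_def lin_def cop_def smul_def)

lemma tens_eq: "tens a b = lin (\<lambda>u. lin (\<lambda>v. bas (u, v)) b) a"
  by (simp add: tens_def lin_def smul_sum smul_single)

lemma braided_mult_eq: "braided_mult chi s t =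
    lin (\<lambda>(u, v). lin (\<lambda>(u', v'). smul (chi (zdeg v) (zdeg u')) (bas (u + u', v + v'))) t) s"
  unfolding braided_mult_def lin_def smul_sum
  by (intro sum.cong refl) (simp add: smul_single case_prod_unfold smul_sum mult_ac)

lemma cop_0: "cop 0 = bas (0, 0)"
  by (simp add: cop_def tens_def)

lemma cop_step: "cop (var i + w) =
    lin (\<lambda>(u, v). bas (var i + u, v) + smul (chi (alpha i) (zdeg u)) (bas (u, var i + v))) (cop w)"
proof -
  have "tens (ncvar i) 1 + tens 1 (ncvar i) = (bas (var i, 0) + bas (0, var i) :: ('k, 'i) ncpoly2)"
    by (simp add: tens_def ncvar_def)
  then show ?thesis
    by (simp add: cop_def braided_mult_eq lin_add lin_fun_add[symmetric] case_prod_unfold)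
qed

text \<open>Identities for the coproduct are proved by induction on the word after testing both
  sides against a family \<open>\<beta>\<close> indexed by pairs of words.\<close>

lemma lin_cop_step: "lin \<beta> (cop (var i + w)) =
    lin (\<lambda>(u, v). \<beta> (var i + u, v) + smul (chi (alpha i) (zdeg u)) (\<beta> (u, var i + v))) (cop w)"
  unfolding cop_step lin_lin by (rule lin_cong) (simp add: case_prod_unfold lin_add lin_smul)

lemma keys_cop: "(u, v) \<in> keys (cop w) \<Longrightarrow> zdeg w = zdeg u + zdeg v"
proof (induction w arbitrary: u v rule: word_induct)
  case zero
  then show ?case by (simp add: cop_0)
next
  case (step i w)
  obtain u' v' where uv: "(u', v') \<in> keys (cop w)"
    and k: "(u, v) \<in> keys (bas (var i + u', v') + smul (chi (alpha i) (zdeg u')) (bas (u', var i + v')))"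
    using step.prems keys_lin unfolding cop_step by (force simp: case_prod_unfold)
  from k have "(u, v) = (var i + u', v') \<or> (u, v) = (u', var i + v')"
    using Poly_Mapping.keys_add keys_smul by (fastforce simp: smul_single split: if_splits)
  with step.IH[OF uv] show ?case
    by auto
qed

lemma cop_counit_right: "lin (\<lambda>(u, v). if v = 0 then f u else 0) (cop w) = f w"
proof (induction w arbitrary: f rule: word_induct)
  case zero
  show ?case by (simp add: cop_0)
next
  case (step i w)
  have "lin (\<lambda>(u, v). if v = 0 then f u else 0) (cop (var i + w))
      = lin (\<lambda>(u, v). if v = 0 then f (var i + u) else 0) (cop w)"
    unfolding lin_cop_step by (rule lin_cong) auto
  then show ?case using step[of "\<lambda>u. f (var i + u)"] by simp
qed

lemma cop_counit_left: "lin (\<lambda>(u, v). if u = 0 then f v else 0) (cop w) = f w"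
proof (induction w arbitrary: f rule: word_induct)
  case zero
  show ?case by (simp add: cop_0)
next
  case (step i w)
  have "lin (\<lambda>(u, v). if u = 0 then f v else 0) (cop (var i + w))
      = lin (\<lambda>(u, v). if u = 0 then f (var i + v) else 0) (cop w)"
    unfolding lin_cop_step by (rule lin_cong) auto
  then show ?case using step[of "\<lambda>u. f (var i + u)"] by simp
qed

text \<open>Selecting one occurrence of x_i for the right tensor factor moves it past the letters
  behind it, which gives the scalar chi(alpha_i, w''). Stability of a biideal under the skew
  derivations thus follows from its coproduct condition.\<close>

lemma Dp_cop: "lin (\<lambda>(u, v). if v = var i then bas u else 0) (cop w) = Dp i w"
proof (induction w rule: word_induct)
  case zero
  show ?case by (simp add: cop_0)
next
  case (step j w)
  have "lin (\<lambda>(u, v). if v = var i then bas u else 0) (cop (var j + w))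
      = lin (\<lambda>x. bas (var j) * (case x of (u, v) \<Rightarrow> if v = var i then bas u else 0)
         + (case x of (u, v) \<Rightarrow> if v = 0 then (if i = j then smul (chi (alpha j) (zdeg u)) (bas u) else 0) else 0))
         (cop w)"
    unfolding lin_cop_step by (rule lin_cong) (auto simp: bas_times_bas)
  also have "\<dots> = bas (var j) * Dp i w + (if i = j then smul (chi (alpha j) (zdeg w)) (bas w) else 0)"
    by (simp add: lin_fun_add cop_counit_right linmap_lin_apply[OF linmap_times_left, symmetric] step)
  finally show ?case
    by (simp add: Dp_step add.commute)
qed

text \<open>Here all letters in front of the chosen x_i pass it, and symmetry of q turns their
  scalars into chi(alpha_i, w').\<close>

lemma Dl_cop: "lin (\<lambda>(u, v). if u = var i then bas v else 0) (cop w) = Dl i w"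
proof (induction w rule: word_induct)
  case zero
  show ?case by (simp add: cop_0)
next
  case (step j w)
  have "lin (\<lambda>(u, v). if u = var i then bas v else 0) (cop (var j + w))
      = lin (\<lambda>x. smul (chi (alpha i) (alpha j)) (bas (var j) * (case x of (u, v) \<Rightarrow> if u = var i then bas v else 0))
         + (case x of (u, v) \<Rightarrow> if u = 0 then (if i = j then bas v else 0) else 0))
         (cop w)"
    unfolding lin_cop_step by (rule lin_cong) (auto simp: bas_times_bas q_sym)
  also have "\<dots> = smul (chi (alpha i) (alpha j)) (bas (var j) * Dl i w) + (if i = j then bas w else 0)"
    by (simp add: lin_fun_add lin_fun_smul cop_counit_left linmap_lin_apply[OF linmap_times_left, symmetric] step)
  finally show ?case
    by (simp add: Dl_step add.commute)
qed

text \<open>Coassociativity: \<open>(id \<otimes> Dl_j) \<Delta> = (Dp_j \<otimes> id) \<Delta>\<close>.\<close>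

lemma cop_Dl_Dp: "lin (\<lambda>(u, v). lin (\<beta> u) (Dl j v)) (cop w) =
    lin (\<lambda>(u, v). lin (\<lambda>u'. \<beta> u' v) (Dp j u)) (cop w)"
proof (induction w arbitrary: \<beta> rule: word_induct)
  case zero
  show ?case by (simp add: cop_0)
next
  case (step i w)
  let ?d = "\<lambda>x. case x of (u, v) \<Rightarrow> if i = j then smul (chi (alpha i) (zdeg u)) (\<beta> u v) else 0"
  let ?c = "\<lambda>u v. smul (chi (alpha i) (zdeg u) * chi (alpha i) (alpha j)) (\<beta> u (var i + v))"
  have "lin (\<lambda>(u, v). lin (\<beta> u) (Dl j v)) (cop (var i + w)) =
      lin (\<lambda>x. (case x of (u, v) \<Rightarrow> lin (\<beta> (var i + u)) (Dl j v)) + ?d x +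
         (case x of (u, v) \<Rightarrow> lin (?c u) (Dl j v))) (cop w)"
    unfolding lin_cop_step
    by (rule lin_cong)
      (auto simp: Dl_step lin_add lin_smul smul_add lin_times_left lin_fun_smul q_sym)
  also have "\<dots> = lin (\<lambda>x. (case x of (u, v) \<Rightarrow> lin (\<lambda>u'. \<beta> (var i + u') v) (Dp j u)) + ?d x +
         (case x of (u, v) \<Rightarrow> lin (\<lambda>u'. ?c u' v) (Dp j u))) (cop w)"
    using step[of "\<lambda>u v. \<beta> (var i + u) v"] step[of ?c] by (simp add: lin_fun_add)
  also have "\<dots> = lin (\<lambda>(u, v). lin (\<lambda>u'. \<beta> u' v) (Dp j (var i + u)) +
      smul (chi (alpha i) (zdeg u)) (lin (\<lambda>u'. \<beta> u' (var i + v)) (Dp j u))) (cop w)"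
  proof (rule lin_cong)
    fix x assume "x \<in> keys (cop w)"
    obtain u v where x: "x = (u, v)" by (cases x)
    have "lin (\<lambda>u'. ?c u' v) (Dp j u) = lin (\<lambda>u'. smul (chi (alpha i) (zdeg u)) (\<beta> u' (var i + v))) (Dp j u)"
      by (rule lin_cong) (auto dest!: keys_Dp simp: chi_simps q_sym mult.commute)
    then show "(case x of (u, v) \<Rightarrow> lin (\<lambda>u'. \<beta> (var i + u') v) (Dp j u)) + ?d x +
         (case x of (u, v) \<Rightarrow> lin (\<lambda>u'. ?c u' v) (Dp j u)) = (case x of (u, v) \<Rightarrow>
         lin (\<lambda>u'. \<beta> u' v) (Dp j (var i + u)) +
      smul (chi (alpha i) (zdeg u)) (lin (\<lambda>u'. \<beta> u' (var i + v)) (Dp j u)))"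
      by (auto simp: x Dp_step lin_add lin_smul lin_times_left lin_fun_smul)
  qed
  also have "\<dots> = lin (\<lambda>(u, v). lin (\<lambda>u'. \<beta> u' v) (Dp j u)) (cop (var i + w))"
    unfolding lin_cop_step by simp
  finally show ?case .
qed

lemma lin_tens: "lin \<beta> (tens a b) = lin (\<lambda>v. lin (\<lambda>u. \<beta> (u, v)) a) b"
  unfolding tens_eq lin_lin by (subst lin_swap) simp


section \<open>Graded biideals\<close>

lemma free_ring_simps [simp]:
  "carrier (free_ring :: ('k, 'g) ncpoly ring) = UNIV"
  "x \<otimes>\<^bsub>(free_ring :: ('k, 'g) ncpoly ring)\<^esub> y = x * y"
  "x \<oplus>\<^bsub>(free_ring :: ('k, 'g) ncpoly ring)\<^esub> y = x + y"
  "\<one>\<^bsub>(free_ring :: ('k, 'g) ncpoly ring)\<^esub> = 1"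
  "\<zero>\<^bsub>(free_ring :: ('k, 'g) ncpoly ring)\<^esub> = 0"
  by (simp_all add: ring_of_type_algebra_def)

lemma ring_free_ring: "ring (free_ring :: ('k, 'g) ncpoly ring)"
proof -
  have "\<exists>y. x + y = 0" for x :: "('k, 'g) ncpoly"
    using add.right_inverse by blast
  then show ?thesis
    unfolding ring_of_type_algebra_def using add.right_inverse
    by unfold_locales (auto simp: algebra_simps Units_def)
qed

lemma ideal_free_ring_iff: "ideal J (free_ring :: ('k, 'g) ncpoly ring) \<longleftrightarrow>
    subsp J \<and> (\<forall>x\<in>J. \<forall>a. a * x \<in> J \<and> x * a \<in> J)"
proof
  assume J: "ideal J (free_ring :: ('k, 'g) ncpoly ring)"
  then interpret J: ideal J "free_ring :: ('k, 'g) ncpoly ring" .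
  have l: "a * x \<in> J" "x * a \<in> J" if "x \<in> J" for a x
    using J.I_l_closed[of x a] J.I_r_closed[of x a] that by simp_all
  have "smul a x \<in> J" if "x \<in> J" for a x
    using l(1)[OF that, of "Poly_Mapping.single 0 a"]
    by (simp add: smul_def mult_map_scale_conv_mult)
  then show "subsp J \<and> (\<forall>x\<in>J. \<forall>a. a * x \<in> J \<and> x * a \<in> J)"
    using l additive_subgroup.zero_closed[OF J.is_additive_subgroup]
      additive_subgroup.a_closed[OF J.is_additive_subgroup] by (auto intro!: subspI)
next
  assume J: "subsp J \<and> (\<forall>x\<in>J. \<forall>a. a * x \<in> J \<and> x * a \<in> J)"
  interpret F: ring "free_ring :: ('k, 'g) ncpoly ring" by (rule ring_free_ring)
  have m: "\<ominus>\<^bsub>free_ring\<^esub> x = - x" for x :: "('k, 'g) ncpoly"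
    using F.minus_equality[of "- x" x] by simp
  show "ideal J (free_ring :: ('k, 'g) ncpoly ring)"
  proof (rule idealI[OF ring_free_ring])
    show "subgroup J (add_monoid (free_ring :: ('k, 'g) ncpoly ring))"
      using J by (intro F.add.subgroupI)
        (auto simp: m subsp_uminus subsp_add a_inv_def[symmetric] dest: subsp_0)
  qed (use J in auto)
qed

lemma I_subsp: "subsp I"
  and I_left: "p \<in> I \<Longrightarrow> a * p \<in> I"
  and I_right: "p \<in> I \<Longrightarrow> p * a \<in> I"
  using biideal unfolding graded_biideal_def ideal_free_ring_iff by blast+

lemma I_length: "p \<in> I \<Longrightarrow> w \<in> keys p \<Longrightarrow> 2 \<le> wlen w"
  using biideal unfolding graded_biideal_def by blast

lemma hpart_res: "hpart l p = res (\<lambda>w. wdeg w = l) p"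
  by (rule poly_mapping_eqI)
    (auto simp: hpart_def lookup_sum lookup_single when_def in_keys_iff)

lemma I_hpart: "p \<in> I \<Longrightarrow> res (\<lambda>w. wdeg w = l) p \<in> I"
  using biideal unfolding graded_biideal_def hpart_res by blast

text \<open>Coefficients that depend only on the degree of a word are constant on homogeneous
  components, which again lie in \<open>I\<close>.\<close>

lemma I_lin_graded:
  assumes "p \<in> I" "subsp S"
    and "\<And>p l. p \<in> I \<Longrightarrow> mhomogeneous l p \<Longrightarrow> lin (g l) p \<in> S"
  shows "lin (\<lambda>w. g (wdeg w) w) p \<in> S"
proof -
  let ?D = "wdeg ` keys p"
  have "lin (\<lambda>w. g (wdeg w) w) p
      = lin (\<lambda>w. g (wdeg w) w) (\<Sum>l\<in>?D. res (\<lambda>w. wdeg w = l) p)"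
    using sum_res_partition[of ?D p wdeg] by simp
  also have "\<dots> = (\<Sum>l\<in>?D. lin (g l) (res (\<lambda>w. wdeg w = l) p))"
    unfolding lin_sum by (intro sum.cong lin_cong refl) (auto simp: keys_res)
  also have "\<dots> \<in> S"
    by (intro subsp_sum assms I_hpart) (simp add: mhomogeneous_def keys_res)
  finally show ?thesis .
qed

lemma I_lin_scaled:
  assumes "p \<in> I" "subsp S" "\<And>p. p \<in> I \<Longrightarrow> lin g p \<in> S"
  shows "lin (\<lambda>w. smul (f (wdeg w)) (g w)) p \<in> S"
  using assms by (intro I_lin_graded[where g = "\<lambda>l w. smul (f l) (g w)"])
    (simp_all add: lin_fun_smul subsp_smul)

lemma I_res: "p \<in> I \<Longrightarrow> res (\<lambda>w. P (wdeg w)) p \<in> I"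
  using I_lin_scaled[of p I bas "\<lambda>l. if P l then 1 else 0"]
  by (simp add: I_subsp res_def if_distrib[of "\<lambda>a. smul a _"] cong: if_cong)

text \<open>The inclusion \<open>\<Delta>(I) \<subseteq> I \<otimes> T + T \<otimes> I\<close>, tested against a bilinear map \<open>\<beta>\<close>.\<close>

lemma I_cop:
  assumes "p \<in> I" "subsp S"
    and "\<And>a v. a \<in> I \<Longrightarrow> lin (\<lambda>u. \<beta> (u, v)) a \<in> S"
    and "\<And>b u. b \<in> I \<Longrightarrow> lin (\<lambda>v. \<beta> (u, v)) b \<in> S"
  shows "lin (\<lambda>w. lin \<beta> (cop w)) p \<in> S"
proof -
  obtain zs where zs: "\<forall>(a, b)\<in>set zs. a \<in> I \<or> b \<in> I"
    and eq: "lin cop p = (\<Sum>(a, b)\<leftarrow>zs. tens a b)"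
    using biideal assms(1) unfolding graded_biideal_def braided_coproduct_lin by blast
  have "lin (\<lambda>w. lin \<beta> (cop w)) p = lin \<beta> (\<Sum>(a, b)\<leftarrow>zs. tens a b)"
    by (simp add: lin_lin[symmetric] eq)
  also have "\<dots> = (\<Sum>(a, b)\<leftarrow>zs. lin \<beta> (tens a b))"
    by (induction zs) (auto simp: lin_add)
  also have "\<dots> \<in> S"
  proof (rule subsp_sum_list[OF assms(2)], clarsimp)
    fix a b assume "(a, b) \<in> set zs"
    with zs have "a \<in> I \<or> b \<in> I" by auto
    then show "lin \<beta> (tens a b) \<in> S"
    proof
      assume "a \<in> I"
      then show ?thesis
        unfolding lin_tens by (intro lin_mem assms)
    next
      assume "b \<in> I"
      then show ?thesis
        unfolding lin_tens by (subst lin_swap) (intro lin_mem assms)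
    qed
  qed
  finally show ?thesis .
qed

text \<open>In I (x) T + T (x) I the first summand gives elements of \<open>I\<close>, and the
  second gives zero, because elements of \<open>I\<close> contain no words of length one.\<close>

lemma I_Dp: "p \<in> I \<Longrightarrow> lin (Dp i) p \<in> I"
proof -
  assume p: "p \<in> I"
  have "lin (\<lambda>w. lin (\<lambda>(u, v). if v = var i then bas u else 0) (cop w)) p \<in> I"
  proof (rule I_cop[OF p I_subsp])
    fix a and v :: "'i word" assume "a \<in> I"
    then show "lin (\<lambda>u. case (u, v) of (u, v) \<Rightarrow> if v = var i then bas u else 0) a \<in> I"
      by (cases "v = var i") (simp_all add: subsp_0[OF I_subsp])
  next
    fix b and u :: "'i word" assume "b \<in> I"
    then have "lin (\<lambda>v. case (u, v) of (u, v) \<Rightarrow> if v = var i then bas u else 0) b = lin (\<lambda>v. 0) b"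
      by (intro lin_cong) (auto dest: I_length)
    then show "lin (\<lambda>v. case (u, v) of (u, v) \<Rightarrow> if v = var i then bas u else 0) b \<in> I"
      by (simp add: subsp_0[OF I_subsp])
  qed
  then show ?thesis unfolding Dp_cop .
qed

lemma I_Dl: "p \<in> I \<Longrightarrow> lin (Dl i) p \<in> I"
proof -
  assume p: "p \<in> I"
  have "lin (\<lambda>w. lin (\<lambda>(u, v). if u = var i then bas v else 0) (cop w)) p \<in> I"
  proof (rule I_cop[OF p I_subsp])
    fix b and u :: "'i word" assume "b \<in> I"
    then show "lin (\<lambda>v. case (u, v) of (u, v) \<Rightarrow> if u = var i then bas v else 0) b \<in> I"
      by (cases "u = var i") (simp_all add: subsp_0[OF I_subsp])
  next
    fix a and v :: "'i word" assume "a \<in> I"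
    then have "lin (\<lambda>u. case (u, v) of (u, v) \<Rightarrow> if u = var i then bas v else 0) a = lin (\<lambda>v. 0) a"
      by (intro lin_cong) (auto dest: I_length)
    then show "lin (\<lambda>u. case (u, v) of (u, v) \<Rightarrow> if u = var i then bas v else 0) a \<in> I"
      by (simp add: subsp_0[OF I_subsp])
  qed
  then show ?thesis unfolding Dl_cop .
qed

lemma I_Dm: "p \<in> I \<Longrightarrow> lin (Dm i) p \<in> I"
  using I_lin_scaled[of p I "Dl i" "\<lambda>l. chi (alpha i) (alpha i) / chi (alpha i) (zvec l)"]
  by (simp add: I_subsp I_Dl Dm_eq_Dl[abs_def])

end

section \<open>A module with basis \<open>E_u K_m F_v\<close>\<close>

text \<open>The triple \<open>(u, m, v)\<close> stands for \<open>E_u K_m F_v\<close>, and the operators below describe left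
  multiplication by the generators.\<close>

type_synonym ('k, 'i) pbw = "'i word \<times> (int ^ 'i) \<times> 'i word \<Rightarrow>\<^sub>0 'k"

context pre_nichols_pair
begin

definition opE :: "'i \<Rightarrow> ('k, 'i) pbw \<Rightarrow> ('k, 'i) pbw" where
  "opE i = lin (\<lambda>(u, m, v). bas (var i + u, m, v))"

definition opK :: "int ^ 'i \<Rightarrow> ('k, 'i) pbw \<Rightarrow> ('k, 'i) pbw" where
  "opK l = lin (\<lambda>(u, m, v). smul (chi l (zdeg u)) (bas (u, m + l, v)))"

text \<open>In F_i E_u K_m F_v the letter F_i either passes E_u, which is \<open>op0\<close>, or is
  contracted with a letter of E_u by the relation E_i F_i - F_i E_i = K_i - K_i^{-1}. The two kinds
  of contraction are kept apart because they change the degree m - v in opposite directions.\<close>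

definition op0 :: "'i \<Rightarrow> ('k, 'i) pbw \<Rightarrow> ('k, 'i) pbw" where
  "op0 i = lin (\<lambda>(u, m, v). smul (chi m (alpha i)) (bas (u, m, var i + v)))"

definition opDp :: "'i \<Rightarrow> ('k, 'i) pbw \<Rightarrow> ('k, 'i) pbw" where
  "opDp i = lin (\<lambda>(u, m, v). lin (\<lambda>u'. bas (u', m + alpha i, v)) (Dp i u))"

definition opDm :: "'i \<Rightarrow> ('k, 'i) pbw \<Rightarrow> ('k, 'i) pbw" where
  "opDm i = lin (\<lambda>(u, m, v). lin (\<lambda>u'. bas (u', m - alpha i, v)) (Dm i u))"

definition opF :: "'i \<Rightarrow> ('k, 'i) pbw \<Rightarrow> ('k, 'i) pbw" where
  "opF i x = op0 i x - opDp i x + opDm i x"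

lemma linmap_ops [simp, intro]:
  "linmap (opE i)" "linmap (opK l)" "linmap (op0 i)" "linmap (opDp i)" "linmap (opDm i)" "linmap (opF i)"
proof -
  show l: "linmap (opE i)" "linmap (opK l)" "linmap (op0 i)" "linmap (opDp i)" "linmap (opDm i)"
    by (simp_all add: opE_def opK_def op0_def opDp_def opDm_def)
  show "linmap (opF i)"
    unfolding opF_def[abs_def] by (intro linmap_plus linmap_minus l)
qed

lemmas op_lin = linmap_lin_apply [OF linmap_ops(1)] linmap_lin_apply [OF linmap_ops(2)]
    linmap_lin_apply [OF linmap_ops(3)] linmap_lin_apply [OF linmap_ops(4)]
    linmap_lin_apply [OF linmap_ops(5)] linmap_lin_apply [OF linmap_ops(6)]
  and op_add = linmap_add [OF linmap_ops(1)] linmap_add [OF linmap_ops(2)]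
    linmap_add [OF linmap_ops(3)] linmap_add [OF linmap_ops(4)]
    linmap_add [OF linmap_ops(5)] linmap_add [OF linmap_ops(6)]
  and op_diff = linmap_diff [OF linmap_ops(1)] linmap_diff [OF linmap_ops(2)]
    linmap_diff [OF linmap_ops(3)] linmap_diff [OF linmap_ops(4)]
    linmap_diff [OF linmap_ops(5)] linmap_diff [OF linmap_ops(6)]
  and op_smul = linmap_smul [OF linmap_ops(1)] linmap_smul [OF linmap_ops(2)]
    linmap_smul [OF linmap_ops(3)] linmap_smul [OF linmap_ops(4)]
    linmap_smul [OF linmap_ops(5)] linmap_smul [OF linmap_ops(6)]
  and op_0 [simp] = linmap_0 [OF linmap_ops(1)] linmap_0 [OF linmap_ops(2)]
    linmap_0 [OF linmap_ops(3)] linmap_0 [OF linmap_ops(4)]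
    linmap_0 [OF linmap_ops(5)] linmap_0 [OF linmap_ops(6)]

lemmas linmap_intros = linmap_ops linmap_comp [OF linmap_ops(1)] linmap_comp [OF linmap_ops(2)]
  linmap_comp [OF linmap_ops(3)] linmap_comp [OF linmap_ops(4)] linmap_comp [OF linmap_ops(5)]
  linmap_comp [OF linmap_ops(6)] linmap_comp [OF linmap_lin] linmap_plus linmap_minus linmap_scale
  linmap_zero linmap_id

lemma opE_bas: "opE i (bas (u, m, v)) = bas (var i + u, m, v)"
  and opK_bas: "opK l (bas (u, m, v)) = smul (chi l (zdeg u)) (bas (u, m + l, v))"
  and op0_bas: "op0 i (bas (u, m, v)) = smul (chi m (alpha i)) (bas (u, m, var i + v))"
  and opDp_bas: "opDp i (bas (u, m, v)) = lin (\<lambda>u'. bas (u', m + alpha i, v)) (Dp i u)"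
  and opDm_bas: "opDm i (bas (u, m, v)) = lin (\<lambda>u'. bas (u', m - alpha i, v)) (Dm i u)"
  by (simp_all add: opE_def opK_def op0_def opDp_def opDm_def)

lemmas op_bas = opE_bas opK_bas op0_bas opDp_bas opDm_bas

lemma pbw_eqI:
  assumes "linmap f" "linmap g" "\<And>u m v. f (bas (u, m, v)) = g (bas (u, m, v))"
  shows "f x = g (x :: ('k, 'i) pbw)"
  using assms(1,2) by (rule linmap_eqI) (use assms(3) in auto)

lemma pbw_eqI_opE:
  assumes "linmap f" "linmap g" "\<And>m v. f (bas (0, m, v)) = g (bas (0, m, v))"
    and "\<And>i y. f y = g y \<Longrightarrow> f (opE i y) = g (opE i y)"
  shows "f x = g (x :: ('k, 'i) pbw)"
proof (rule pbw_eqI[OF assms(1,2)])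
  fix u m v
  show "f (bas (u, m, v)) = g (bas (u, m, v))"
  proof (induction u rule: word_induct)
    case zero
    show ?case by (rule assms)
  next
    case (step i u)
    from assms(4)[OF this, of i] show ?case by (simp add: opE_bas)
  qed
qed

lemma opK_opK: "opK l (opK l' x) = opK (l + l') x"
  by (rule pbw_eqI[of "\<lambda>x. opK l (opK l' x)"])
    (auto intro!: linmap_intros simp: opK_bas op_smul chi_simps add_ac mult_ac)

lemma opK_zero [simp]: "opK 0 x = x"
  by (rule pbw_eqI[of "opK 0"]) (auto simp: opK_bas)

lemma opK_opE: "opK l (opE i x) = smul (chi l (alpha i)) (opE i (opK l x))"
  by (rule pbw_eqI[of "\<lambda>x. opK l (opE i x)"])
    (auto intro!: linmap_intros simp: op_bas op_smul chi_simps mult_ac)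

lemma op0_opK: "op0 i (opK l x) = smul (chi l (alpha i)) (opK l (op0 i x))"
  by (rule pbw_eqI[of "\<lambda>x. op0 i (opK l x)"])
    (auto intro!: linmap_intros simp: op_bas op_smul chi_simps mult_ac)

lemma opDp_opK: "opDp i (opK l x) = smul (chi l (alpha i)) (opK l (opDp i x))"
proof (rule pbw_eqI[of "\<lambda>x. opDp i (opK l x)"])
  show "opDp i (opK l (bas (u, m, v))) = smul (chi l (alpha i)) (opK l (opDp i (bas (u, m, v))))" for u m v
    unfolding op_bas op_smul op_lin lin_fun_smul[symmetric]
    by (rule lin_cong) (auto dest!: keys_Dp simp: op_bas chi_simps add_ac)
qed (auto intro!: linmap_intros)

lemma opDm_opK: "opDm i (opK l x) = smul (chi l (alpha i)) (opK l (opDm i x))"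
proof (rule pbw_eqI[of "\<lambda>x. opDm i (opK l x)"])
  show "opDm i (opK l (bas (u, m, v))) = smul (chi l (alpha i)) (opK l (opDm i (bas (u, m, v))))" for u m v
    unfolding op_bas op_smul op_lin lin_fun_smul[symmetric]
    by (rule lin_cong) (auto dest!: keys_Dm simp: op_bas chi_simps algebra_simps)
qed (auto intro!: linmap_intros)

lemma op0_opE: "op0 i (opE j x) = opE j (op0 i x)"
  by (rule pbw_eqI[of "\<lambda>x. op0 i (opE j x)"])
    (auto intro!: linmap_intros simp: op_bas op_smul)

lemma opDp_opE: "opDp i (opE j x) = opE j (opDp i x) + (if i = j then opK (alpha i) x else 0)"
  by (cases "i = j"; rule pbw_eqI[of "\<lambda>x. opDp i (opE j x)"])
    (auto intro!: linmap_intros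
      simp: op_bas op_lin Dp_step lin_add lin_smul lin_times_left add_ac)

lemma opDm_opE: "opDm i (opE j x) = opE j (opDm i x) + (if i = j then opK (- alpha i) x else 0)"
  by (cases "i = j"; rule pbw_eqI[of "\<lambda>x. opDm i (opE j x)"])
    (auto intro!: linmap_intros
      simp: op_bas op_lin Dm_step lin_add lin_smul lin_times_left add_ac chi_simps)

lemma opDp_op0: "opDp i (op0 k x) = smul (inverse (chi (alpha i) (alpha k))) (op0 k (opDp i x))"
  by (rule pbw_eqI[of "\<lambda>x. opDp i (op0 k x)"])
    (auto intro!: linmap_intros simp: op_bas op_lin op_smul lin_fun_smul chi_simps field_simps)

lemma opDm_op0: "opDm i (op0 k x) = smul (chi (alpha i) (alpha k)) (op0 k (opDm i x))"
  by (rule pbw_eqI[of "\<lambda>x. opDm i (op0 k x)"])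
    (auto intro!: linmap_intros simp: op_bas op_lin op_smul lin_fun_smul chi_simps)

text \<open>Composing two derivations on words directly is avoided: the Leibniz rules with
  \<open>opE\<close> reduce the identity to u = 0, where both sides vanish.\<close>

lemma opDp_opDm: "opDp i (opDm k x) = smul (inverse (chi (alpha i) (alpha k))) (opDm k (opDp i x))"
proof (rule pbw_eqI_opE[of "\<lambda>x. opDp i (opDm k x)"])
  fix j y
  assume "opDp i (opDm k y) = smul (inverse (chi (alpha i) (alpha k))) (opDm k (opDp i y))"
  then show "opDp i (opDm k (opE j y)) =
      smul (inverse (chi (alpha i) (alpha k))) (opDm k (opDp i (opE j y)))"
    by (auto simp: opDm_opE opDp_opE op_add op_smul smul_add opDp_opK opDm_opK chi_simps q_sym)
qed (auto intro!: linmap_intros simp: op_bas)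

lemma opF_opK: "opF i (opK l x) = smul (chi l (alpha i)) (opK l (opF i x))"
  by (simp add: opF_def op0_opK opDp_opK opDm_opK op_add op_diff smul_add smul_diff)

lemma opF_opE: "opF i (opE j x) =
    opE j (opF i x) - (if i = j then opK (alpha i) x - opK (- alpha i) x else 0)"
  by (simp add: opF_def op0_opE opDp_opE opDm_opE op_add op_diff)


section \<open>The action of the free algebra\<close>

fun opG :: "'i gen \<Rightarrow> ('k, 'i) pbw \<Rightarrow> ('k, 'i) pbw" where
  "opG (GenE i) = opE i"
| "opG (GenF i) = opF i"
| "opG (GenK i) = opK (alpha i)"
| "opG (GenKinv i) = opK (- alpha i)"

lemma linmap_opG [simp, intro]: "linmap (opG g)"
  by (cases g) auto

definition opw :: "'i gen word \<Rightarrow> ('k, 'i) pbw \<Rightarrow> ('k, 'i) pbw" where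
  "opw w x = foldr opG (letters w) x"

lemma opw_0 [simp]: "opw 0 x = x"
  and opw_plus [simp]: "opw (u + v) x = opw u (opw v x)"
  and opw_var [simp]: "opw (var g) x = opG g x"
  by (simp_all add: opw_def)

lemma linmap_opw [simp, intro]: "linmap (opw w)"
proof (induction w rule: word_induct)
  case zero
  show ?case using linmap_id by (simp add: opw_def[abs_def])
next
  case (step g w)
  then show ?case
    using linmap_comp[OF linmap_opG[of g] step] by (simp add: linmap_def)
qed

definition act :: "('k, 'i gen) ncpoly \<Rightarrow> ('k, 'i) pbw \<Rightarrow> ('k, 'i) pbw" where
  "act a x = lin (\<lambda>w. opw w x) a"

lemma linmap_act [simp, intro]: "linmap (act a)"
  unfolding act_def[abs_def] by (rule linmap_lin_param) simp

lemma linmap_act_left [simp, intro]: "linmap (\<lambda>a. act a x)"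
  unfolding act_def[abs_def] by simp

lemma act_bas [simp]: "act (bas w) x = opw w x"
  by (simp add: act_def)

lemma act_one [simp]: "act 1 x = x"
  using act_bas[of 0 x] by simp

lemma act_ncvar [simp]: "act (ncvar g) x = opG g x"
  by (simp add: ncvar_def)

lemma act_ncconst [simp]: "act (ncconst a) x = smul a x"
  by (simp add: ncconst_def act_def)

lemma act_add: "act (a + b) x = act a x + act b x"
  and act_diff: "act (a - b) x = act a x - act b x"
  and act_smul: "act (smul k a) x = smul k (act a x)"
  and act_zero [simp]: "act 0 x = 0"
  by (simp_all add: act_def lin_add lin_diff lin_smul)

lemma act_mult: "act (a * b) x = act a (act b x)"
proof -
  have *: "act (bas u * b) x = act (bas u) (act b x)" for u
    by (rule linmap_eqI[of "\<lambda>b. act (bas u * b) x"])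
      (simp_all add: linmap_comp[OF linmap_act_left linmap_times_left]
        linmap_comp[OF linmap_opw linmap_act_left] bas_times_bas)
  show ?thesis
    by (rule linmap_eqI[of "\<lambda>a. act (a * b) x"])
      (simp_all add: linmap_comp[OF linmap_act_left linmap_times_right] linmap_act_left *)
qed

lemma nc_eval_free:
  fixes p :: "('k, 'a) ncpoly"
  shows "nc_eval (free_ring :: ('k, 'h) ncpoly ring) ncconst b p =
    lin (\<lambda>w. foldr (\<lambda>g y. b g * y) (letters w) 1) p"
proof -
  interpret F: ring "free_ring :: ('k, 'h) ncpoly ring" by (rule ring_free_ring)
  have "finsum free_ring f A = sum f A" if "finite A" for f :: "'a word \<Rightarrow> ('k, 'h) ncpoly" and A
    using that by (induction A rule: finite_induct) (simp_all add: F.finsum_insert)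
  then have "nc_eval (free_ring :: ('k, 'h) ncpoly ring) ncconst b p = (\<Sum>w\<in>keys p.
      ncconst (coef p w) * foldr (\<lambda>g y. b g * y) (letters w) 1)"
    by (simp add: nc_eval_def)
  then show ?thesis
    by (simp add: lin_def smul_def mult_map_scale_conv_mult ncconst_def)
qed

abbreviation Ew :: "'i word \<Rightarrow> ('k, 'i gen) ncpoly" where
  "Ew w \<equiv> bas (Word (map GenE (letters w)))"

abbreviation Fw :: "'i word \<Rightarrow> ('k, 'i gen) ncpoly" where
  "Fw w \<equiv> bas (Word (map GenF (letters w)))"

lemma foldr_ncvar: "foldr (\<lambda>g y. ncvar (h g) * y) l 1 = bas (Word (map h l))"
  by (induction l) (simp_all add: ncvar_def mult_single zero_word_def[symmetric] plus_word_def)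

lemma Ew_step: "Ew (u + v) = Ew u * Ew v"
  and Fw_step: "Fw (u + v) = Fw u * Fw v"
  by (simp_all add: mult_single plus_word_def)

lemma Ew_0: "Ew 0 = 1" and Fw_0: "Fw 0 = 1"
  by (simp_all flip: zero_word_def)

lemma act_Ew: "act (Ew w) (bas (u, m, v)) = bas (w + u, m, v)"
proof (induction w rule: word_induct)
  case zero
  show ?case by (simp flip: zero_word_def)
next
  case (step i w)
  then show ?case
    by (simp only: Ew_step act_mult) (simp add: opE_bas add.assoc)
qed

definition opFw :: "'i word \<Rightarrow> ('k, 'i) pbw \<Rightarrow> ('k, 'i) pbw" where
  "opFw w x = act (Fw w) x"

lemma opFw_0 [simp]: "opFw 0 x = x"
  unfolding opFw_def Fw_0 by simp

lemma opFw_step [simp]: "opFw (var i + w) x = opF i (opFw w x)"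
  unfolding opFw_def Fw_step act_mult by simp

lemma linmap_opFw [simp, intro]: "linmap (opFw w)"
  unfolding opFw_def[abs_def] by (rule linmap_act)

lemma opFw_opK: "opFw w (opK l x) = smul (chi l (zdeg w)) (opK l (opFw w x))"
  by (induction w rule: word_induct) (simp_all add: opF_opK op_smul chi_simps mult_ac)

text \<open>Contracting E_j with a letter of F_w leaves K_j or its inverse, which is then moved to
  the right past the remaining letters. Since K_j F_i = q^{-1} F_i K_j, the terms with K_j carry the
  scalars of \<open>Dm\<close>, so the two derivations change places compared with
  \<open>gF_Ew\<close>.\<close>

lemma opFw_opE: "opFw w (opE j x) = opE j (opFw w x)
    - lin (\<lambda>w'. opFw w' (opK (alpha j) x)) (Dm j w)
    + lin (\<lambda>w'. opFw w' (opK (- alpha j) x)) (Dp j w)"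
proof (induction w rule: word_induct)
  case zero
  show ?case by simp
next
  case (step i w)
  show ?case
    by (auto simp: step op_add op_diff op_lin opF_opE Dm_step Dp_step lin_add lin_smul lin_times_left
      opFw_opK opF_opK op_smul chi_simps smul_diff algebra_simps)
qed

lemma opFw_bas_0: "opFw w (bas (0, m, v)) = smul (chi m (zdeg w)) (bas (0, m, w + v))"
  by (induction w rule: word_induct)
    (simp_all add: opF_def op_bas op_smul chi_simps mult_ac add_ac)


section \<open>The submodule generated by the biideal\<close>

text \<open>The span of the E_a K_m F_v and E_u K_m F_b with a and b in \<open>I\<close>. The rules
  add one generator at a time; scalars are absorbed by \<open>I\<close>.\<close>

inductive_set Nsub :: "('k, 'i) pbw set" where
  Nsub_0: "0 \<in> Nsub"
| Nsub_left: "x \<in> Nsub \<Longrightarrow> a \<in> I \<Longrightarrow> x + lin (\<lambda>u. bas (u, m, v)) a \<in> Nsub"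
| Nsub_right: "x \<in> Nsub \<Longrightarrow> b \<in> I \<Longrightarrow> x + lin (\<lambda>v. bas (u, m, v)) b \<in> Nsub"

lemma Nsub_leftI: "a \<in> I \<Longrightarrow> lin (\<lambda>u. bas (u, m, v)) a \<in> Nsub"
  and Nsub_rightI: "b \<in> I \<Longrightarrow> lin (\<lambda>v. bas (u, m, v)) b \<in> Nsub"
  using Nsub_left[OF Nsub_0] Nsub_right[OF Nsub_0] by simp_all

lemma Nsub_linmap:
  assumes "x \<in> Nsub" "linmap f" "subsp S"
    and "\<And>a m v. a \<in> I \<Longrightarrow> lin (\<lambda>u. f (bas (u, m, v))) a \<in> S"
    and "\<And>b u m. b \<in> I \<Longrightarrow> lin (\<lambda>v. f (bas (u, m, v))) b \<in> S"
  shows "f x \<in> S"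
  using assms(1)
  by induction (simp_all add: linmap_0 linmap_add linmap_lin_apply assms subsp_0 subsp_add)

lemma Nsub_subsp: "subsp Nsub"
proof (rule subspI)
  show a: "x + y \<in> Nsub" if "x \<in> Nsub" "y \<in> Nsub" for x y
    using that(2) by induction (simp_all add: that(1) add.assoc[symmetric] Nsub.intros)
  show "smul k x \<in> Nsub" if "x \<in> Nsub" for k x
    using that
  proof induction
    case (Nsub_left x a m v)
    have "smul k (lin (\<lambda>u. bas (u, m, v)) a) = lin (\<lambda>u. bas (u, m, v)) (smul k a)"
      by (simp add: lin_smul)
    then show ?case
      using Nsub_left subsp_smul[OF I_subsp] by (auto simp: smul_add intro!: Nsub.intros)
  next
    case (Nsub_right x b u m)
    have "smul k (lin (\<lambda>v. bas (u, m, v)) b) = lin (\<lambda>v. bas (u, m, v)) (smul k b)"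
      by (simp add: lin_smul)
    then show ?case
      using Nsub_right subsp_smul[OF I_subsp] by (auto simp: smul_add intro!: Nsub.intros)
  qed (simp add: Nsub_0)
qed (rule Nsub_0)

lemma Nsub_emb_left: "a \<in> I \<Longrightarrow> lin (\<lambda>u. smul (f (wdeg u)) (bas (u, m, v))) a \<in> Nsub"
  by (rule I_lin_scaled[OF _ Nsub_subsp]) (auto intro: Nsub_leftI)

lemma Nsub_opE: "x \<in> Nsub \<Longrightarrow> opE i x \<in> Nsub"
proof (erule Nsub_linmap[OF _ linmap_ops(1) Nsub_subsp])
  fix a m v assume "a \<in> I"
  then show "lin (\<lambda>u. opE i (bas (u, m, v))) a \<in> Nsub"
    using Nsub_leftI[OF I_left[of a "bas (var i)"], of m v] by (simp add: opE_bas lin_times_left)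
qed (simp add: opE_bas Nsub_rightI)

lemma Nsub_opK: "x \<in> Nsub \<Longrightarrow> opK l x \<in> Nsub"
  by (erule Nsub_linmap[OF _ linmap_ops(2) Nsub_subsp])
    (simp_all add: opK_bas Nsub_emb_left[of _ "\<lambda>a. chi l (zvec a)"] Nsub_rightI lin_fun_smul
      subsp_smul[OF Nsub_subsp])

lemma Nsub_op0: "x \<in> Nsub \<Longrightarrow> op0 i x \<in> Nsub"
proof (erule Nsub_linmap[OF _ linmap_ops(3) Nsub_subsp])
  fix b u m assume "b \<in> I"
  then show "lin (\<lambda>v. op0 i (bas (u, m, v))) b \<in> Nsub"
    using subsp_smul[OF Nsub_subsp, OF Nsub_rightI[OF I_left[of b "bas (var i)"], of u m], of "chi m (alpha i)"]
    by (simp add: op0_bas lin_times_left lin_fun_smul)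
qed (simp add: op0_bas lin_fun_smul Nsub_leftI subsp_smul[OF Nsub_subsp])

lemma Nsub_opDp: "x \<in> Nsub \<Longrightarrow> opDp i x \<in> Nsub"
proof (erule Nsub_linmap[OF _ linmap_ops(4) Nsub_subsp])
  fix a m v assume "a \<in> I"
  then show "lin (\<lambda>u. opDp i (bas (u, m, v))) a \<in> Nsub"
    using Nsub_leftI[OF I_Dp[of a i], of "m + alpha i" v] by (simp add: opDp_bas lin_lin)
next
  fix b u m assume "b \<in> I"
  then show "lin (\<lambda>v. opDp i (bas (u, m, v))) b \<in> Nsub"
    unfolding opDp_bas by (subst lin_swap) (intro lin_mem Nsub_subsp Nsub_rightI)
qed

lemma Nsub_opDm: "x \<in> Nsub \<Longrightarrow> opDm i x \<in> Nsub"
proof (erule Nsub_linmap[OF _ linmap_ops(5) Nsub_subsp])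
  fix a m v assume "a \<in> I"
  then show "lin (\<lambda>u. opDm i (bas (u, m, v))) a \<in> Nsub"
    using Nsub_leftI[OF I_Dm[of a i], of "m - alpha i" v] by (simp add: opDm_bas lin_lin)
next
  fix b u m assume "b \<in> I"
  then show "lin (\<lambda>v. opDm i (bas (u, m, v))) b \<in> Nsub"
    unfolding opDm_bas by (subst lin_swap) (intro lin_mem Nsub_subsp Nsub_rightI)
qed

lemma Nsub_opF: "x \<in> Nsub \<Longrightarrow> opF i x \<in> Nsub"
  unfolding opF_def
  by (intro subsp_add subsp_diff Nsub_subsp Nsub_op0 Nsub_opDp Nsub_opDm)

lemma Nsub_opG: "x \<in> Nsub \<Longrightarrow> opG g x \<in> Nsub"
  by (cases g) (simp_all add: Nsub_opE Nsub_opF Nsub_opK)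

lemma Nsub_act: "x \<in> Nsub \<Longrightarrow> act a x \<in> Nsub"
proof -
  assume x: "x \<in> Nsub"
  have "opw w x \<in> Nsub" for w
    by (induction w rule: word_induct) (simp_all add: x Nsub_opG)
  then show ?thesis
    unfolding act_def by (intro lin_mem Nsub_subsp)
qed

text \<open>The relation p(F) has to hold on every vector and not only on those with u = 0.
  Induction on u moves F_p past one E_j at a time; the correction terms involve \<open>Dp\<close>
  and \<open>Dm\<close> of p, which stay in \<open>I\<close>, so the induction hypothesis is needed
  for all p and m.\<close>

lemma I_opFw: "p \<in> I \<Longrightarrow> lin (\<lambda>w. opFw w x) p \<in> Nsub"
proof -
  have "lin (\<lambda>w. opFw w (bas (u, m, v))) p \<in> Nsub" if "p \<in> I" for u m v p
    using that
  proof (induction u arbitrary: p m rule: word_induct)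
    case zero
    have "lin (\<lambda>w. bas (0, m, w + v)) q \<in> Nsub" if "q \<in> I" for q
    proof -
      have "q * bas v = lin (\<lambda>w. bas (w + v)) q"
        by (subst linmap_eq_lin[OF linmap_times_right]) (simp add: bas_times_bas)
      then have "lin (\<lambda>w. bas (0 :: 'i word, m, w)) (q * bas v) = lin (\<lambda>w. bas (0, m, w + v)) q"
        by (simp add: lin_lin)
      then show ?thesis
        using Nsub_rightI[OF I_right[OF that, of "bas v"], of 0 m] by simp
    qed
    then show ?case
      unfolding opFw_bas_0 by (intro I_lin_scaled zero Nsub_subsp)
  next
    case (step j u)
    let ?x = "bas (u, m, v)"
    have K: "lin (\<lambda>w. opFw w (opK l ?x)) q \<in> Nsub" if "q \<in> I" for q l
      using subsp_smul[OF Nsub_subsp step.IH[OF that, of "m + l"]]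
      by (simp add: opK_bas linmap_smul[OF linmap_opFw] lin_fun_smul)
    have "lin (\<lambda>w. opFw w (bas (var j + u, m, v))) p = opE j (lin (\<lambda>w. opFw w ?x) p)
        - lin (\<lambda>w. opFw w (opK (alpha j) ?x)) (lin (Dm j) p)
        + lin (\<lambda>w. opFw w (opK (- alpha j) ?x)) (lin (Dp j) p)"
      unfolding opE_bas[symmetric] opFw_opE by (simp add: lin_fun_add lin_fun_diff lin_lin op_lin)
    also have "\<dots> \<in> Nsub"
      by (intro subsp_add subsp_diff Nsub_subsp Nsub_opE K I_Dp I_Dm step)
    finally show ?case .
  qed
  then have "lin (\<lambda>a. lin (\<lambda>w. opFw w (bas a)) p) x \<in> Nsub" if "p \<in> I"
    using that by - (rule lin_mem[OF Nsub_subsp], auto)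
  moreover have "lin (\<lambda>w. opFw w x) p = lin (\<lambda>a. lin (\<lambda>w. opFw w (bas a)) p) x"
    by (rule linmap_eq_lin) (intro linmap_lin_param linmap_opFw)
  ultimately show "p \<in> I \<Longrightarrow> lin (\<lambda>w. opFw w x) p \<in> Nsub" by simp
qed

lemma I_opEw: "p \<in> I \<Longrightarrow> lin (\<lambda>w. act (Ew w) x) p \<in> Nsub"
proof -
  assume p: "p \<in> I"
  have *: "lin (\<lambda>w. act (Ew w) (bas (u, m, v))) p \<in> Nsub" for u m v
  proof -
    have "p * bas u = lin (\<lambda>w. bas (w + u)) p"
      by (subst linmap_eq_lin[OF linmap_times_right]) (simp add: bas_times_bas)
    then show ?thesis
      using Nsub_leftI[OF I_right[OF p, of "bas u"], of m v]
      by (simp only: act_Ew) (simp add: lin_lin)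
  qed
  show ?thesis
    by (rule linmap_mem[of "\<lambda>x. lin (\<lambda>w. act (Ew w) x) p"])
      (auto intro!: linmap_lin_param Nsub_subsp simp del: act_bas simp: *)
qed

section \<open>The defining ideal of \<open>U(chi)\<close> and its action modulo
  \<open>Nsub\<close>\<close>

abbreviation "J \<equiv> U_ideal chi I"

lemma J_ideal: "ideal J free_ring"
  unfolding U_ideal_def by (rule ring.genideal_ideal[OF ring_free_ring]) simp

lemma J_subsp: "subsp J"
  and J_left: "x \<in> J \<Longrightarrow> a * x \<in> J"
  and J_right: "x \<in> J \<Longrightarrow> x * a \<in> J"
  using J_ideal unfolding ideal_free_ring_iff by blast+

lemma nc_eval_E: "nc_eval free_ring ncconst (\<lambda>i. ncvar (GenE i)) p = lin Ew p"
  and nc_eval_F: "nc_eval free_ring ncconst (\<lambda>i. ncvar (GenF i)) p = lin Fw p"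
  by (simp_all add: nc_eval_free foldr_ncvar)

lemma J_rel: "r \<in> U_tilde_relations chi \<Longrightarrow> r \<in> J"
  and J_E: "p \<in> I \<Longrightarrow> lin Ew p \<in> J"
  and J_F: "p \<in> I \<Longrightarrow> lin Fw p \<in> J"
  using ring.genideal_self[OF ring_free_ring, of "U_tilde_relations chi \<union>
      nc_eval free_ring ncconst (\<lambda>i. ncvar (GenE i)) ` I \<union>
      nc_eval free_ring ncconst (\<lambda>i. ncvar (GenF i)) ` I"]
  unfolding U_ideal_def[symmetric] by (auto simp: nc_eval_E nc_eval_F)

text \<open>The elements that map the whole module into \<open>Nsub\<close> form a two-sided ideal,
  so it is enough to check generators. The relations of U~ hold in the module itself, those from
  \<open>I\<close> modulo \<open>Nsub\<close>.\<close>

lemma act_J: "a \<in> J \<Longrightarrow> act a x \<in> Nsub"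
proof -
  let ?A = "{a. \<forall>x. act a x \<in> Nsub}"
  have "ideal ?A free_ring"
    unfolding ideal_free_ring_iff
    by (auto intro!: subspI simp: act_add act_smul act_mult Nsub_act Nsub_0
        subsp_add[OF Nsub_subsp] subsp_smul[OF Nsub_subsp])
  moreover have "act r x = 0" if "r \<in> U_tilde_relations chi" for r x
    using that unfolding U_tilde_relations_def Let_def
    by (auto simp: act_diff act_mult opK_opK opK_opE opF_opK opF_opE smul_diff
      chi_simps add.commute split: if_splits)
  moreover have "lin Ew p \<in> ?A" "lin Fw p \<in> ?A" if "p \<in> I" for p
    using I_opEw[OF that] I_opFw[OF that] linmap_lin_apply[OF linmap_act_left, where f = Ew and s = p]
      linmap_lin_apply[OF linmap_act_left, where f = Fw and s = p] by (simp_all add: opFw_def del: act_bas)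
  ultimately have "J \<subseteq> ?A"
    unfolding U_ideal_def
    by (intro ring.genideal_minimal[OF ring_free_ring]) (auto simp: nc_eval_E nc_eval_F Nsub_0)
  then show "a \<in> J \<Longrightarrow> act a x \<in> Nsub" by blast
qed


section \<open>The triangular decomposition of \<open>U(chi)\<close>\<close>


definition cg :: "('k, 'i gen) ncpoly \<Rightarrow> ('k, 'i gen) ncpoly \<Rightarrow> bool" (infix "\<simeq>\<^sub>J" 50) where
  "x \<simeq>\<^sub>J y \<longleftrightarrow> x - y \<in> J"

lemma cg_refl [simp]: "x \<simeq>\<^sub>J x"
  by (simp add: cg_def subsp_0[OF J_subsp])

lemma cg_sym: "x \<simeq>\<^sub>J y \<Longrightarrow> y \<simeq>\<^sub>J x"
  using subsp_uminus[OF J_subsp, of "x - y"] by (simp add: cg_def)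

lemma cg_trans [trans]: "x \<simeq>\<^sub>J y \<Longrightarrow> y \<simeq>\<^sub>J z \<Longrightarrow> x \<simeq>\<^sub>J z"
  using subsp_add[OF J_subsp, of "x - y" "y - z"] by (simp add: cg_def)

lemma cg_add: "x \<simeq>\<^sub>J y \<Longrightarrow> x' \<simeq>\<^sub>J y' \<Longrightarrow> x + x' \<simeq>\<^sub>J y + y'"
  using subsp_add[OF J_subsp, of "x - y" "x' - y'"] by (simp add: cg_def algebra_simps)

lemma cg_diff: "x \<simeq>\<^sub>J y \<Longrightarrow> x' \<simeq>\<^sub>J y' \<Longrightarrow> x - x' \<simeq>\<^sub>J y - y'"
  using subsp_diff[OF J_subsp, of "x - y" "x' - y'"] by (simp add: cg_def algebra_simps)

lemma cg_smul: "x \<simeq>\<^sub>J y \<Longrightarrow> smul a x \<simeq>\<^sub>J smul a y"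
  using subsp_smul[OF J_subsp, of "x - y" a] by (simp add: cg_def smul_diff)

lemma cg_times_left: "x \<simeq>\<^sub>J y \<Longrightarrow> a * x \<simeq>\<^sub>J a * y"
  using J_left[of "x - y" a] by (simp add: cg_def ring_distribs)

lemma cg_times_right: "x \<simeq>\<^sub>J y \<Longrightarrow> x * a \<simeq>\<^sub>J y * a"
  using J_right[of "x - y" a] by (simp add: cg_def ring_distribs)

lemma cg_mult: "x \<simeq>\<^sub>J y \<Longrightarrow> x' \<simeq>\<^sub>J y' \<Longrightarrow> x * x' \<simeq>\<^sub>J y * y'"
  using cg_trans[OF cg_times_left cg_times_right] .

lemma cg_lin: "(\<And>a. a \<in> keys s \<Longrightarrow> f a \<simeq>\<^sub>J g a) \<Longrightarrow> lin f s \<simeq>\<^sub>J lin g s"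
  unfolding cg_def lin_fun_diff[symmetric] by (rule lin_mem[OF J_subsp])

lemma cg_linmap:
  "linmap f \<Longrightarrow> linmap g \<Longrightarrow> (\<And>a. a \<in> keys s \<Longrightarrow> f (bas a) \<simeq>\<^sub>J g (bas a)) \<Longrightarrow> f s \<simeq>\<^sub>J g s"
  by (subst linmap_eq_lin[of f], assumption, subst linmap_eq_lin[of g], assumption) (rule cg_lin)

abbreviation "gE i \<equiv> ncvar (GenE i) :: ('k, 'i gen) ncpoly"
abbreviation "gF i \<equiv> ncvar (GenF i) :: ('k, 'i gen) ncpoly"
abbreviation "gK i \<equiv> ncvar (GenK i) :: ('k, 'i gen) ncpoly"
abbreviation "gL i \<equiv> ncvar (GenKinv i) :: ('k, 'i gen) ncpoly"

lemma ncconst_times: "ncconst a * x = smul a x" for x :: "('k, 'g) ncpoly"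
  by (simp add: ncconst_def smul_def mult_map_scale_conv_mult)

lemma rel_KL: "gK i * gL i \<simeq>\<^sub>J 1" "gL i * gK i \<simeq>\<^sub>J 1"
  and rel_KK: "gK i * gK j \<simeq>\<^sub>J gK j * gK i"
  and rel_KE: "gK i * gE j \<simeq>\<^sub>J smul (qmat chi i j) (gE j * gK i)"
  and rel_KF: "gK i * gF j \<simeq>\<^sub>J smul (inverse (qmat chi i j)) (gF j * gK i)"
  and rel_EF: "gE i * gF j \<simeq>\<^sub>J gF j * gE i + (if i = j then gK i - gL i else 0)"
proof -
  have *: "ncconst a * x * y = smul a (x * y)" for a and x y :: "('k, 'i gen) ncpoly"
    by (simp add: mult.assoc ncconst_times smul_mult_left)
  have r1: "gK i * gL i - 1 \<in> J" "gL i * gK i - 1 \<in> J"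
    by (rule J_rel, unfold U_tilde_relations_def Let_def, rule UnI1, rule UN_I[where a = i],
        rule UNIV_I, (rule insertI1 | rule insertI2)+)+
  have r2: "gK i * gK j - gK j * gK i \<in> J"
      "gK i * gE j - ncconst (qmat chi i j) * gE j * gK i \<in> J"
      "gK i * gF j - ncconst (inverse (qmat chi i j)) * gF j * gK i \<in> J"
      "gE i * gF j - gF j * gE i - (if i = j then gK i - gL i else 0) \<in> J"
    by (rule J_rel, unfold U_tilde_relations_def Let_def, rule UnI2, rule UN_I[where a = i],
        rule UNIV_I, rule UN_I[where a = j], rule UNIV_I, (rule insertI1 | rule insertI2)+)+
  show "gK i * gL i \<simeq>\<^sub>J 1" "gL i * gK i \<simeq>\<^sub>J 1" "gK i * gK j \<simeq>\<^sub>J gK j * gK i"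
    "gK i * gE j \<simeq>\<^sub>J smul (qmat chi i j) (gE j * gK i)"
    "gK i * gF j \<simeq>\<^sub>J smul (inverse (qmat chi i j)) (gF j * gK i)"
    using r1 r2 unfolding cg_def * by simp_all
  show "gE i * gF j \<simeq>\<^sub>J gF j * gE i + (if i = j then gK i - gL i else 0)"
    using r2(4) unfolding cg_def by (simp add: diff_diff_eq)
qed

text \<open>Weight under conjugation by the K_j, expressed by congruences in the free algebra, so
  that no grading of \<open>U(chi)\<close> has to be set up.\<close>

definition wt :: "('k, 'i gen) ncpoly \<Rightarrow> int ^ 'i \<Rightarrow> bool" where
  "wt y l \<longleftrightarrow> (\<forall>j. gK j * y \<simeq>\<^sub>J smul (chi (alpha j) l) (y * gK j))"

lemma wtD: "wt y l \<Longrightarrow> gK j * y \<simeq>\<^sub>J smul (chi (alpha j) l) (y * gK j)"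
  by (simp add: wt_def)

lemma wtD_inverse: "wt y l \<Longrightarrow> gL j * y \<simeq>\<^sub>J smul (inverse (chi (alpha j) l)) (y * gL j)"
proof -
  assume wt: "wt y l"
  have "gL j * y * 1 \<simeq>\<^sub>J gL j * y * (gK j * gL j)"
    by (intro cg_times_left cg_sym[OF rel_KL(1)])
  also have "\<dots> = smul (inverse (chi (alpha j) l)) (gL j * smul (chi (alpha j) l) (y * gK j) * gL j)"
    by (simp add: mult.assoc flip: smul_mult_left smul_mult_right)
  also have "\<dots> \<simeq>\<^sub>J smul (inverse (chi (alpha j) l)) (gL j * (gK j * y) * gL j)"
    by (intro cg_smul cg_times_left cg_times_right cg_sym[OF wtD[OF wt]])
  also have "\<dots> = smul (inverse (chi (alpha j) l)) ((gL j * gK j) * (y * gL j))"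
    by (simp add: mult.assoc)
  also have "\<dots> \<simeq>\<^sub>J smul (inverse (chi (alpha j) l)) (1 * (y * gL j))"
    by (intro cg_smul cg_times_right rel_KL)
  finally show ?thesis by simp
qed

lemma wt_mult: "wt x l \<Longrightarrow> wt y m \<Longrightarrow> wt (x * y) (l + m)"
  unfolding wt_def
proof
  fix j
  assume x: "\<forall>j. gK j * x \<simeq>\<^sub>J smul (chi (alpha j) l) (x * gK j)"
    and y: "\<forall>j. gK j * y \<simeq>\<^sub>J smul (chi (alpha j) m) (y * gK j)"
  have "gK j * (x * y) = (gK j * x) * y" by (simp add: mult.assoc)
  also have "\<dots> \<simeq>\<^sub>J smul (chi (alpha j) l) (x * gK j) * y"
    using x by (intro cg_times_right) blast
  also have "\<dots> = smul (chi (alpha j) l) (x * (gK j * y))"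
    by (simp add: mult.assoc flip: smul_mult_left)
  also have "\<dots> \<simeq>\<^sub>J smul (chi (alpha j) l) (x * smul (chi (alpha j) m) (y * gK j))"
    using y by (intro cg_smul cg_times_left) blast
  finally show "gK j * (x * y) \<simeq>\<^sub>J smul (chi (alpha j) (l + m)) (x * y * gK j)"
    by (simp add: mult.assoc chi_simps flip: smul_mult_right)
qed

lemma wt_one: "wt 1 0"
  by (simp add: wt_def)

lemma wt_E: "wt (gE i) (alpha i)"
  and wt_F: "wt (gF i) (- alpha i)"
  and wt_K: "wt (gK i) 0"
  by (simp_all add: wt_def rel_KE rel_KF rel_KK chi_simps)

lemma wt_L: "wt (gL i) 0"
  using wtD_inverse[OF wt_K] by (simp add: wt_def cg_sym)

lemma Ew_var_step: "Ew (var i + w) = gE i * Ew w"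
  and Fw_var_step: "Fw (var i + w) = gF i * Fw w"
  unfolding Ew_step Fw_step by (simp_all add: ncvar_def)

lemma wt_Ew: "wt (Ew w) (zdeg w)"
proof (induction w rule: word_induct)
  case zero
  show ?case unfolding Ew_0 by (simp add: wt_one)
next
  case (step i w)
  show ?case unfolding Ew_var_step by (simp add: wt_mult wt_E step)
qed

section \<open>Integer powers of the \<open>K_j\<close> and the ordered products
  \<open>K_m\<close>\<close>

definition kz :: "'i \<Rightarrow> int \<Rightarrow> ('k, 'i gen) ncpoly" where
  "kz j n = (if 0 \<le> n then gK j ^ nat n else gL j ^ nat (- n))"

lemma gK_kz: "gK j * kz j n \<simeq>\<^sub>J kz j (n + 1)"
proof (cases "0 \<le> n")
  case True
  then show ?thesis by (simp add: kz_def nat_add_distrib)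
next
  case False
  define m where "m = nat (- n) - 1"
  then have n: "n = - int m - 1" using False by simp
  have "gK j * gL j * gL j ^ m \<simeq>\<^sub>J 1 * gL j ^ m"
    by (intro cg_times_right rel_KL)
  moreover have "nat (- n) = Suc m" "kz j (n + 1) = gL j ^ m"
    using n by (auto simp: kz_def)
  ultimately show ?thesis
    using False by (simp add: kz_def mult.assoc)
qed

lemma gL_kz: "gL j * kz j n \<simeq>\<^sub>J kz j (n - 1)"
proof (cases "0 < n")
  case True
  define m where "m = nat n - 1"
  then have n: "n = int m + 1" using True by simp
  have "gL j * gK j * gK j ^ m \<simeq>\<^sub>J 1 * gK j ^ m"
    by (intro cg_times_right rel_KL)
  moreover have "nat n = Suc m" "kz j (n - 1) = gK j ^ m"
    using n by (auto simp: kz_def)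
  ultimately show ?thesis
    using True by (simp add: kz_def mult.assoc)
next
  case False
  then have "kz j n = gL j ^ nat (- n)" "kz j (n - 1) = gL j ^ nat (- (n - 1))"
    by (auto simp: kz_def)
  moreover have "nat (- (n - 1)) = Suc (nat (- n))" using False by simp
  ultimately show ?thesis by simp
qed

lemma axis_zero: "axis j 0 = (0 :: int ^ 'i)"
  by (simp add: axis_def vec_eq_iff)

lemma kz_commute: "wt y l \<Longrightarrow> kz j n * y \<simeq>\<^sub>J smul (chi (axis j n) l) (y * kz j n)"
proof -
  assume wt: "wt y l"
  have *: "x ^ n * y \<simeq>\<^sub>J smul (chi (axis j (int n * e)) l) (y * x ^ n)"
    if x: "x * y \<simeq>\<^sub>J smul (chi (axis j e) l) (y * x)" for x n e
  proof (induction n)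
    case 0
    show ?case by (simp add: axis_zero)
  next
    case (Suc n)
    have ax: "axis j (int (Suc n) * e) = axis j e + axis j (int n * e)"
      by (simp add: axis_def vec_eq_iff algebra_simps)
    have "x ^ Suc n * y = x * (x ^ n * y)" by (simp add: mult.assoc)
    also have "\<dots> \<simeq>\<^sub>J x * smul (chi (axis j (int n * e)) l) (y * x ^ n)"
      by (intro cg_times_left Suc)
    also have "\<dots> = smul (chi (axis j (int n * e)) l) ((x * y) * x ^ n)"
      by (simp add: mult.assoc flip: smul_mult_right)
    also have "\<dots> \<simeq>\<^sub>J smul (chi (axis j (int n * e)) l) (smul (chi (axis j e) l) (y * x) * x ^ n)"
      by (intro cg_smul cg_times_right x)
    also have "\<dots> = smul (chi (axis j (int (Suc n) * e)) l) (y * x ^ Suc n)"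
      unfolding ax by (simp add: mult.assoc chi_simps mult_ac flip: smul_mult_left)
    finally show ?case .
  qed
  have "axis j (- 1) = - alpha j" for j :: 'i
    by (simp add: alpha_def axis_def vec_eq_iff)
  then have L: "gL j * y \<simeq>\<^sub>J smul (chi (axis j (- 1)) l) (y * gL j)"
    using wtD_inverse[OF wt, of j] by (simp add: chi_simps)
  have K: "gK j * y \<simeq>\<^sub>J smul (chi (axis j 1) l) (y * gK j)"
    using wtD[OF wt, of j] by (simp add: alpha_def)
  show ?thesis
    using *[OF K, of "nat n"] *[OF L, of "nat (- n)"] by (auto simp: kz_def)
qed

definition Kl :: "'i list \<Rightarrow> int ^ 'i \<Rightarrow> ('k, 'i gen) ncpoly" where
  "Kl xs m = foldr (\<lambda>j x. kz j (m $ j) * x) xs 1"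

lemma Kl_simps [simp]: "Kl [] m = 1" "Kl (j # xs) m = kz j (m $ j) * Kl xs m"
  by (simp_all add: Kl_def)

lemma Kl_cong: "(\<And>j. j \<in> set xs \<Longrightarrow> m $ j = m' $ j) \<Longrightarrow> Kl xs m = Kl xs m'"
  by (induction xs) auto

text \<open>Covers K_j with d = 1 and its inverse with d = -1: an element of weight zero commutes
  past the factors in front of the one for j.\<close>

lemma Kl_shift:
  assumes "wt g 0" and "\<And>n. g * kz j n \<simeq>\<^sub>J kz j (n + d)"
  shows "distinct xs \<Longrightarrow> j \<in> set xs \<Longrightarrow> g * Kl xs m \<simeq>\<^sub>J Kl xs (m + axis j d)"
proof (induction xs)
  case (Cons a xs)
  show ?case
  proof (cases "a = j")
    case True
    then have "Kl xs (m + axis j d) = Kl xs m"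
      using Cons.prems by (intro Kl_cong) (auto simp: axis_def)
    moreover have "g * kz j (m $ j) * Kl xs m \<simeq>\<^sub>J kz j (m $ j + d) * Kl xs m"
      by (intro cg_times_right assms)
    ultimately show ?thesis
      by (simp add: True mult.assoc)
  next
    case False
    have "g * kz a (m $ a) \<simeq>\<^sub>J kz a (m $ a) * g"
      using kz_commute[OF assms(1), of a "m $ a"] by (simp add: cg_sym)
    then have "g * kz a (m $ a) * Kl xs m \<simeq>\<^sub>J kz a (m $ a) * g * Kl xs m"
      by (rule cg_times_right)
    also have "\<dots> \<simeq>\<^sub>J kz a (m $ a) * Kl xs (m + axis j d)"
      unfolding mult.assoc using Cons False by (intro cg_times_left) auto
    finally show ?thesis
      using False by (simp add: mult.assoc axis_def)
  qed
qed simp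

text \<open>In the free algebra the K_j do not commute, so \<open>K_m\<close> is fixed as a product
  in a chosen order of the index set.\<close>

definition idx :: "'i list" where
  "idx = (SOME xs. distinct xs \<and> set xs = UNIV)"

lemma idx: "distinct idx" "set idx = UNIV"
proof -
  have "\<exists>xs. distinct xs \<and> set xs = (UNIV :: 'i set)"
    using finite_distinct_list[of "UNIV :: 'i set"] by auto
  then show "distinct idx" "set idx = UNIV"
    unfolding idx_def by (metis (mono_tags, lifting) someI_ex)+
qed

lemma sum_axis_idx: "(\<Sum>j\<leftarrow>idx. axis j (m $ j)) = (m :: int ^ 'i)"
proof -
  have "(\<Sum>j\<leftarrow>idx. axis j (m $ j)) = (\<Sum>j\<in>UNIV. axis j (m $ j))"
    using idx by (simp add: sum_list_distinct_conv_sum_set)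
  also have "\<dots> = m"
    by (simp add: vec_eq_iff axis_def)
  finally show ?thesis .
qed

definition Kp :: "int ^ 'i \<Rightarrow> ('k, 'i gen) ncpoly" where
  "Kp m = Kl idx m"

lemma gK_Kp: "gK j * Kp m \<simeq>\<^sub>J Kp (m + alpha j)"
  unfolding Kp_def alpha_def by (intro Kl_shift wt_K gK_kz idx) (simp add: idx)

lemma gL_Kp: "gL j * Kp m \<simeq>\<^sub>J Kp (m - alpha j)"
proof -
  have "m - alpha j = m + axis j (- 1)"
    by (simp add: alpha_def axis_def vec_eq_iff)
  moreover have "gL j * Kl idx m \<simeq>\<^sub>J Kl idx (m + axis j (- 1))"
    by (intro Kl_shift wt_L idx) (use gL_kz[of j] in \<open>simp_all add: idx\<close>)
  ultimately show ?thesis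
    by (simp only: Kp_def)
qed

lemma Kp_0: "Kp 0 = 1"
proof -
  have "Kl xs 0 = 1" for xs
    by (induction xs) (simp_all add: kz_def)
  then show ?thesis by (simp add: Kp_def)
qed

lemma Kp_commute: "wt y l \<Longrightarrow> Kp m * y \<simeq>\<^sub>J smul (chi m l) (y * Kp m)"
proof -
  assume wt: "wt y l"
  have "Kl xs m * y \<simeq>\<^sub>J smul (chi (\<Sum>j\<leftarrow>xs. axis j (m $ j)) l) (y * Kl xs m)" for xs
  proof (induction xs)
    case (Cons j xs)
    let ?a = "chi (\<Sum>j\<leftarrow>xs. axis j (m $ j)) l"
    have "Kl (j # xs) m * y = kz j (m $ j) * (Kl xs m * y)" by (simp add: mult.assoc)
    also have "\<dots> \<simeq>\<^sub>J kz j (m $ j) * smul ?a (y * Kl xs m)"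
      by (intro cg_times_left Cons)
    also have "\<dots> = smul ?a (kz j (m $ j) * y * Kl xs m)"
      by (simp add: mult.assoc flip: smul_mult_right)
    also have "\<dots> \<simeq>\<^sub>J smul ?a (smul (chi (axis j (m $ j)) l) (y * kz j (m $ j)) * Kl xs m)"
      by (intro cg_smul cg_times_right kz_commute wt)
    finally show ?case
      by (simp add: mult.assoc chi_simps mult_ac flip: smul_mult_left)
  qed simp
  from this[of idx] show ?thesis
    unfolding Kp_def sum_axis_idx .
qed

text \<open>A linear section of the evaluation on the vacuum: \<open>theta_rho\<close> holds on the
  nose and \<open>rho_theta\<close> modulo \<open>J\<close>. Together with \<open>act_J\<close> and
  \<open>rho_Nsub\<close> this identifies \<open>U(chi)\<close> with the module modulo
  \<open>Nsub\<close>.\<close>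

definition rho :: "('k, 'i) pbw \<Rightarrow> ('k, 'i gen) ncpoly" where
  "rho = lin (\<lambda>(u, m, v). Ew u * Kp m * Fw v)"

lemma linmap_rho [simp, intro]: "linmap rho"
  by (simp add: rho_def)

lemma rho_bas: "rho (bas (u, m, v)) = Ew u * Kp m * Fw v"
  by (simp add: rho_def)

lemma gF_Ew: "gF i * Ew u \<simeq>\<^sub>J Ew u * gF i - lin Ew (Dp i u) * gK i + lin Ew (Dm i u) * gL i"
proof (induction u rule: word_induct)
  case zero
  show ?case unfolding Ew_0 by simp
next
  case (step j u)
  let ?d = "if i = j then gK i - gL i else 0"
  have 1: "gF i * gE j \<simeq>\<^sub>J gE j * gF i - ?d"
    using rel_EF[of j i] cg_sym by (auto simp: cg_def algebra_simps dest: subsp_uminus[OF J_subsp])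
  have lE: "lin Ew (bas (var j) * p) = gE j * lin Ew p" for p
    unfolding lin_times_left Ew_var_step
    by (rule linmap_lin_apply[OF linmap_times_left, symmetric])
  have 2: "?d * Ew u \<simeq>\<^sub>J (if i = j then smul (chi (alpha i) (zdeg u)) (Ew u) * gK i
      - smul (inverse (chi (alpha i) (zdeg u))) (Ew u) * gL i else 0)"
    using cg_diff[OF wtD[OF wt_Ew] wtD_inverse[OF wt_Ew]]
    by (simp add: left_diff_distrib flip: smul_mult_left)
  have "gF i * Ew (var j + u) = (gF i * gE j) * Ew u"
    unfolding Ew_var_step by (simp add: mult.assoc)
  also have "\<dots> \<simeq>\<^sub>J (gE j * gF i - ?d) * Ew u"
    by (rule cg_times_right) (rule 1)
  also have "\<dots> = gE j * (gF i * Ew u) - ?d * Ew u"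
    by (simp add: left_diff_distrib mult.assoc)
  also have "\<dots> \<simeq>\<^sub>J gE j * (Ew u * gF i - lin Ew (Dp i u) * gK i + lin Ew (Dm i u) * gL i)
     - (if i = j then smul (chi (alpha i) (zdeg u)) (Ew u) * gK i
      - smul (inverse (chi (alpha i) (zdeg u))) (Ew u) * gL i else 0)"
    by (intro cg_diff cg_times_left step 2)
  also have "\<dots> = Ew (var j + u) * gF i - lin Ew (Dp i (var j + u)) * gK i + lin Ew (Dm i (var j + u)) * gL i"
    unfolding Ew_var_step Dp_step Dm_step lin_add lE
    by (auto simp: lin_smul algebra_simps)
  finally show ?case .
qed

text \<open>Reordering a generator in front of E_u K_m F_v by the relations gives what the operator
  prescribes; this is the origin of the formulas for the operators.\<close>

lemma rho_opG: "ncvar g * rho x \<simeq>\<^sub>J rho (opG g x)"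
proof (rule cg_linmap[of "\<lambda>x. ncvar g * rho x"])
  fix a assume "a \<in> keys x"
  obtain u m v where a: "a = (u, m, v)" by (cases a)
  show "ncvar g * rho (bas a) \<simeq>\<^sub>J rho (opG g (bas a))"
  proof (cases g)
    case (GenE i)
    then show ?thesis
      unfolding a opG.simps opE_bas rho_bas GenE Ew_var_step by (simp add: mult.assoc)
  next
    case (GenK i)
    have "gK i * Ew u * (Kp m * Fw v) \<simeq>\<^sub>J smul (chi (alpha i) (zdeg u)) (Ew u * gK i) * (Kp m * Fw v)"
      by (intro cg_times_right wtD wt_Ew)
    also have "\<dots> = smul (chi (alpha i) (zdeg u)) (Ew u * (gK i * Kp m) * Fw v)"
      by (simp add: mult.assoc flip: smul_mult_left)
    also have "\<dots> \<simeq>\<^sub>J smul (chi (alpha i) (zdeg u)) (Ew u * Kp (m + alpha i) * Fw v)"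
      by (intro cg_smul cg_times_left cg_times_right gK_Kp)
    finally show ?thesis
      using GenK by (simp add: a opK_bas rho_bas linmap_smul[OF linmap_rho] mult.assoc)
  next
    case (GenKinv i)
    have "gL i * Ew u * (Kp m * Fw v) \<simeq>\<^sub>J smul (inverse (chi (alpha i) (zdeg u))) (Ew u * gL i) * (Kp m * Fw v)"
      by (intro cg_times_right wtD_inverse wt_Ew)
    also have "\<dots> = smul (inverse (chi (alpha i) (zdeg u))) (Ew u * (gL i * Kp m) * Fw v)"
      by (simp add: mult.assoc flip: smul_mult_left)
    also have "\<dots> \<simeq>\<^sub>J smul (inverse (chi (alpha i) (zdeg u))) (Ew u * Kp (m - alpha i) * Fw v)"
      by (intro cg_smul cg_times_left cg_times_right gL_Kp)
    finally show ?thesis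
      using GenKinv by (simp add: a opK_bas rho_bas linmap_smul[OF linmap_rho] mult.assoc chi_simps)
  next
    case (GenF i)
    have FK: "gF i * Kp m \<simeq>\<^sub>J smul (chi m (alpha i)) (Kp m * gF i)"
    proof -
      have "gF i * Kp m = smul (chi m (alpha i)) (smul (chi m (- alpha i)) (gF i * Kp m))"
        by (simp add: chi_simps)
      also have "\<dots> \<simeq>\<^sub>J smul (chi m (alpha i)) (Kp m * gF i)"
        by (intro cg_smul cg_sym[OF Kp_commute] wt_F)
      finally show ?thesis .
    qed
    have lE: "lin f p * y = lin (\<lambda>u. f u * y) p" for f :: "'i word \<Rightarrow> ('k, 'i gen) ncpoly" and p y
      by (rule linmap_lin_apply[OF linmap_times_right])
    have "gF i * rho (bas a) = gF i * Ew u * (Kp m * Fw v)"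
      by (simp add: a rho_bas mult.assoc)
    also have "\<dots> \<simeq>\<^sub>J (Ew u * gF i - lin Ew (Dp i u) * gK i + lin Ew (Dm i u) * gL i) * (Kp m * Fw v)"
      by (intro cg_times_right gF_Ew)
    also have "\<dots> = Ew u * (gF i * Kp m) * Fw v - lin Ew (Dp i u) * (gK i * Kp m) * Fw v
        + lin Ew (Dm i u) * (gL i * Kp m) * Fw v"
      by (simp add: algebra_simps)
    also have "\<dots> \<simeq>\<^sub>J Ew u * smul (chi m (alpha i)) (Kp m * gF i) * Fw v
        - lin Ew (Dp i u) * Kp (m + alpha i) * Fw v + lin Ew (Dm i u) * Kp (m - alpha i) * Fw v"
      by (intro cg_add cg_diff cg_times_right cg_times_left FK gK_Kp gL_Kp)
    also have "\<dots> = rho (opF i (bas a))"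
      unfolding a opF_def op_bas linmap_add[OF linmap_rho] linmap_diff[OF linmap_rho]
        linmap_smul[OF linmap_rho] linmap_lin_apply[OF linmap_rho] rho_bas lE mult.assoc Fw_var_step
      by (simp add: mult.assoc flip: smul_mult_left smul_mult_right)
    finally show ?thesis using GenF by simp
  qed
qed (auto intro!: linmap_comp[OF linmap_times_left linmap_rho] linmap_comp[OF linmap_rho linmap_opG])

definition theta :: "('k, 'i gen) ncpoly \<Rightarrow> ('k, 'i) pbw" where
  "theta a = act a (bas (0, 0, 0))"

lemma linmap_theta [simp, intro]: "linmap theta"
  unfolding theta_def[abs_def] by simp

lemma theta_mult: "theta (a * b) = act a (theta b)"
  by (simp add: theta_def act_mult)

lemma rho_theta: "rho (theta a) \<simeq>\<^sub>J a"
proof (rule cg_linmap[of "\<lambda>a. rho (theta a)" "\<lambda>a. a"])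
  fix w
  show "rho (theta (bas w)) \<simeq>\<^sub>J bas w"
  proof (induction w rule: word_induct)
    case zero
    have "rho (bas (0, 0, 0)) = 1"
      unfolding rho_bas Ew_0 Fw_0 Kp_0 by simp
    then show ?case by (simp add: theta_def)
  next
    case (step g w)
    have "rho (theta (bas (var g + w))) = rho (opG g (theta (bas w)))"
      by (simp add: theta_def)
    also have "\<dots> \<simeq>\<^sub>J ncvar g * rho (theta (bas w))"
      by (rule cg_sym[OF rho_opG])
    also have "\<dots> \<simeq>\<^sub>J ncvar g * bas w"
      by (rule cg_times_left) (rule step)
    finally show ?case
      by (simp add: ncvar_def bas_times_bas)
  qed
qed (auto intro!: linmap_comp[OF linmap_rho linmap_theta] linmap_id)

lemma rho_Nsub: "x \<in> Nsub \<Longrightarrow> rho x \<in> J"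
proof (erule Nsub_linmap[OF _ linmap_rho J_subsp])
  fix a m v assume "a \<in> I"
  have "lin (\<lambda>u. rho (bas (u, m, v))) a = lin Ew a * (Kp m * Fw v)"
    unfolding rho_bas mult.assoc by (rule linmap_lin_apply[OF linmap_times_right, symmetric])
  then show "lin (\<lambda>u. rho (bas (u, m, v))) a \<in> J"
    using J_right[OF J_E[OF \<open>a \<in> I\<close>]] by simp
next
  fix b u m assume "b \<in> I"
  have "lin (\<lambda>v. rho (bas (u, m, v))) b = (Ew u * Kp m) * lin Fw b"
    unfolding rho_bas by (rule linmap_lin_apply[OF linmap_times_left, symmetric])
  then show "lin (\<lambda>v. rho (bas (u, m, v))) b \<in> J"
    using J_left[OF J_F[OF \<open>b \<in> I\<close>]] by simp
qed

lemma J_iff: "a \<in> J \<longleftrightarrow> theta a \<in> Nsub"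
proof
  assume "theta a \<in> Nsub"
  then have "rho (theta a) \<simeq>\<^sub>J 0"
    using rho_Nsub by (simp add: cg_def)
  then have "a \<simeq>\<^sub>J 0"
    using cg_trans[OF cg_sym[OF rho_theta]] by blast
  then show "a \<in> J" by (simp add: cg_def)
qed (simp add: theta_def act_J)

lemma cg_iff: "a \<simeq>\<^sub>J b \<longleftrightarrow> theta a - theta b \<in> Nsub"
  by (simp add: cg_def J_iff linmap_diff[OF linmap_theta])

lemma act_power: "act (x ^ n) y = ((act x) ^^ n) y"
  by (induction n) (simp_all add: act_mult)

lemma act_kz: "act (kz j n) x = opK (axis j n) x"
proof -
  have *: "((opK (axis j e)) ^^ n) x = opK (axis j (int n * e)) x" for n e
  proof (induction n)
    case 0
    show ?case by (simp add: axis_zero)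
  next
    case (Suc n)
    have "axis j e + axis j (int n * e) = axis j (int (Suc n) * e)"
      by (simp add: axis_def vec_eq_iff algebra_simps)
    with Suc show ?case by (simp add: opK_opK)
  qed
  have "axis j (- 1) = - alpha j" "axis j 1 = alpha j" for j :: 'i
    by (simp_all add: alpha_def axis_def vec_eq_iff)
  moreover have "act (gK j) = opK (alpha j)" "act (gL j) = opK (- alpha j)"
    by (simp_all add: fun_eq_iff)
  ultimately show ?thesis
    using *[where e = 1 and n = "nat n"] *[where e = "-1" and n = "nat (- n)"]
    by (auto simp: kz_def act_power)
qed

lemma act_Kp: "act (Kp m) x = opK m x"
proof -
  have "act (Kl xs m) x = opK (\<Sum>j\<leftarrow>xs. axis j (m $ j)) x" for xs
    by (induction xs) (simp_all add: act_mult act_kz opK_opK)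
  from this[of idx] show ?thesis
    unfolding Kp_def sum_axis_idx .
qed

lemma theta_rho_bas: "theta (Ew u * Kp m * Fw v) = bas (u, m, v)"
  by (simp add: theta_mult act_mult act_Kp theta_def opFw_def[symmetric] opFw_bas_0 opK_bas
      act_Ew del: act_bas)

lemma theta_rho: "theta (rho x) = x"
  by (rule pbw_eqI[of "\<lambda>x. theta (rho x)" "\<lambda>x. x"])
    (auto intro!: linmap_comp[OF linmap_theta linmap_rho] linmap_id simp: rho_bas theta_rho_bas)


section \<open>The lattice of \<open>H_theta\<close>\<close>


text \<open>Only sums of generators are formed, yet the result is a subgroup: the involution
  \<open>tau\<close> exchanges each generator alpha_i - alpha_(tau i) with its negative.\<close>

inductive_set Lat :: "(int ^ 'i) set" where
  Lat_0: "0 \<in> Lat"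
| Lat_add_gen: "l \<in> Lat \<Longrightarrow> l + (alpha i - alpha (tau i)) \<in> Lat"

lemma Lat_add: "l \<in> Lat \<Longrightarrow> m \<in> Lat \<Longrightarrow> l + m \<in> Lat"
  by (rotate_tac, induction rule: Lat.induct)
    (auto simp: add.assoc[symmetric] simp del: add_diff_eq intro: Lat_add_gen)

lemma Lat_gen: "alpha i - alpha (tau i) \<in> Lat"
  using Lat_add_gen[OF Lat_0, of i] by simp

lemma height_Lat: "l \<in> Lat \<Longrightarrow> height l = 0"
  by (induction rule: Lat.induct) (simp_all add: height_0 height_plus height_minus height_alpha)

lemma q_tau_left: "qmat chi (tau i) j = qmat chi i (tau j)"
  using q_tau[of i "tau j"] by simp

text \<open>On generators of \<open>Lat\<close> this is invariance and symmetry of q. It gives F_i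
  and E_(tau i) K_i^{-1} the same commutation scalar with K_l for l in \<open>Lat\<close>, so that
  \<open>B_i\<close> as a whole skew commutes with \<open>H_theta\<close>.\<close>

lemma chi_Lat: "l \<in> Lat \<Longrightarrow> chi l (alpha (tau i)) = inverse (chi l (alpha i))"
proof (induction rule: Lat.induct)
  case (Lat_add_gen l j)
  then show ?case
    by (simp add: chi_simps q_tau q_tau_left field_simps)
qed simp

lemma chi_sum_Lat: "l \<in> Lat \<Longrightarrow> chi (alpha i + alpha (tau i)) l = 1"
proof (induction rule: Lat.induct)
  case (Lat_add_gen l j)
  then show ?case
    by (simp add: chi_simps q_tau q_tau_left)
qed simp

lemma chi_zdeg_sym: "chi (alpha j) (zdeg w) = chi (zdeg w) (alpha j)"
  by (induction w rule: word_induct) (simp_all add: chi_simps q_sym)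


section \<open>The generators of the coideal subalgebra as operators\<close>

definition Bg :: "'i \<Rightarrow> ('k, 'i gen) ncpoly" where
  "Bg i = gF i + ncconst (c $ i) * gE (tau i) * gL i"

definition opL :: "'i \<Rightarrow> ('k, 'i) pbw \<Rightarrow> ('k, 'i) pbw" where
  "opL i x = smul (c $ i) (opE (tau i) (opK (- alpha i) x))"

text \<open>\<open>Bg i\<close> acts by \<open>opBs i - opDp i\<close>, where \<open>opBs i\<close> lowers the degree \<open>m - v\<close> of \<open>(u, m, v)\<close>
  by \<open>alpha i\<close> while \<open>opDp i\<close> raises it; this is the degree of the projections \<open>proj_P\<close>.\<close>

definition opC :: "'i \<Rightarrow> ('k, 'i) pbw \<Rightarrow> ('k, 'i) pbw" where
  "opC i x = opL i x + opDm i x"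

definition opBs :: "'i \<Rightarrow> ('k, 'i) pbw \<Rightarrow> ('k, 'i) pbw" where
  "opBs i x = op0 i x + opC i x"

definition opB :: "'i \<Rightarrow> ('k, 'i) pbw \<Rightarrow> ('k, 'i) pbw" where
  "opB i x = opBs i x - opDp i x"

lemma linmap_opL [simp, intro]: "linmap (opL i)"
  unfolding opL_def[abs_def] by (intro linmap_intros)

lemma linmap_opC [simp, intro]: "linmap (opC i)"
  unfolding opC_def[abs_def] by (intro linmap_intros linmap_opL)

lemma linmap_opBs [simp, intro]: "linmap (opBs i)"
  unfolding opBs_def[abs_def] by (intro linmap_intros linmap_opC)

lemma linmap_opB [simp, intro]: "linmap (opB i)"
  unfolding opB_def[abs_def] by (intro linmap_intros linmap_opBs)

lemmas opB_lin = linmap_lin_apply [OF linmap_opL] linmap_lin_apply [OF linmap_opC]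
    linmap_lin_apply [OF linmap_opBs] linmap_lin_apply [OF linmap_opB]
  and opB_diff = linmap_diff [OF linmap_opL] linmap_diff [OF linmap_opC]
    linmap_diff [OF linmap_opBs] linmap_diff [OF linmap_opB]
  and opB_smul = linmap_smul [OF linmap_opL] linmap_smul [OF linmap_opC]
    linmap_smul [OF linmap_opBs] linmap_smul [OF linmap_opB]

lemma act_Bg: "act (Bg i) x = opB i x"
  by (simp add: Bg_def opB_def opBs_def opC_def opL_def opF_def act_add act_mult)

lemma opL_opK: "opL i (opK l x) = smul (inverse (chi l (alpha (tau i)))) (opK l (opL i x))"
  by (simp add: opL_def op_smul opK_opE opK_opK add.commute mult_ac)

lemma opC_opK: "l \<in> Lat \<Longrightarrow> opC i (opK l x) = smul (chi l (alpha i)) (opK l (opC i x))"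
  by (simp add: opC_def opL_opK opDm_opK chi_Lat op_add smul_add)

lemma opBs_opK: "l \<in> Lat \<Longrightarrow> opBs i (opK l x) = smul (chi l (alpha i)) (opK l (opBs i x))"
  by (simp add: opBs_def opC_opK op0_opK op_add smul_add)

lemma opB_opK: "l \<in> Lat \<Longrightarrow> opB i (opK l x) = smul (chi l (alpha i)) (opK l (opB i x))"
  by (simp add: opB_def opBs_opK opDp_opK op_diff smul_diff)

lemma opK_op0: "opK l (op0 i x) = smul (inverse (chi l (alpha i))) (op0 i (opK l x))"
  by (simp add: op0_opK)

lemma opC_op0: "opC j (op0 i x) = smul (chi (alpha j) (alpha i)) (op0 i (opC j x))"
  by (simp add: opC_def opL_def opK_op0 op0_opE[symmetric] opDm_op0 op_add op_smul smul_add chi_simps mult_ac)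

lemma opDp_opL: "opDp i (opL k x) = smul (inverse (chi (alpha i) (alpha k))) (opL k (opDp i x))
    + (if i = tau k then smul (c $ k) (opK (alpha i - alpha k) x) else 0)"
  by (simp add: opL_def op_smul opDp_opE opDp_opK opK_opK smul_add chi_simps q_sym mult_ac)

lemma opDm_opL: "opDm i (opL k x) = smul (inverse (chi (alpha i) (alpha k))) (opL k (opDm i x))
    + (if i = tau k then smul (c $ k) (opK (- alpha i - alpha k) x) else 0)"
  by (simp add: opL_def op_smul opDm_opE opDm_opK opK_opK smul_add chi_simps q_sym mult_ac)

text \<open>Only the summand of \<open>opBs k\<close> that contains E_(tau k) can be contracted by
  \<open>opDp i\<close>. The result K_i K_k^{-1} with i = tau k has its weight in
  \<open>Lat\<close>, hence lies in \<open>H_theta\<close> and skew commutes with all further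
  \<open>opBs\<close>.\<close>

lemma opDp_opBs: "opDp i (opBs k x) = smul (inverse (chi (alpha i) (alpha k))) (opBs k (opDp i x))
    + (if i = tau k then smul (c $ k) (opK (alpha i - alpha k) x) else 0)"
  by (simp add: opBs_def opC_def op_add opDp_op0 opDp_opL opDp_opDm smul_add)

section \<open>Monomials in the \<open>B_i\<close> applied to the vacuum vector\<close>

definition Bw :: "'i word \<Rightarrow> ('k, 'i gen) ncpoly" where
  "Bw w = foldr (\<lambda>i y. Bg i * y) (letters w) 1"

lemma Bw_0 [simp]: "Bw 0 = 1"
  and Bw_step: "Bw (var i + w) = Bg i * Bw w"
  by (simp_all add: Bw_def)

lemma Bw_plus: "Bw (u + v) = Bw u * Bw v"
  by (induction u rule: word_induct) (simp_all add: Bw_step add.assoc mult.assoc)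

abbreviation vac :: "('k, 'i) pbw" where "vac \<equiv> bas (0, 0, 0)"

definition thB :: "'i word \<Rightarrow> ('k, 'i) pbw" where "thB w = theta (Bw w)"

lemma thB_0: "thB 0 = vac"
  and thB_step: "thB (var i + w) = opB i (thB w)"
  by (simp_all add: thB_def Bw_step theta_mult act_Bg) (simp add: theta_def)

text \<open>The part of \<open>thB w\<close> in which no \<open>opDp\<close> is used; by
  \<open>res_thB\<close> it is the component of lowest degree m - v.\<close>

definition Xw :: "'i word \<Rightarrow> ('k, 'i) pbw" where "Xw w = foldr opBs (letters w) vac"

lemma Xw_0: "Xw 0 = vac" and Xw_step: "Xw (var i + w) = opBs i (Xw w)"
  by (simp_all add: Xw_def)

text \<open>\<open>opDp i\<close> kills the vacuum, so commuting it to the right leaves one term for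
  each factorization w = w' x_(tau i) w''. Its scalar is the inverse of chi(alpha_(tau i), w') once
  the K factor has been moved to the left; the quotient in front rewrites this through
  chi(alpha_(tau i), w''), the scalar of \<open>Dp\<close>.\<close>

lemma opDp_Xw:
  "opDp i (Xw w) = smul (c $ tau i * chi (alpha (tau i)) (alpha (tau i)) / chi (alpha (tau i)) (zdeg w))
     (opK (alpha i - alpha (tau i)) (lin Xw (Dp (tau i) w)))"
proof (induction w rule: word_induct)
  case zero
  show ?case by (simp add: Xw_0 opDp_bas)
next
  case (step k w)
  have k: "(i = tau k) = (tau i = k)" by (metis tau_invol)
  have ll: "lin Xw (bas (var k) * p) = opBs k (lin Xw p)" for p
    by (simp add: lin_times_left Xw_step opB_lin)
  show ?case
    by (auto simp: Xw_step opDp_opBs step opB_smul opBs_opK[OF Lat_gen] Dp_step lin_add lin_smul ll op_add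
        op_smul smul_add chi_simps q_sym k field_simps)
qed

lemma keys_linmap:
  assumes "linmap f" "\<And>a. a \<in> P \<Longrightarrow> keys (f (bas a)) \<subseteq> Q" "keys x \<subseteq> P"
  shows "keys (f x) \<subseteq> Q"
  using linmap_mem[OF assms(1) subsp_keys, of x Q] assms(2,3) by auto

lemma keys_lin_bas:
  "(\<And>w. w \<in> keys p \<Longrightarrow> f w \<in> Q) \<Longrightarrow> keys (lin (\<lambda>w. bas (f w)) p :: 'a \<Rightarrow>\<^sub>0 'k) \<subseteq> Q"
  using keys_lin[of "\<lambda>w. bas (f w)" p] by auto

lemma opL_bas: "opL i (bas (u, m, v)) =
    smul (c $ i * chi (- alpha i) (zdeg u)) (bas (var (tau i) + u, m - alpha i, v))"
  by (simp add: opL_def op_bas op_smul)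

text \<open>The three transitions of the support are those of \<open>op0\<close>,
  \<open>opDm\<close> and \<open>opL\<close>, in this order.\<close>

lemma keys_opBs:
  assumes "\<And>u m v. P (u, m, v) \<Longrightarrow> Q (u, m, var i + v)"
    and "\<And>u m v u'. P (u, m, v) \<Longrightarrow> zdeg u = alpha i + zdeg u' \<Longrightarrow> Q (u', m - alpha i, v)"
    and "\<And>u m v. P (u, m, v) \<Longrightarrow> Q (var (tau i) + u, m - alpha i, v)"
    and "keys x \<subseteq> Collect P"
  shows "keys (opBs i x) \<subseteq> Collect Q"
proof (rule keys_linmap[OF _ _ assms(4)])
  fix a assume "a \<in> Collect P"
  moreover obtain u m v where a: "a = (u, m, v)" by (cases a)
  ultimately have P: "P (u, m, v)" by simp
  have 1: "keys (op0 i (bas a)) \<subseteq> Collect Q"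
    using assms(1)[OF P] by (auto simp: a op0_bas smul_bas)
  have 2: "keys (opDm i (bas a)) \<subseteq> Collect Q"
    unfolding a opDm_bas by (rule keys_lin_bas) (use assms(2)[OF P] keys_Dm in blast)
  have 3: "keys (opL i (bas a)) \<subseteq> Collect Q"
    using assms(3)[OF P] by (auto simp: a opL_bas smul_bas)
  from 1 2 3 show "keys (opBs i (bas a)) \<subseteq> Collect Q"
    using subsp_add[OF subsp_keys[of "Collect Q"], of "op0 i (bas a)" "opL i (bas a) + opDm i (bas a)"]
      subsp_add[OF subsp_keys[of "Collect Q"], of "opL i (bas a)" "opDm i (bas a)"]
    by (simp add: opBs_def opC_def)
qed simp

lemma keys_opDp:
  assumes "\<And>u m v u'. P (u, m, v) \<Longrightarrow> zdeg u = alpha i + zdeg u' \<Longrightarrow> Q (u', m + alpha i, v)"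
    and "keys x \<subseteq> Collect P"
  shows "keys (opDp i x) \<subseteq> Collect Q"
proof (rule keys_linmap[OF _ _ assms(2)])
  fix a assume "a \<in> Collect P"
  moreover obtain u m v where a: "a = (u, m, v)" by (cases a)
  ultimately have P: "P (u, m, v)" by simp
  show "keys (opDp i (bas a)) \<subseteq> Collect Q"
    unfolding a opDp_bas by (rule keys_lin_bas) (use assms(1)[OF P] keys_Dp in blast)
qed simp

text \<open>The first invariant is the degree of \<open>proj_P\<close>. The second says that every
  term commutes with K_l, l in \<open>Lat\<close>, by the same scalar as \<open>B_w\<close>; the
  only nontrivial case is \<open>opL\<close>, where u + w grows by alpha_(tau i) + alpha_i and
  \<open>chi_sum_Lat\<close> applies.\<close>

lemma keys_Xw: "(u, m, v) \<in> keys (Xw w) \<Longrightarrow>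
    m - zdeg v = - zdeg w \<and> (\<forall>l\<in>Lat. chi (zdeg u + zdeg w - zdeg v) l = 1)"
proof -
  let ?P = "\<lambda>w (u, m, v). m - zdeg v = - zdeg w \<and> (\<forall>l\<in>Lat. chi (zdeg u + zdeg w - zdeg v) l = 1)"
  have "keys (Xw w) \<subseteq> Collect (?P w)"
  proof (induction w rule: word_induct)
    case (step i w)
    show ?case
      unfolding Xw_step
    proof (rule keys_opBs[OF _ _ _ step])
      fix u m v assume P: "?P w (u, m, v)"
      then show "?P (var i + w) (u, m, var i + v)" by (auto simp: algebra_simps)
      show "?P (var i + w) (u', m - alpha i, v)" if "zdeg u = alpha i + zdeg u'" for u'
        using P by (auto simp: algebra_simps that)
      have "zdeg (var (tau i) + u) + zdeg (var i + w) - zdeg v =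
          (zdeg u + zdeg w - zdeg v) + (alpha i + alpha (tau i))" by simp
      then have "chi (zdeg (var (tau i) + u) + zdeg (var i + w) - zdeg v) l = 1" if "l \<in> Lat" for l
        using P that by (simp only: chi_add_left[of "zdeg u + zdeg w - zdeg v"] chi_sum_Lat) auto
      then show "?P (var i + w) (var (tau i) + u, m - alpha i, v)"
        using P by (auto simp: algebra_simps)
    qed
  qed (simp add: Xw_0)
  then show "(u, m, v) \<in> keys (Xw w) \<Longrightarrow> ?thesis" by blast
qed

text \<open>Each \<open>opDp\<close> in place of an \<open>opBs\<close> raises the height by one
  instead of lowering it, so all terms beyond \<open>Xw w\<close> have strictly larger
  height.\<close>

lemma keys_thB_Xw: "(u, m, v) \<in> keys (thB w - Xw w) \<Longrightarrow> height (m - zdeg v) > - int (wlen w)"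
proof -
  let ?P = "\<lambda>n (u, m, v). height (m - zdeg v) > n"
  have "keys (thB w - Xw w) \<subseteq> Collect (?P (- int (wlen w)))"
  proof (induction w rule: word_induct)
    case (step i w)
    let ?n = "- int (wlen w)"
    have X: "keys (Xw w) \<subseteq> Collect (?P (?n - 1))"
    proof clarify
      fix u m v assume "(u, m, v) \<in> keys (Xw w)"
      from keys_Xw[OF this] have "height (m - zdeg v) = ?n"
        by (simp add: height_uminus height_zdeg)
      then show "?n - 1 < height (m - zdeg v)" by simp
    qed
    have "keys (thB w - Xw w) \<subseteq> Collect (?P (?n - 1))"
      using step.IH by auto
    then have "keys ((thB w - Xw w) + Xw w) \<subseteq> Collect (?P (?n - 1))"
      using X subsp_add[OF subsp_keys] by blast
    then have D: "keys (opDp i (thB w)) \<subseteq> Collect (?P ?n)"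
      by (intro keys_opDp[of "?P (?n - 1)"])
        (auto simp: height_plus height_minus height_alpha)
    have "keys (opBs i (thB w - Xw w)) \<subseteq> Collect (?P (?n - 1))"
      by (rule keys_opBs[OF _ _ _ step.IH]) (auto simp: height_plus height_minus height_alpha)
    moreover have "keys (opDp i (thB w)) \<subseteq> Collect (?P (?n - 1))"
      using D by auto
    ultimately have "keys (opBs i (thB w - Xw w) - opDp i (thB w)) \<subseteq> Collect (?P (?n - 1))"
      using subsp_diff[OF subsp_keys] by blast
    moreover have "opBs i (thB w - Xw w) - opDp i (thB w) = thB (var i + w) - Xw (var i + w)"
      by (simp add: thB_step Xw_step opB_def opB_diff algebra_simps)
    moreover have "?n - 1 = - int (wlen (var i + w))" by simp
    ultimately show ?case by (simp only:)
  qed (simp add: thB_0 Xw_0)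
  then show "(u, m, v) \<in> keys (thB w - Xw w) \<Longrightarrow> ?thesis" by blast
qed

lemma res_thB: "res (\<lambda>(u, m, v). m - zdeg v = - zdeg w) (thB w) = Xw w"
proof -
  let ?P = "\<lambda>(u, m, v). m - zdeg v = - zdeg w"
  have "res ?P (Xw w) = Xw w"
    using keys_Xw by (intro res_all) auto
  moreover have "res ?P (thB w - Xw w) = 0"
  proof (rule res_none)
    fix a assume a: "a \<in> keys (thB w - Xw w)"
    obtain u m v where uv: "a = (u, m, v)" by (cases a)
    have "height (m - zdeg v) > - int (wlen w)"
      using keys_thB_Xw a uv by blast
    then show "\<not> ?P a"
      using height_uminus[of "zdeg w"] height_zdeg[of w] uv by auto
  qed
  ultimately show ?thesis
    using res_add[of ?P "thB w - Xw w" "Xw w"] by simp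
qed

text \<open>The level |u| - |v| drops by at most one for each \<open>B_i\<close>. The vector F_w
  itself has u = 0, so the derivations kill it and only \<open>op0\<close> lowers its level;
  everything else stays strictly above.\<close>

lemma keys_thB_top: "(u, m, v) \<in> keys (thB w - bas (0, 0, w)) \<Longrightarrow> int (wlen u) - int (wlen v) > - int (wlen w)"
proof -
  let ?P = "\<lambda>n (u, m :: int ^ 'i, v). int (wlen u) - int (wlen v) > n"
  have len: "int (wlen u) = 1 + int (wlen u')" if "zdeg u = alpha i + zdeg u'" for u u' :: "'i word" and i
    using arg_cong[OF that, of height] by (simp add: height_plus height_zdeg height_alpha)
  have "keys (thB w - bas (0, 0, w)) \<subseteq> Collect (?P (- int (wlen w)))"
  proof (induction w rule: word_induct)
    case (step i w)
    let ?n = "- int (wlen w)"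
    let ?S = "{x. keys x \<subseteq> Collect (?P (?n - 1))}"
    let ?b = "bas (0, 0, w) :: ('k, 'i) pbw"
    have "opBs i (thB w - ?b) \<in> ?S"
      by (simp, rule keys_opBs[OF _ _ _ step.IH]) (auto dest: len)
    moreover have "opDp i (thB w - ?b) \<in> ?S"
      by (simp, rule keys_opDp[OF _ step.IH]) (auto dest: len)
    moreover have "opL i ?b \<in> ?S"
      by (auto simp: opL_bas smul_bas)
    ultimately have "opBs i (thB w - ?b) - opDp i (thB w - ?b) + opL i ?b \<in> ?S"
      by (intro subsp_add[OF subsp_keys] subsp_diff[OF subsp_keys])
    moreover have "opBs i (thB w - ?b) - opDp i (thB w - ?b) + opL i ?b = thB (var i + w) - bas (0, 0, var i + w)"
      by (simp add: thB_step opB_def opB_diff op_diff opBs_def opC_def op_bas algebra_simps)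
    moreover have "?n - 1 = - int (wlen (var i + w))" by simp
    ultimately show ?case by (simp only: mem_Collect_eq)
  qed (simp add: thB_0)
  then show "(u, m, v) \<in> keys (thB w - bas (0, 0, w)) \<Longrightarrow> ?thesis" by blast
qed

section \<open>The filtration\<close>

text \<open>\<open>SS n\<close> indexes the elements of the filtration step \<open>n - 1\<close>.\<close>

definition SS :: "nat \<Rightarrow> ((int ^ 'i) \<times> 'i word \<Rightarrow>\<^sub>0 'k) set" where
  "SS n = {s. keys s \<subseteq> {(m, w). m \<in> Lat \<and> wlen w < n}}"

definition thH :: "((int ^ 'i) \<times> 'i word \<Rightarrow>\<^sub>0 'k) \<Rightarrow> ('k, 'i) pbw" where
  "thH = lin (\<lambda>(m, w). opK m (thB w))"

definition FM :: "nat \<Rightarrow> ('k, 'i) pbw set" where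
  "FM n = thH ` SS n"

lemma SS_subsp: "subsp (SS n)"
  unfolding SS_def by (rule subsp_keys)

lemma linmap_thH [simp, intro]: "linmap thH"
  by (simp add: thH_def)

lemma FM_subsp: "subsp (FM n)"
  unfolding FM_def by (rule subsp_image[OF linmap_thH SS_subsp])

lemma FM_gen: "m \<in> Lat \<Longrightarrow> wlen w < n \<Longrightarrow> opK m (thB w) \<in> FM n"
  unfolding FM_def by (rule image_eqI[of _ _ "bas (m, w)"]) (simp_all add: thH_def SS_def)

lemma FM_linmap:
  assumes "linmap f" "subsp S" "\<And>m w. m \<in> Lat \<Longrightarrow> wlen w < n \<Longrightarrow> f (opK m (thB w)) \<in> S" "x \<in> FM n"
  shows "f x \<in> S"
proof -
  obtain s where s: "s \<in> SS n" and x: "x = thH s"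
    using assms(4) by (auto simp: FM_def)
  show ?thesis
    unfolding x thH_def linmap_lin_apply[OF assms(1)]
    by (rule lin_mem[OF assms(2)]) (use s in \<open>auto simp: SS_def intro!: assms(3)\<close>)
qed

lemma FM_mono: "n \<le> n' \<Longrightarrow> FM n \<subseteq> FM n'"
  using FM_linmap[OF linmap_id FM_subsp, of n n'] FM_gen by fastforce

lemma FM_opK: "l \<in> Lat \<Longrightarrow> x \<in> FM n \<Longrightarrow> opK l x \<in> FM n"
  by (erule FM_linmap[OF linmap_ops(2) FM_subsp, rotated]) (simp add: opK_opK FM_gen Lat_add)

lemma FM_opB: "x \<in> FM n \<Longrightarrow> opB i x \<in> FM (Suc n)"
  by (erule FM_linmap[OF linmap_opB FM_subsp, rotated])
    (auto simp: opB_opK thB_step[symmetric] intro!: subsp_smul[OF FM_subsp] FM_gen)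

lemma thB_FM: "wlen w < n \<Longrightarrow> thB w \<in> FM n"
  using FM_gen[OF Lat_0, of w n] by simp

text \<open>For w = x_i v one has X_w - B_w = B_i (X_v - B_v) + d_i X_v on the vacuum, and by
  \<open>opDp_Xw\<close> the last term comes from K_l, l in \<open>Lat\<close>, applied to X_u for
  words u shorter than v. These need not be suffixes of w, hence the induction on length.\<close>

lemma Xw_thB: "Xw w - thB w \<in> FM (wlen w)"
proof (induction "wlen w" arbitrary: w rule: less_induct)
  case less
  show ?case
  proof (cases "letters w")
    case Nil
    then have "w = 0" by simp
    then show ?thesis by (simp add: Xw_0 thB_0 subsp_0[OF FM_subsp])
  next
    case (Cons i l)
    define v where "v = Word l"
    have w: "w = var i + v"
      using Cons by (cases w) (simp add: v_def plus_word_def)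
    have "lin Xw (Dp (tau i) v) \<in> FM (wlen v)"
    proof (rule lin_mem[OF FM_subsp])
      fix u assume "u \<in> keys (Dp (tau i) v)"
      from arg_cong[OF keys_Dp[OF this], of height] have u: "wlen u < wlen v"
        by (simp add: height_plus height_zdeg height_alpha)
      then have "Xw u - thB u \<in> FM (wlen v)"
        using less[of u] FM_mono[of "wlen u" "wlen v"] w by auto
      moreover have "thB u \<in> FM (wlen v)"
        by (rule thB_FM) (rule u)
      ultimately show "Xw u \<in> FM (wlen v)"
        using subsp_add[OF FM_subsp, of "Xw u - thB u" "wlen v" "thB u"] by simp
    qed
    then have "opDp i (Xw v) \<in> FM (wlen v)"
      unfolding opDp_Xw by (intro subsp_smul[OF FM_subsp] FM_opK Lat_gen)
    then have "opDp i (Xw v) \<in> FM (wlen w)"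
      using FM_mono[of "wlen v" "wlen w"] w by auto
    moreover have "opB i (Xw v - thB v) \<in> FM (wlen w)"
      using FM_opB[OF less[of v]] w by simp
    ultimately have "opB i (Xw v - thB v) + opDp i (Xw v) \<in> FM (wlen w)"
      by (intro subsp_add[OF FM_subsp])
    then show ?thesis
      by (simp add: w Xw_step thB_step opB_diff) (simp add: opB_def)
  qed
qed

lemma Xp_FM: "(\<And>w. w \<in> keys p \<Longrightarrow> wlen w \<le> n) \<Longrightarrow> lin Xw p - lin thB p \<in> FM n"
  unfolding lin_fun_diff[symmetric]
  by (rule lin_mem[OF FM_subsp]) (use Xw_thB FM_mono in blast)


section \<open>A Wick formula\<close>


text \<open>\<open>op0\<close> creates letters of F, while \<open>opC\<close> acts on the E and K
  part only. \<open>Cw\<close> uses only \<open>opC\<close>, and \<open>Lw\<close> only those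
  summands of it that create letters of E.\<close>

definition op0w :: "'i word \<Rightarrow> ('k, 'i) pbw \<Rightarrow> ('k, 'i) pbw" where
  "op0w w x = foldr op0 (letters w) x"
definition Cw :: "'i word \<Rightarrow> ('k, 'i) pbw" where "Cw w = foldr opC (letters w) vac"
definition Lw :: "'i word \<Rightarrow> ('k, 'i) pbw" where "Lw w = foldr opL (letters w) vac"

lemma op0w_0 [simp]: "op0w 0 x = x" and op0w_step [simp]: "op0w (var i + w) x = op0 i (op0w w x)"
  and Cw_0: "Cw 0 = vac" and Cw_step: "Cw (var i + w) = opC i (Cw w)"
  and Lw_0: "Lw 0 = vac" and Lw_step: "Lw (var i + w) = opL i (Lw w)"
  by (simp_all add: op0w_def Cw_def Lw_def)

lemma linmap_op0w [simp, intro]: "linmap (op0w w)"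
proof (induction w rule: word_induct)
  case zero
  show ?case using linmap_id by (simp add: op0w_def[abs_def])
next
  case (step i w)
  then show ?case
    using linmap_comp[OF linmap_ops(3)[of i] step] by (simp add: linmap_def)
qed

lemma opC_op0w: "opC j (op0w w x) = smul (chi (alpha j) (zdeg w)) (op0w w (opC j x))"
  by (induction w rule: word_induct) (simp_all add: opC_op0 op_smul chi_simps mult_ac)

text \<open>Expand the product of the \<open>op0 i + opC i\<close> and move all \<open>op0\<close>
  to the left. The scalar chi(alpha_j, alpha_i) of \<open>opC_op0\<close> is the one by which
  letters are exchanged in the braided tensor square, so the terms are those of the
  coproduct.\<close>

lemma Xw_wick: "Xw w = lin (\<lambda>(u, v). op0w u (Cw v)) (cop w)"
proof (induction w rule: word_induct)
  case zero
  show ?case by (simp add: cop_0 Xw_0 Cw_0)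
next
  case (step i w)
  have "Xw (var i + w) = lin (\<lambda>x. opBs i (case x of (u, v) \<Rightarrow> op0w u (Cw v))) (cop w)"
    unfolding Xw_step step by (rule opB_lin)
  also have "\<dots> = lin (\<lambda>(u, v). op0w u (Cw v)) (cop (var i + w))"
    unfolding lin_cop_step by (rule lin_cong) (auto simp: opBs_def opC_op0w Cw_step)
  finally show ?case .
qed

text \<open>By \<open>keys_Xw\<close> this is the only weight that can occur together with u = v =
  0.\<close>

definition kappa :: "'i word \<Rightarrow> 'k" where
  "kappa w = coef (Xw w) (0, - zdeg w, 0)"

lemma kappa_Lat: "kappa w \<noteq> 0 \<Longrightarrow> l \<in> Lat \<Longrightarrow> chi (zdeg w) l = 1"
  using keys_Xw[of 0 "- zdeg w" 0 w] by (auto simp: kappa_def in_keys_iff)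

lemma kappa_0: "kappa 0 = 1"
  by (simp add: kappa_def Xw_0)

text \<open>Creating a letter of E or F cannot lead to u = v = 0, so only \<open>opDm\<close>
  contributes, and only from vectors with u = x_i. There \<open>Dm\<close> and \<open>Dp\<close>
  agree, so \<open>opDm\<close> may be traded for \<open>opDp\<close>, whose action on
  \<open>Xw\<close> is known, at the price of a shift by 2 alpha_i.\<close>

lemma coef_opBs_0: "coef (opBs i x) (0, m, 0) = coef (opDp i x) (0, m + alpha i + alpha i, 0)"
proof -
  \<comment> \<open>A coefficient becomes a map into the one-dimensional space over the unit type,
    so that \<open>linmap_eqI\<close> applies to functionals.\<close>
  let ?f = "\<lambda>y. Poly_Mapping.single () (coef y (0, m, 0))"
  let ?g = "\<lambda>y. Poly_Mapping.single () (coef y (0, m + alpha i + alpha i, 0))"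
  have l: "linmap ?f" "linmap ?g"
    by (auto intro!: linmapI simp: lookup_add single_add smul_single)
  have "?f (opBs i x) = ?g (opDp i x)"
  proof (rule linmap_eqI[of "\<lambda>x. ?f (opBs i x)" "\<lambda>x. ?g (opDp i x)"])
    fix a :: "'i word \<times> (int ^ 'i) \<times> 'i word"
    assume "a \<in> keys x"
    obtain u m' v where a: "a = (u, m', v)" by (cases a)
    have s: "coef (lin (\<lambda>u'. bas (u', m'', v)) q) (0, k, 0) = (if m'' = k \<and> v = 0 then coef q 0 else 0)"
      for m'' k and q :: "('k, 'i) ncpoly"
    proof -
      have "coef (lin (\<lambda>u'. bas (u', m'', v)) q) (0, k, 0)
          = (\<Sum>u'\<in>keys q. coef q u' * (if u' = 0 then 1 else 0) * (if m'' = k \<and> v = 0 then 1 else 0))"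
        unfolding lin_def lookup_sum by (intro sum.cong refl) (auto simp: lookup_single when_def)
      also have "\<dots> = (\<Sum>u'\<in>keys q. coef q u' * (if u' = 0 then 1 else 0)) * (if m'' = k \<and> v = 0 then 1 else 0)"
        by (rule sum_distrib_right[symmetric])
      finally show ?thesis
        unfolding sum_coef_delta by simp
    qed
    have D: "coef (Dm i u) 0 = coef (Dp i u) 0"
    proof (cases "u = var i")
      case True
      then show ?thesis
        using Dm_step[of i i 0] Dp_step[of i i 0] by simp
    next
      case False
      have nk: "0 \<notin> keys D" if "\<And>v. v \<in> keys D \<Longrightarrow> zdeg u = alpha i + zdeg v" for D :: "('k, 'i) ncpoly"
      proof
        assume "0 \<in> keys D"
        then have "zdeg u = zdeg (var i)"
          using that[of 0] by simp
        then have d: "wdeg u = wdeg (var i)" by (simp only: zvec_inj)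
        then have "wlen u = 1"
          using wdeg_eq_imp_wlen[OF d] by simp
        then obtain j where u: "u = var j"
          by (cases u) (auto simp: length_Suc_conv)
        from d have "alpha j = alpha i" using u zdeg_var by metis
        then have "j = i" by (simp add: alpha_def axis_eq_axis)
        with u False show False by simp
      qed
      show ?thesis
        using nk[of "Dm i u"] nk[of "Dp i u"] keys_Dm keys_Dp by (auto simp: in_keys_iff)
    qed
    show "?f (opBs i (bas a)) = ?g (opDp i (bas a))"
      by (auto simp: a opBs_def opC_def opL_bas op0_bas opDp_bas opDm_bas lookup_add s D
        smul_bas lookup_single when_def algebra_simps)
  qed (rule linmap_comp[OF l(1) linmap_opBs] linmap_comp[OF l(2) linmap_ops(4)])+
  then have "coef (?f (opBs i x)) () = coef (?g (opDp i x)) ()" by simp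
  then show ?thesis by simp
qed

lemma lin_const:
  fixes y :: "'b \<Rightarrow>\<^sub>0 'k"
  shows "lin (\<lambda>u. smul (f u) y) p = smul (\<Sum>u\<in>keys p. coef p u * f u) y"
proof -
  have "smul (\<Sum>u\<in>A. g u) y = (\<Sum>u\<in>A. smul (g u) y)" for g :: "'a \<Rightarrow> 'k" and A
    by (induction A rule: infinite_finite_induct) (simp_all add: smul_add_left)
  then show ?thesis by (simp add: lin_def)
qed

text \<open>By \<open>coef_opBs_0\<close> the coefficient is read off from
  \<open>opDp i (Xw w)\<close>, and \<open>opDp_Xw\<close> expresses this by \<open>Xw\<close> on
  the shorter words of \<open>Dp (tau i) w\<close>.\<close>

lemma kappa_step: "kappa (var i + w) = c $ tau i * chi (alpha (tau i)) (alpha (tau i)) / chi (alpha (tau i)) (zdeg w)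
    * (\<Sum>u\<in>keys (Dp (tau i) w). coef (Dp (tau i) w) u * kappa u)"
proof -
  let ?j = "tau i"
  let ?y = "lin Xw (Dp ?j w)"
  have K: "coef (opK l x) (0, m, 0) = coef x (0, m - l, 0)" for l m x
  proof -
    let ?f = "\<lambda>y. Poly_Mapping.single () (coef y (0 :: 'i word, m, 0 :: 'i word))"
    let ?g = "\<lambda>y. Poly_Mapping.single () (coef y (0 :: 'i word, m - l, 0 :: 'i word))"
    have li: "linmap ?f" "linmap ?g"
      by (auto intro!: linmapI simp: lookup_add single_add smul_single)
    have "?f (opK l x) = ?g x"
    proof (rule pbw_eqI[of "\<lambda>x. ?f (opK l x)" ?g])
      show "?f (opK l (bas (u, m', v))) = ?g (bas (u, m', v))" for u m' v
        by (auto simp: opK_bas lookup_single when_def)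
    qed (auto intro!: linmap_comp[OF li(1)] li)
    then have "coef (?f (opK l x)) () = coef (?g x) ()" by simp
    then show ?thesis by simp
  qed
  have "kappa (var i + w) = coef (opDp i (Xw w)) (0, alpha i - zdeg w, 0)"
    by (simp add: kappa_def Xw_step coef_opBs_0)
  also have "\<dots> = c $ ?j * chi (alpha ?j) (alpha ?j) / chi (alpha ?j) (zdeg w) * coef ?y (0, alpha ?j - zdeg w, 0)"
    by (simp add: opDp_Xw K algebra_simps)
  also have "coef ?y (0, alpha ?j - zdeg w, 0) = (\<Sum>u\<in>keys (Dp ?j w). coef (Dp ?j w) u * kappa u)"
    unfolding lin_def lookup_sum
  proof (rule sum.cong[OF refl])
    fix u assume "u \<in> keys (Dp ?j w)"
    from keys_Dp[OF this] have "alpha ?j - zdeg w = - zdeg u" by simp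
    then show "coef (smul (coef (Dp ?j w) u) (Xw u)) (0, alpha ?j - zdeg w, 0) = coef (Dp ?j w) u * kappa u"
      by (simp add: kappa_def)
  qed
  finally show ?thesis .
qed

text \<open>Moving \<open>opDm i\<close> to the right leaves the inverse of K_i K_(tau i) in place
  of a letter tau i. Its weight is not in \<open>Lat\<close>; instead, invariance of q under
  \<open>tau\<close> shows that moving it to the left turns the prefix scalars into chi(alpha_(tau
  i), w'). So \<open>Dl\<close> appears, with no further factor.\<close>

lemma opDm_Lw: "opDm i (Lw w) = smul (c $ tau i) (opK (- alpha i - alpha (tau i)) (lin Lw (Dl (tau i) w)))"
proof (induction w rule: word_induct)
  case zero
  show ?case by (simp add: Lw_0 opDm_bas)
next
  case (step k w)
  have k: "(i = tau k) = (tau i = k)" by (metis tau_invol)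
  have ll: "lin Lw (bas (var k) * p) = opL k (lin Lw p)" for p
    by (simp add: lin_times_left Lw_step opB_lin)
  have q: "chi (- alpha i - alpha (tau i)) (alpha (tau k)) =
      inverse (chi (alpha i) (alpha k)) * inverse (chi (alpha (tau i)) (alpha k))"
    using q_tau[of i k] q_tau_left[of i k] by (simp add: chi_simps field_simps)
  show ?case
    by (auto simp: Lw_step opDm_opL step opB_smul opL_opK Dl_step lin_add lin_smul ll op_add
        op_smul smul_add q k field_simps)
qed

text \<open>The support condition \<open>kappa_Lat\<close> makes \<open>chi(u, alpha_i)\<close> and \<open>chi(u, alpha_(tau i))\<close>
  interchangeable in front of \<open>kappa u\<close>.\<close>

lemma kappa_chi_tau: "kappa u * chi (zdeg u) (alpha (tau i)) = kappa u * chi (zdeg u) (alpha i)"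
  using kappa_Lat[of u, OF _ Lat_gen[of i]] by (cases "kappa u = 0") (auto simp: chi_simps field_simps)

text \<open>Contracting a new \<open>opDm i\<close> with the factor \<open>Lw v\<close> gives
  \<open>Dl (tau i) v\<close> by \<open>opDm_Lw\<close>. Coassociativity moves the removed letter to
  the left factor, where \<open>kappa_step\<close> recognizes the sum as kappa(x_i u). The other
  summand \<open>opL i\<close> adds a letter to v, as the braided coproduct does.\<close>

lemma Cw_wick: "Cw w = lin (\<lambda>(u, v). smul (kappa u) (opK (- zdeg u) (Lw v))) (cop w)"
proof (induction w rule: word_induct)
  case zero
  show ?case by (simp add: cop_0 Cw_0 Lw_0 kappa_0)
next
  case (step i w)
  let ?j = "tau i"
  let ?\<beta> = "\<lambda>u v. smul (kappa u * inverse (chi (zdeg u) (alpha i)) * c $ ?j) (opK (- zdeg u - alpha i - alpha ?j) (Lw v))"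
  let ?t = "\<lambda>(u, v). smul (kappa u) (opK (- zdeg u) (Lw v))"
  have D: "lin (\<lambda>x. opDm i (?t x)) (cop w) = lin (\<lambda>(u, v). ?t (var i + u, v)) (cop w)"
  proof -
    have "lin (\<lambda>x. opDm i (?t x)) (cop w) = lin (\<lambda>(u, v). lin (?\<beta> u) (Dl ?j v)) (cop w)"
    proof (rule lin_cong)
      fix x assume "x \<in> keys (cop w)"
      obtain u v where x: "x = (u, v)" by (cases x)
      have e: "- zdeg u + (- alpha i - alpha ?j) = - zdeg u - alpha i - alpha ?j" by simp
      show "opDm i (?t x) = (case x of (u, v) \<Rightarrow> lin (?\<beta> u) (Dl ?j v))"
        by (simp only: x prod.case op_smul opDm_opK opDm_Lw opK_opK e op_lin lin_fun_smul smul_smul)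
          (simp add: chi_simps mult_ac)
    qed
    also have "\<dots> = lin (\<lambda>(u, v). lin (\<lambda>u'. ?\<beta> u' v) (Dp ?j u)) (cop w)"
      by (rule cop_Dl_Dp)
    also have "\<dots> = lin (\<lambda>(u, v). ?t (var i + u, v)) (cop w)"
    proof (rule lin_cong)
      fix x assume "x \<in> keys (cop w)"
      obtain u v where x: "x = (u, v)" by (cases x)
      let ?Y = "opK (- zdeg (var i + u)) (Lw v)"
      let ?s = "c $ ?j * chi (alpha ?j) (alpha ?j) / chi (alpha ?j) (zdeg u)"
      have "lin (\<lambda>u'. ?\<beta> u' v) (Dp ?j u) = lin (\<lambda>u'. smul (?s * kappa u') ?Y) (Dp ?j u)"
      proof (rule lin_cong)
        fix u' assume "u' \<in> keys (Dp ?j u)"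
        from keys_Dp[OF this] have u: "zdeg u = alpha ?j + zdeg u'" .
        \<comment> \<open>The scalars for alpha_i and alpha_(tau i) are exchanged here, which is
          justified by the factor kappa u' in front.\<close>
        have "kappa u' * inverse (chi (zdeg u') (alpha i)) = kappa u' * inverse (chi (zdeg u') (alpha ?j))"
          using kappa_chi_tau[of u' i] by (cases "kappa u' = 0") auto
        then have "?\<beta> u' v = smul (kappa u' * inverse (chi (zdeg u') (alpha ?j)) * c $ ?j)
            (opK (- zdeg u' - alpha i - alpha ?j) (Lw v))"
          by (simp only:)
        moreover have "?s * kappa u' = kappa u' * inverse (chi (zdeg u') (alpha ?j)) * c $ ?j"
          by (simp add: u chi_simps chi_zdeg_sym field_simps)
        moreover have "- zdeg u' - alpha i - alpha ?j = - zdeg (var i + u)"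
          by (simp add: u)
        ultimately show "?\<beta> u' v = smul (?s * kappa u') ?Y"
          by (simp only:)
      qed
      also have "\<dots> = smul (kappa (var i + u)) ?Y"
        unfolding lin_const kappa_step
        by (simp add: sum_distrib_left mult_ac)
      finally show "(case x of (u, v) \<Rightarrow> lin (\<lambda>u'. ?\<beta> u' v) (Dp ?j u)) = (case x of (u, v) \<Rightarrow> ?t (var i + u, v))"
        by (simp add: x)
    qed
    finally show ?thesis .
  qed
  have L: "opL i (?t (u, v)) = smul (chi (alpha i) (zdeg u)) (?t (u, var i + v))" for u v
    using kappa_chi_tau[of u i] by (auto simp add: opB_smul opL_opK Lw_step chi_simps chi_zdeg_sym mult.commute)
  have "Cw (var i + w) = lin (\<lambda>x. opDm i (?t x)) (cop w) + lin (\<lambda>x. opL i (?t x)) (cop w)"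
    unfolding Cw_step step opC_def opB_lin op_lin by (rule add.commute)
  also have "\<dots> = lin ?t (cop (var i + w))"
    unfolding D lin_cop_step lin_fun_add[symmetric]
    by (rule lin_cong) (use L in \<open>simp add: case_prod_unfold\<close>)
  finally show ?case .
qed


section \<open>The obstruction \<open>kappa\<close> on the biideal\<close>

definition klin :: "('k, 'i) ncpoly \<Rightarrow> 'k" where
  "klin p = (\<Sum>w\<in>keys p. coef p w * kappa w)"

definition kappa_below :: "nat \<Rightarrow> bool" where
  "kappa_below n \<longleftrightarrow> (\<forall>p\<in>I. \<forall>l. mhomogeneous l p \<longrightarrow> height (zvec l) < int n \<longrightarrow> klin p = 0)"

text \<open>\<open>Lw w\<close> is a multiple of \<open>E_(tau w) K_(- w)\<close>. As \<open>chi(alpha_i, alpha_(tau j))\<close> is symmetric in \<open>i\<close>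
  and \<open>j\<close>, the scalar does not depend on the order of the letters of \<open>w\<close>.\<close>

lemma Lw_degree: "\<exists>g. \<forall>w. Lw w = smul (g (wdeg w)) (bas (Word (map tau (letters w)), - zdeg w, 0))"
proof -
  let ?tw = "\<lambda>w. Word (map tau (letters w))"
  \<comment> \<open>The pair consists of the scalar collected so far and the degree of the E part.
    These maps commute, so folding them over a word depends only on its multiset of letters.\<close>
  define f where "f i = (\<lambda>(a, l). (c $ i / chi (alpha i) l * a, l + alpha (tau i)))" for i
  define G where "G w = foldr f (letters w) (1, 0)" for w
  have G: "Lw w = smul (fst (G w)) (bas (?tw w, - zdeg w, 0)) \<and> snd (G w) = zdeg (?tw w)" for w
  proof (induction w rule: word_induct)
    case zero
    show ?case by (simp add: G_def Lw_0 flip: zero_word_def)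
  next
    case (step i w)
    have t: "?tw (var i + w) = var (tau i) + ?tw w" by (simp add: plus_word_def)
    have "G (var i + w) = f i (G w)" by (simp add: G_def)
    moreover have z: "- zdeg (var i + w) = - zdeg w - alpha i" by simp
    ultimately show ?case
      unfolding t z using step
      by (cases "G w") (simp add: f_def Lw_step opB_smul opL_bas chi_simps divide_inverse mult_ac)
  qed
  have c: "f i \<circ> f j = f j \<circ> f i" for i j
    using q_tau_left[of i j]
    by (auto simp: f_def fun_eq_iff chi_simps q_sym mult_ac divide_inverse)
  have "G w = G w'" if "wdeg w = wdeg w'" for w w'
  proof -
    have "count (mset (letters w)) i = count (mset (letters w')) i" for i
      using arg_cong[OF that, of "\<lambda>l. l $ i"] by (simp add: wdeg_def count_mset)
    then have "mset (rev (letters w)) = mset (rev (letters w'))"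
      by (simp add: multiset_eq_iff)
    then show ?thesis
      unfolding G_def foldr_conv_fold by (intro fun_cong[OF fold_multiset_equiv] c) auto
  qed
  then have "G (SOME w'. wdeg w' = wdeg w) = G w" for w
    by (metis (mono_tags, lifting) someI)
  then show ?thesis
    using G by (intro exI[of _ "\<lambda>l. fst (G (SOME w. wdeg w = l))"]) simp
qed

lemma I_tau: "p \<in> I \<Longrightarrow> lin (\<lambda>w. bas (Word (map tau (letters w)))) p \<in> I"
proof -
  assume "p \<in> I"
  then have "tau_hom tau p \<in> I" using tau_I by blast
  then show ?thesis
    by (simp add: tau_hom_def nc_eval_free foldr_ncvar)
qed

text \<open>On homogeneous p the value is a constant times p(E_(tau i)) K_(- deg p), and the
  automorphism given by \<open>tau\<close> preserves \<open>I\<close>.\<close>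

lemma I_Lw: "p \<in> I \<Longrightarrow> lin Lw p \<in> Nsub"
proof -
  assume p: "p \<in> I"
  obtain g where g: "\<And>w. Lw w = smul (g (wdeg w)) (bas (Word (map tau (letters w)), - zdeg w, 0))"
    using Lw_degree by blast
  have "lin (\<lambda>w. smul (g (wdeg w)) (bas (Word (map tau (letters w)), - zdeg w, 0))) p \<in> Nsub"
  proof (rule I_lin_graded[OF p Nsub_subsp, where g = "\<lambda>l w. smul (g l) (bas (Word (map tau (letters w)), - zvec l, 0))"])
    fix p l assume "p \<in> I"
    then show "lin (\<lambda>w. smul (g l) (bas (Word (map tau (letters w)), - zvec l, 0))) p \<in> Nsub"
      using subsp_smul[OF Nsub_subsp, OF Nsub_leftI[OF I_tau, of p "- zvec l" 0], of "g l"]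
      by (simp add: lin_lin lin_fun_smul)
  qed
  then show ?thesis by (simp add: g[abs_def])
qed

lemma Nsub_op0w: "x \<in> Nsub \<Longrightarrow> op0w w x \<in> Nsub"
  by (induction w rule: word_induct) (simp_all add: Nsub_op0)

lemma op0w_bas: "op0w w (bas (u, m, v)) = smul (chi m (zdeg w)) (bas (u, m, w + v))"
  by (induction w rule: word_induct) (simp_all add: op0_bas op_smul chi_simps mult_ac add_ac)

lemma I_op0w: "p \<in> I \<Longrightarrow> lin (\<lambda>w. op0w w x) p \<in> Nsub"
proof -
  assume p: "p \<in> I"
  have "lin (\<lambda>w. op0w w (bas (u, m, v))) p \<in> Nsub" for u m v
    unfolding op0w_bas
  proof (rule I_lin_scaled[OF p Nsub_subsp])
    fix p assume "p \<in> I"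
    have "p * bas v = lin (\<lambda>w. bas (w + v)) p"
      by (subst linmap_eq_lin[OF linmap_times_right]) (simp add: bas_times_bas)
    then show "lin (\<lambda>w. bas (u, m, w + v)) p \<in> Nsub"
      using Nsub_rightI[OF I_right[OF \<open>p \<in> I\<close>, of "bas v"], of u m] by (simp add: lin_lin)
  qed
  then show ?thesis
    by - (rule linmap_mem[of "\<lambda>x. lin (\<lambda>w. op0w w x) p"],
        auto intro!: Nsub_subsp linmap_lin_param[where f = op0w])
qed

text \<open>The expansion \<open>Cw_wick\<close> without the terms with |u| >= n, so that only those
  values of kappa remain to which \<open>kappa_below n\<close> applies.\<close>

definition Ch :: "nat \<Rightarrow> 'i word \<Rightarrow> ('k, 'i) pbw" where
  "Ch n w = lin (\<lambda>(u, v). smul (if wlen u < n then kappa u else 0) (opK (- zdeg u) (Lw v))) (cop w)"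

text \<open>If the left tensor factor lies in \<open>I\<close>, its kappa values sum to zero below
  length n, and the coefficients are zero from n on. If the right one does, \<open>I_Lw\<close>
  applies.\<close>

lemma I_Ch: "kappa_below n \<Longrightarrow> p \<in> I \<Longrightarrow> lin (Ch n) p \<in> Nsub"
  unfolding Ch_def[abs_def]
proof (rule I_cop[OF _ Nsub_subsp], assumption)
  assume n: "kappa_below n"
  fix a and v :: "'i word" assume a: "a \<in> I"
  show "lin (\<lambda>u. case (u, v) of (u, v) \<Rightarrow> smul (if wlen u < n then kappa u else 0) (opK (- zdeg u) (Lw v))) a \<in> Nsub"
    unfolding prod.case
  proof (rule I_lin_graded[OF a Nsub_subsp, where
        g = "\<lambda>l u. smul (if wlen u < n then kappa u else 0) (opK (- zvec l) (Lw v))"])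
    fix p l assume p: "p \<in> I" "mhomogeneous l p"
    have len: "int (wlen w) = height (zvec l)" if "w \<in> keys p" for w
      using p(2) that height_zdeg[of w] by (simp add: mhomogeneous_def)
    have "(\<Sum>u\<in>keys p. coef p u * (if wlen u < n then kappa u else 0)) = 0"
    proof (cases "height (zvec l) < int n")
      case True
      have "wlen u < n" if "u \<in> keys p" for u
        using len[OF that] True by simp
      then have "(\<Sum>u\<in>keys p. coef p u * (if wlen u < n then kappa u else 0)) = klin p"
        unfolding klin_def by (intro sum.cong refl) auto
      then show ?thesis
        using n p True by (simp add: kappa_below_def)
    next
      case False
      have "\<not> wlen u < n" if "u \<in> keys p" for u
        using len[OF that] False by simp
      then show ?thesis
        by (intro sum.neutral) auto
    qed
    then show "lin (\<lambda>u. smul (if wlen u < n then kappa u else 0) (opK (- zvec l) (Lw v))) p \<in> Nsub"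
      unfolding lin_const by (simp add: Nsub_0)
  qed
next
  fix b and u :: "'i word" assume b: "b \<in> I"
  show "lin (\<lambda>v. case (u, v) of (u, v) \<Rightarrow> smul (if wlen u < n then kappa u else 0) (opK (- zdeg u) (Lw v))) b \<in> Nsub"
    using subsp_smul[OF Nsub_subsp, OF Nsub_opK[OF I_Lw[OF b], of "- zdeg u"], of "if wlen u < n then kappa u else 0"]
    by (simp add: lin_fun_smul op_lin)
qed

lemma keys_cop_wlen: "(u, v) \<in> keys (cop w) \<Longrightarrow> wlen w = wlen u + wlen v"
  using arg_cong[OF keys_cop, of u v w height] by (simp add: height_plus height_zdeg)

text \<open>For |w| <= n a term with |u| >= n has |u| = |w| and v = 0; by the counit the only such
  term is u = w.\<close>

lemma Cw_Ch: "wlen w \<le> n \<Longrightarrow> Cw w - Ch n w = (if wlen w = n then smul (kappa w) (bas (0, - zdeg w, 0)) else 0)"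
proof -
  assume w: "wlen w \<le> n"
  let ?f = "\<lambda>u. if wlen u < n then 0 else smul (kappa u) (opK (- zdeg u) vac)"
  have "Cw w - Ch n w = lin (\<lambda>(u, v). if v = 0 then ?f u else 0) (cop w)"
    unfolding Cw_wick Ch_def lin_fun_diff[symmetric]
  proof (rule lin_cong)
    fix x assume x: "x \<in> keys (cop w)"
    obtain u v where uv: "x = (u, v)" by (cases x)
    have "wlen u < n" if "v \<noteq> 0"
    proof -
      have "wlen v \<noteq> 0" using that by simp
      moreover have "wlen w = wlen u + wlen v"
        using keys_cop_wlen x uv by blast
      ultimately show ?thesis using w by linarith
    qed
    then show "(case x of (u, v) \<Rightarrow> smul (kappa u) (opK (- zdeg u) (Lw v))) -
        (case x of (u, v) \<Rightarrow> smul (if wlen u < n then kappa u else 0) (opK (- zdeg u) (Lw v))) =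
        (case x of (u, v) \<Rightarrow> if v = 0 then ?f u else 0)"
      by (auto simp: uv Lw_0)
  qed
  also have "\<dots> = ?f w" by (rule cop_counit_right)
  finally show ?thesis using w by (auto simp: opK_bas)
qed

text \<open>Put \<open>Ch n\<close> for \<open>Cw\<close> in \<open>Xw_wick\<close>. The new sum
  maps \<open>I\<close> into \<open>Nsub\<close> by the biideal property, and in degree n the
  difference comes from the term u = 0 alone, where it is kappa(w) K_(- deg w).\<close>

lemma Xp_homogeneous_ideal:
  assumes n: "kappa_below n" and p: "p \<in> I" "mhomogeneous l p" and l: "height (zvec l) = int n"
  shows "lin Xw p - smul (klin p) (bas (0, - zvec l, 0)) \<in> Nsub"
proof -
  let ?H = "\<lambda>w. lin (\<lambda>(u, v). op0w u (Ch n v)) (cop w)"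
  have H: "lin ?H p \<in> Nsub"
  proof (rule I_cop[OF p(1) Nsub_subsp])
    show "lin (\<lambda>u. case (u, v) of (u, v) \<Rightarrow> op0w u (Ch n v)) a \<in> Nsub" if "a \<in> I" for a v
      using I_op0w[OF that] by simp
    show "lin (\<lambda>v. case (u, v) of (u, v) \<Rightarrow> op0w u (Ch n v)) b \<in> Nsub" if "b \<in> I" for b u
      using Nsub_op0w[OF I_Ch[OF n that], of u] by (simp add: linmap_lin_apply[OF linmap_op0w])
  qed
  have "Xw w - ?H w = smul (kappa w) (bas (0, - zvec l, 0))" if w: "w \<in> keys p" for w
  proof -
    have wl: "wdeg w = l" using w p(2) by (simp add: mhomogeneous_def)
    then have len: "wlen w = n" using height_zdeg[of w] l by simp
    have "Xw w - ?H w = lin (\<lambda>(u, v). if u = 0 then Cw v - Ch n v else 0) (cop w)"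
      unfolding Xw_wick lin_fun_diff[symmetric]
    proof (rule lin_cong)
      fix x assume x: "x \<in> keys (cop w)"
      obtain u v where uv: "x = (u, v)" by (cases x)
      have "wlen v < n" if "u \<noteq> 0"
      proof -
        have "wlen u \<noteq> 0" using that by simp
        then show ?thesis using keys_cop_wlen[of u v w] x len uv by simp
      qed
      then have "Cw v = Ch n v" if "u \<noteq> 0"
        using that Cw_Ch[of v n] by auto
      then show "(case x of (u, v) \<Rightarrow> op0w u (Cw v)) - (case x of (u, v) \<Rightarrow> op0w u (Ch n v)) =
          (case x of (u, v) \<Rightarrow> if u = 0 then Cw v - Ch n v else 0)"
        by (auto simp: uv)
    qed
    also have "\<dots> = Cw w - Ch n w" by (rule cop_counit_left)
    finally show ?thesis using Cw_Ch[of w n] len wl by simp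
  qed
  then have "lin Xw p - lin ?H p = lin (\<lambda>w. smul (kappa w) (bas (0, - zvec l, 0))) p"
    unfolding lin_fun_diff[symmetric] by (rule lin_cong)
  also have "\<dots> = smul (klin p) (bas (0, - zvec l, 0))"
    unfolding lin_const klin_def ..
  finally have "lin Xw p - smul (klin p) (bas (0, - zvec l, 0)) = lin ?H p"
    by (simp add: algebra_simps)
  with H show ?thesis by simp
qed


section \<open>Working in \<open>U(chi)\<close> through representatives\<close>


abbreviation U where "U \<equiv> U_alg chi I"
abbreviation cl where "cl \<equiv> U_class chi I"

lemma ring_U: "ring U"
  unfolding U_alg_def by (rule ideal.quotient_is_ring[OF J_ideal])

lemma cl_hom: "cl \<in> ring_hom free_ring U"
  unfolding U_alg_def U_class_def[abs_def] by (rule ideal.rcos_ring_hom[OF J_ideal])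

lemma cl_mult: "cl x \<otimes>\<^bsub>U\<^esub> cl y = cl (x * y)"
  and cl_add: "cl x \<oplus>\<^bsub>U\<^esub> cl y = cl (x + y)"
  and cl_one: "\<one>\<^bsub>U\<^esub> = cl 1"
  using ring_hom_mult[OF cl_hom, of x y] ring_hom_add[OF cl_hom, of x y] ring_hom_one[OF cl_hom]
  by simp_all

lemma U_carrier: "carrier U = range cl"
  by (auto simp: U_alg_def U_class_def[abs_def] FactRing_def A_RCOSETS_def RCOSETS_def a_r_coset_def)

lemma cl_mem: "x \<in> cl a \<longleftrightarrow> x \<simeq>\<^sub>J a"
  by (auto simp: U_class_def a_r_coset_def r_coset_def cg_def ring_of_type_algebra_def)
    (metis diff_add_cancel)

lemma cl_eq: "cl x = cl y \<longleftrightarrow> x \<simeq>\<^sub>J y"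
  using cl_mem cg_refl cg_sym cg_trans by (metis subsetI subset_antisym)

lemma cl_zero: "\<zero>\<^bsub>U\<^esub> = cl 0"
proof -
  interpret ring U by (rule ring_U)
  have "cl 0 \<oplus>\<^bsub>U\<^esub> cl 0 = cl 0" by (simp add: cl_add)
  then show ?thesis using U_carrier by (metis r_neg1 rangeI r_zero zero_closed add.l_cancel_one')
qed

lemma cl_eq_zero: "cl x = \<zero>\<^bsub>U\<^esub> \<longleftrightarrow> x \<in> J"
  by (simp add: cl_zero cl_eq cg_def)

lemma cl_uminus: "\<ominus>\<^bsub>U\<^esub> cl x = cl (- x)"
proof -
  interpret ring U by (rule ring_U)
  have "cl (- x) \<oplus>\<^bsub>U\<^esub> cl x = \<zero>\<^bsub>U\<^esub>" by (simp add: cl_add cl_zero)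
  then show ?thesis using minus_equality[of "cl (- x)" "cl x"] U_carrier by auto
qed

lemma cl_sum: "finite A \<Longrightarrow> finsum U (\<lambda>x. cl (f x)) A = cl (sum f A)"
proof -
  interpret ring U by (rule ring_U)
  show "finite A \<Longrightarrow> ?thesis"
    by (induction A rule: finite_induct) (auto simp: cl_zero cl_add finsum_insert U_carrier)
qed

lemma U_scalar_cl: "U_scalar chi I a = cl (ncconst a)"
  and U_E_cl: "U_E chi I i = cl (gE i)"
  and U_F_cl: "U_F chi I i = cl (gF i)"
  and U_K_cl: "U_K chi I i = cl (gK i)"
  and U_Kinv_cl: "U_Kinv chi I i = cl (gL i)"
  by (simp_all add: U_scalar_def U_E_def U_F_def U_K_def U_Kinv_def)

lemma B_gen_cl: "B_gen chi I tau c i = cl (Bg i)"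
  by (simp add: B_gen_def U_scalar_cl U_E_cl U_F_cl U_Kinv_cl cl_mult cl_add Bg_def)

lemma eval_U_cl: "eval_U chi I (\<lambda>i. cl (b i)) p = cl (lin (\<lambda>w. foldr (\<lambda>i y. b i * y) (letters w) 1) p)"
proof -
  have f: "foldr (\<lambda>g y. cl (b g) \<otimes>\<^bsub>U\<^esub> y) l \<one>\<^bsub>U\<^esub> = cl (foldr (\<lambda>i y. b i * y) l 1)" for l
    by (induction l) (simp_all add: cl_one cl_mult)
  show ?thesis
    unfolding nc_eval_def f U_scalar_cl cl_mult by (simp add: cl_sum lin_def ncconst_times)
qed

lemma eval_E: "eval_U chi I (U_E chi I) p = cl (lin Ew p)"
  and eval_F: "eval_U chi I (U_F chi I) p = cl (lin Fw p)"
  and eval_B: "eval_U chi I (B_gen chi I tau c) p = cl (lin Bw p)"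
  using eval_U_cl[of gE p] eval_U_cl[of gF p] eval_U_cl[of Bg p]
  by (simp_all add: foldr_ncvar U_E_cl[abs_def] U_F_cl[abs_def] B_gen_cl[abs_def] Bw_def[abs_def])

section \<open>Subalgebras of \<open>U(chi)\<close> as spans of ordered monomials\<close>

lemma subalg_subset:
  assumes "subsp T" "1 \<in> T" "\<And>x y. x \<in> T \<Longrightarrow> y \<in> T \<Longrightarrow> \<exists>z\<in>T. x * y \<simeq>\<^sub>J z" "S \<subseteq> cl ` T"
  shows "subalg_U chi I S \<subseteq> cl ` T"
proof
  fix x assume "x \<in> subalg_U chi I S"
  then show "x \<in> cl ` T"
    unfolding subalg_def
  proof induction
    case one
    show ?case using assms(2) by (simp add: cl_one)
  next
    case (incl h)
    have "ncconst a \<in> T" for a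
      using subsp_smul[OF assms(1,2), of a] ncconst_times[of a "1 :: ('k, 'i gen) ncpoly"] by simp
    with incl show ?case
      using assms(4) by (auto simp: U_scalar_cl)
  next
    case (a_inv h)
    then show ?case using subsp_uminus[OF assms(1)] by (auto simp: cl_uminus)
  next
    case (eng_add h1 h2)
    then show ?case using subsp_add[OF assms(1)] by (auto simp: cl_add)
  next
    case (eng_mult h1 h2)
    then obtain x y where xy: "x \<in> T" "y \<in> T" "h1 = cl x" "h2 = cl y" by blast
    with assms(3) obtain z where "z \<in> T" "x * y \<simeq>\<^sub>J z" by blast
    then show ?case using xy cl_eq[of "x * y" z] by (auto simp: cl_mult)
  qed
qed

definition presub :: "('k, 'i) U_elt set \<Rightarrow> ('k, 'i gen) ncpoly set" where
  "presub S = {x. cl x \<in> subalg_U chi I S}"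

lemma presub_one: "1 \<in> presub S"
  unfolding presub_def subalg_def mem_Collect_eq cl_one[symmetric] by (rule generate_ring.one)

lemma presub_mult: "x \<in> presub S \<Longrightarrow> y \<in> presub S \<Longrightarrow> x * y \<in> presub S"
  unfolding presub_def subalg_def mem_Collect_eq cl_mult[symmetric] by (rule generate_ring.eng_mult)

lemma presub_incl: "cl x \<in> S \<Longrightarrow> x \<in> presub S"
  unfolding presub_def subalg_def by (auto intro: generate_ring.incl)

lemma presub_subsp: "subsp (presub S)"
proof (rule subspI)
  have c: "ncconst a \<in> presub S" for a
    unfolding presub_def subalg_def by (auto intro!: generate_ring.incl simp flip: U_scalar_cl)
  show "smul a x \<in> presub S" if "x \<in> presub S" for a x
    using presub_mult[OF c that] by (simp add: ncconst_times)
  show "0 \<in> presub S"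
    using c[of 0] by (simp add: ncconst_def)
  show "x + y \<in> presub S" if "x \<in> presub S" "y \<in> presub S" for x y
    using that unfolding presub_def subalg_def mem_Collect_eq cl_add[symmetric]
    by (rule generate_ring.eng_add)
qed

lemma presub_power: "x \<in> presub S \<Longrightarrow> x ^ n \<in> presub S"
  by (induction n) (simp_all add: presub_one presub_mult)

lemma subalg_eqI:
  assumes "subsp T" "1 \<in> T" "\<And>x y. x \<in> T \<Longrightarrow> y \<in> T \<Longrightarrow> \<exists>z\<in>T. x * y \<simeq>\<^sub>J z" "S \<subseteq> cl ` T" "T \<subseteq> presub S"
  shows "subalg_U chi I S = cl ` T"
  using subalg_subset[OF assms(1-4)] assms(5) by (auto simp: presub_def)

lemma span_mult:
  fixes g :: "'x \<Rightarrow> ('k, 'i gen) ncpoly"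
  assumes "\<And>a b. a \<in> A \<Longrightarrow> b \<in> A \<Longrightarrow> \<exists>k. \<exists>d\<in>A. g a * g b \<simeq>\<^sub>J smul k (g d)"
    and "x \<in> lin g ` {s. keys s \<subseteq> A}" "y \<in> lin g ` {s. keys s \<subseteq> A}"
  shows "\<exists>z\<in>lin g ` {s. keys s \<subseteq> A}. x * y \<simeq>\<^sub>J z"
proof -
  let ?T = "{x. \<exists>z\<in>lin g ` {s. keys s \<subseteq> A}. x \<simeq>\<^sub>J z}"
  have T: "subsp ?T"
  proof (rule subspI)
    show "0 \<in> ?T" by (rule CollectI, rule bexI[of _ "lin g 0"], simp, rule imageI, simp)
    show "x + y \<in> ?T" if "x \<in> ?T" "y \<in> ?T" for x y
    proof -
      from that obtain s t where s: "keys s \<subseteq> A" "x \<simeq>\<^sub>J lin g s" and t: "keys t \<subseteq> A" "y \<simeq>\<^sub>J lin g t"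
        by blast
      have "keys (s + t) \<subseteq> A" using s(1) t(1) Poly_Mapping.keys_add[of s t] by blast
      moreover have "x + y \<simeq>\<^sub>J lin g (s + t)" using cg_add[OF s(2) t(2)] by (simp add: lin_add)
      ultimately show ?thesis by blast
    qed
    show "smul a x \<in> ?T" if "x \<in> ?T" for a x
    proof -
      from that obtain s where s: "keys s \<subseteq> A" "x \<simeq>\<^sub>J lin g s" by blast
      have "keys (smul a s) \<subseteq> A" using s(1) keys_smul[of a s] by blast
      moreover have "smul a x \<simeq>\<^sub>J lin g (smul a s)" using cg_smul[OF s(2)] by (simp add: lin_smul)
      ultimately show ?thesis by blast
    qed
  qed
  have g: "g a * g b \<in> ?T" if "a \<in> A" "b \<in> A" for a b
  proof -
    from assms(1)[OF that] obtain k d where d: "d \<in> A" "g a * g b \<simeq>\<^sub>J smul k (g d)" by blast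
    then have "keys (Poly_Mapping.single d k) \<subseteq> A" "g a * g b \<simeq>\<^sub>J lin g (Poly_Mapping.single d k)"
      by simp_all
    then show ?thesis by blast
  qed
  from assms(2,3) obtain s t where s: "keys s \<subseteq> A" "x = lin g s" and t: "keys t \<subseteq> A" "y = lin g t"
    by blast
  have "x * y = lin (\<lambda>a. lin (\<lambda>b. g a * g b) t) s"
    unfolding s t linmap_lin_apply[OF linmap_times_right] linmap_lin_apply[OF linmap_times_left]
    by (rule lin_swap)
  also have "\<dots> \<in> ?T"
    by (intro lin_mem T g) (use s t in auto)
  finally show ?thesis by blast
qed

text \<open>A family of monomials that is closed under multiplication up to scalars and modulo
  \<open>J\<close> already spans the subalgebra it generates. This computes \<open>U_H\<close>,
  \<open>H_theta\<close>, \<open>U_plus\<close>, \<open>U_minus\<close>, \<open>G_minus\<close> and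
  the product of \<open>H_theta\<close> with \<open>U_minus\<close> alike.\<close>

lemma subalg_span:
  fixes g :: "'x \<Rightarrow> ('k, 'i gen) ncpoly"
  assumes "\<And>a b. a \<in> A \<Longrightarrow> b \<in> A \<Longrightarrow> \<exists>k. \<exists>d\<in>A. g a * g b \<simeq>\<^sub>J smul k (g d)"
    and "1 \<in> g ` A" "S \<subseteq> cl ` (lin g ` {s. keys s \<subseteq> A})" "\<And>a. a \<in> A \<Longrightarrow> g a \<in> presub S"
  shows "subalg_U chi I S = cl ` (lin g ` {s. keys s \<subseteq> A})"
proof (rule subalg_eqI)
  show "subsp (lin g ` {s. keys s \<subseteq> A})"
    by (rule subsp_image[OF linmap_lin subsp_keys])
  obtain e where "e \<in> A" "1 = g e" using assms(2) by blast
  then show "1 \<in> lin g ` {s. keys s \<subseteq> A}" by (intro image_eqI[of _ _ "bas e"]) auto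
  show "lin g ` {s. keys s \<subseteq> A} \<subseteq> presub S"
  proof clarify
    fix s :: "'x \<Rightarrow>\<^sub>0 'k" assume "keys s \<subseteq> A"
    then show "lin g s \<in> presub S"
      by (intro lin_mem presub_subsp assms(4)) auto
  qed
  show "\<exists>z\<in>lin g ` {s. keys s \<subseteq> A}. x * y \<simeq>\<^sub>J z"
    if "x \<in> lin g ` {s. keys s \<subseteq> A}" "y \<in> lin g ` {s. keys s \<subseteq> A}" for x y
    using assms(1) that by (rule span_mult)
qed (rule assms(3))

lemma cl_span_memI: "a \<in> A \<Longrightarrow> x \<simeq>\<^sub>J smul k (g a) \<Longrightarrow> cl x \<in> cl ` (lin g ` {s. keys s \<subseteq> A})"
  by (auto simp: cl_eq image_iff intro!: exI[of _ "Poly_Mapping.single a k"]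
      split: if_splits)

lemma cg_theta: "theta x = theta y \<Longrightarrow> x \<simeq>\<^sub>J y"
  by (simp add: cg_iff Nsub_0)

lemma theta_Kp: "theta (Kp m) = bas (0, m, 0)"
  by (simp add: theta_def act_Kp opK_bas)

lemma Kp_mult: "Kp m * Kp n \<simeq>\<^sub>J Kp (m + n)"
  by (rule cg_theta) (simp add: theta_mult theta_Kp act_Kp opK_bas add.commute)

lemma Fw_Kp: "Fw w * Kp m \<simeq>\<^sub>J smul (chi m (zdeg w)) (Kp m * Fw w)"
  by (rule cg_theta)
    (simp add: theta_mult act_Kp theta_def act_mult linmap_smul[OF linmap_theta] opFw_opK
      act_smul flip: opFw_def del: act_bas)

lemma act_Bw_opK: "m \<in> Lat \<Longrightarrow> act (Bw w) (opK m x) = smul (chi m (zdeg w)) (opK m (act (Bw w) x))"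
  by (induction w rule: word_induct)
    (simp_all add: Bw_step act_mult act_Bg opB_smul opB_opK chi_simps mult_ac)

lemma Bw_Kp: "m \<in> Lat \<Longrightarrow> Bw w * Kp m \<simeq>\<^sub>J smul (chi m (zdeg w)) (Kp m * Bw w)"
  by (rule cg_theta)
    (simp add: theta_mult act_Kp theta_def act_mult linmap_smul[OF linmap_theta] act_Bw_opK act_smul)

lemma cg_times_span: "x \<simeq>\<^sub>J smul k x' \<Longrightarrow> a * x * b \<simeq>\<^sub>J smul k (a * x' * b)"
proof -
  assume "x \<simeq>\<^sub>J smul k x'"
  then have "a * x * b \<simeq>\<^sub>J a * smul k x' * b" by (intro cg_times_left cg_times_right)
  then show ?thesis by (simp flip: smul_mult_left smul_mult_right)
qed

lemma KF_mult: "(Kp a * Fw u) * (Kp b * Fw v) \<simeq>\<^sub>J smul (chi b (zdeg u)) (Kp (a + b) * Fw (u + v))"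
proof -
  have "(Kp a * Fw u) * (Kp b * Fw v) = Kp a * (Fw u * Kp b) * Fw v" by (simp add: mult.assoc)
  also have "\<dots> \<simeq>\<^sub>J smul (chi b (zdeg u)) (Kp a * (Kp b * Fw u) * Fw v)"
    by (rule cg_times_span) (rule Fw_Kp)
  also have "\<dots> = smul (chi b (zdeg u)) ((Kp a * Kp b) * Fw (u + v))"
    unfolding Fw_step by (simp add: mult.assoc)
  also have "\<dots> \<simeq>\<^sub>J smul (chi b (zdeg u)) (Kp (a + b) * Fw (u + v))"
    by (intro cg_smul cg_times_right Kp_mult)
  finally show ?thesis .
qed

lemma KB_mult: "b \<in> Lat \<Longrightarrow>
  (Kp a * Bw u) * (Kp b * Bw v) \<simeq>\<^sub>J smul (chi b (zdeg u)) (Kp (a + b) * Bw (u + v))"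
proof -
  assume b: "b \<in> Lat"
  have "(Kp a * Bw u) * (Kp b * Bw v) = Kp a * (Bw u * Kp b) * Bw v" by (simp add: mult.assoc)
  also have "\<dots> \<simeq>\<^sub>J smul (chi b (zdeg u)) (Kp a * (Kp b * Bw u) * Bw v)"
    by (rule cg_times_span) (rule Bw_Kp[OF b])
  also have "\<dots> = smul (chi b (zdeg u)) ((Kp a * Kp b) * Bw (u + v))"
    unfolding Bw_plus by (simp add: mult.assoc)
  also have "\<dots> \<simeq>\<^sub>J smul (chi b (zdeg u)) (Kp (a + b) * Bw (u + v))"
    by (intro cg_smul cg_times_right Kp_mult)
  finally show ?thesis .
qed

lemma theta_gK: "theta (gK i) = bas (0, alpha i, 0)" and theta_gL: "theta (gL i) = bas (0, - alpha i, 0)"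
  by (simp_all add: theta_def opK_bas)

lemma Kp_alpha: "gK i \<simeq>\<^sub>J Kp (alpha i)" and Kp_malpha: "gL i \<simeq>\<^sub>J Kp (- alpha i)"
  by (rule cg_theta, simp add: theta_Kp theta_gK theta_gL)+

lemma Kp_diff: "gK i * gL j \<simeq>\<^sub>J Kp (alpha i - alpha j)"
  by (rule cg_theta) (simp add: theta_Kp theta_mult theta_gL opK_bas)

lemma presub_cg: "x \<in> presub S \<Longrightarrow> x \<simeq>\<^sub>J y \<Longrightarrow> y \<in> presub S"
  using cl_eq[of x y] by (simp add: presub_def)

lemma presub_Kl:
  assumes "\<And>i. gK i \<in> presub S" "\<And>i. gL i \<in> presub S"
  shows "Kp m \<in> presub S"
proof -
  have "kz j n \<in> presub S" for j n
    by (simp add: kz_def presub_power assms)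
  then have "Kl xs m \<in> presub S" for xs
    by (induction xs) (simp_all add: presub_one presub_mult)
  then show ?thesis by (simp add: Kp_def)
qed

lemma U_H_eq: "U_H chi I = cl ` (lin Kp ` {s. keys s \<subseteq> UNIV})"
  unfolding U_H_def
proof (rule subalg_span)
  show "\<exists>k. \<exists>d\<in>UNIV. Kp a * Kp b \<simeq>\<^sub>J smul k (Kp d)" for a b
    using Kp_mult[of a b] by (intro exI[of _ 1] bexI[of _ "a + b"]) simp_all
  show "1 \<in> range Kp" using Kp_0 by (metis rangeI)
  show "range (U_K chi I) \<union> range (U_Kinv chi I) \<subseteq> cl ` lin Kp ` {s. keys s \<subseteq> UNIV}"
  proof (intro Un_least image_subsetI)
    show "U_K chi I i \<in> cl ` lin Kp ` {s. keys s \<subseteq> UNIV}" for i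
      unfolding U_K_cl by (rule cl_span_memI[where k = 1 and a = "alpha i"]) (simp_all add: Kp_alpha)
    show "U_Kinv chi I i \<in> cl ` lin Kp ` {s. keys s \<subseteq> UNIV}" for i
      unfolding U_Kinv_cl by (rule cl_span_memI[where k = 1 and a = "- alpha i"]) (simp_all add: Kp_malpha)
  qed
  show "Kp a \<in> presub (range (U_K chi I) \<union> range (U_Kinv chi I))" for a
    by (rule presub_Kl) (auto intro!: presub_incl simp flip: U_K_cl U_Kinv_cl)
qed

lemma H_theta_eq: "H_theta chi I tau = cl ` (lin Kp ` {s. keys s \<subseteq> Lat})"
  unfolding H_theta_def
proof (rule subalg_span)
  let ?S = "range (\<lambda>i. U_K chi I i \<otimes>\<^bsub>U\<^esub> U_Kinv chi I (tau i))"
  show "\<exists>k. \<exists>d\<in>Lat. Kp a * Kp b \<simeq>\<^sub>J smul k (Kp d)" if "a \<in> Lat" "b \<in> Lat" for a b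
    using Kp_mult[of a b] that by (intro exI[of _ 1] bexI[of _ "a + b"]) (simp_all add: Lat_add)
  show "1 \<in> Kp ` Lat" using Kp_0 Lat_0 by (metis image_eqI)
  show "?S \<subseteq> cl ` lin Kp ` {s. keys s \<subseteq> Lat}"
    using Kp_diff Lat_gen by (auto simp: U_K_cl U_Kinv_cl cl_mult intro!: cl_span_memI[where k = 1])
  have gen: "Kp (alpha i - alpha (tau i)) \<in> presub ?S" for i
    by (rule presub_cg[OF _ Kp_diff]) (auto intro!: presub_incl simp: U_K_cl U_Kinv_cl cl_mult)
  show "Kp a \<in> presub ?S" if "a \<in> Lat" for a
    using that
  proof induction
    case Lat_0
    show ?case by (simp add: Kp_0 presub_one)
  next
    case (Lat_add_gen l i)
    show ?case
      by (rule presub_cg[OF presub_mult[OF Lat_add_gen.IH gen[of i]] Kp_mult])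
  qed
qed

lemma Ew_presub: "(\<And>i. gE i \<in> presub S) \<Longrightarrow> Ew w \<in> presub S"
proof (induction w rule: word_induct)
  case zero
  show ?case unfolding Ew_0 by (rule presub_one)
next
  case (step i w)
  then show ?case unfolding Ew_var_step by (intro presub_mult) auto
qed

lemma Fw_presub: "(\<And>i. gF i \<in> presub S) \<Longrightarrow> Fw w \<in> presub S"
proof (induction w rule: word_induct)
  case zero
  show ?case unfolding Fw_0 by (rule presub_one)
next
  case (step i w)
  then show ?case unfolding Fw_var_step by (intro presub_mult) auto
qed

lemma Fw_var: "Fw (var i) = gF i"
  by (simp add: ncvar_def)

lemma U_plus_eq: "U_plus chi I = cl ` (lin Ew ` {s. keys s \<subseteq> UNIV})"
  unfolding U_plus_def
proof (rule subalg_span)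
  show "\<exists>k. \<exists>d\<in>UNIV. Ew a * Ew b \<simeq>\<^sub>J smul k (Ew d)" for a b
    by (intro exI[of _ 1] bexI[of _ "a + b"]) (simp_all flip: Ew_step)
  show "1 \<in> range Ew" using Ew_0 by (metis (no_types, lifting) rangeI)
  show "range (U_E chi I) \<subseteq> cl ` lin Ew ` {s. keys s \<subseteq> UNIV}"
  proof clarify
    fix i
    show "U_E chi I i \<in> cl ` lin Ew ` {s. keys s \<subseteq> UNIV}"
      unfolding U_E_cl by (rule cl_span_memI[where k = 1 and a = "var i"]) (simp_all add: ncvar_def)
  qed
  show "Ew a \<in> presub (range (U_E chi I))" for a
    by (rule Ew_presub) (auto intro!: presub_incl simp flip: U_E_cl)
qed

lemma U_minus_eq: "U_minus chi I = cl ` (lin Fw ` {s. keys s \<subseteq> UNIV})"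
  unfolding U_minus_def
proof (rule subalg_span)
  show "\<exists>k. \<exists>d\<in>UNIV. Fw a * Fw b \<simeq>\<^sub>J smul k (Fw d)" for a b
    by (intro exI[of _ 1] bexI[of _ "a + b"]) (simp_all flip: Fw_step)
  show "1 \<in> range Fw" using Fw_0 by (metis (no_types, lifting) rangeI)
  show "range (U_F chi I) \<subseteq> cl ` lin Fw ` {s. keys s \<subseteq> UNIV}"
  proof clarify
    fix i
    show "U_F chi I i \<in> cl ` lin Fw ` {s. keys s \<subseteq> UNIV}"
      unfolding U_F_cl by (rule cl_span_memI[where k = 1 and a = "var i"]) (simp_all add: ncvar_def)
  qed
  show "Fw a \<in> presub (range (U_F chi I))" for a
    by (rule Fw_presub) (auto intro!: presub_incl simp flip: U_F_cl)
qed

definition KF :: "(int ^ 'i) \<times> 'i word \<Rightarrow> ('k, 'i gen) ncpoly" where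
  "KF = (\<lambda>(m, w). Kp m * Fw w)"

definition KB :: "(int ^ 'i) \<times> 'i word \<Rightarrow> ('k, 'i gen) ncpoly" where
  "KB = (\<lambda>(m, w). Kp m * Bw w)"

lemma KF_simp: "KF (m, w) = Kp m * Fw w" and KB_simp: "KB (m, w) = Kp m * Bw w"
  by (simp_all add: KF_def KB_def)

lemma H_theta_U_minus_eq:
  "carrier (H_theta_U_minus chi I tau) = cl ` (lin KF ` {s. keys s \<subseteq> Lat \<times> UNIV})"
proof -
  let ?S = "H_theta chi I tau \<union> U_minus chi I"
  have "subalg_U chi I ?S = cl ` (lin KF ` {s. keys s \<subseteq> Lat \<times> UNIV})"
  proof (rule subalg_span)
    fix a b assume ab: "a \<in> Lat \<times> (UNIV :: 'i word set)" "b \<in> Lat \<times> (UNIV :: 'i word set)"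
    obtain m u n v where "a = (m, u)" "b = (n, v)" by (cases a; cases b)
    then show "\<exists>k. \<exists>d\<in>Lat \<times> UNIV. KF a * KF b \<simeq>\<^sub>J smul k (KF d)"
      using ab KF_mult[of m u n v]
      by (intro exI[of _ "chi n (zdeg u)"] bexI[of _ "(m + n, u + v)"])
        (simp_all add: KF_simp Lat_add del: letters_plus)
  next
    show "1 \<in> KF ` (Lat \<times> (UNIV :: 'i word set))"
      by (rule image_eqI[of _ _ "(0, 0)"]) (simp_all only: KF_simp Kp_0 Fw_0, simp_all add: Lat_0)
    show "?S \<subseteq> cl ` lin KF ` {s. keys s \<subseteq> Lat \<times> UNIV}"
    proof
      fix x assume "x \<in> ?S"
      then consider s where "keys s \<subseteq> Lat" "x = cl (lin Kp s)" | p where "x = cl (lin Fw p)"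
        unfolding H_theta_eq U_minus_eq by blast
      then show "x \<in> cl ` lin KF ` {s. keys s \<subseteq> Lat \<times> UNIV}"
      proof cases
        case 1
        have "lin Kp s = lin KF (lin (\<lambda>m. bas (m, 0)) s)"
          unfolding lin_lin lin_single KF_simp Fw_0 by simp
        moreover have "keys (lin (\<lambda>m. bas (m, 0 :: 'i word) :: _ \<Rightarrow>\<^sub>0 'k) s) \<subseteq> Lat \<times> UNIV"
          by (rule keys_lin_bas) (use 1 in auto)
        ultimately show ?thesis using 1 by auto
      next
        case 2
        have "lin Fw p = lin KF (lin (\<lambda>w. bas (0, w)) p)"
          unfolding lin_lin lin_single KF_simp Kp_0 by simp
        moreover have "keys (lin (\<lambda>w. bas (0, w) :: _ \<Rightarrow>\<^sub>0 'k) p) \<subseteq> Lat \<times> UNIV"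
          by (rule keys_lin_bas) (auto simp: Lat_0)
        ultimately show ?thesis using 2 by auto
      qed
    qed
    fix a assume "a \<in> Lat \<times> (UNIV :: 'i word set)"
    then obtain m w where a: "a = (m, w)" "m \<in> Lat" by auto
    have "Kp m \<in> presub ?S"
      using a by (intro presub_incl UnI1) (auto simp: H_theta_eq intro!: image_eqI[of _ _ "bas m"])
    moreover have "gF i \<in> presub ?S" for i
    proof (intro presub_incl UnI2)
      show "cl (gF i) \<in> U_minus chi I"
        unfolding U_minus_eq by (rule cl_span_memI[where k = 1 and a = "var i"]) (simp_all add: ncvar_def)
    qed
    then have "Fw w \<in> presub ?S"
      by (rule Fw_presub)
    ultimately show "KF a \<in> presub ?S"
      by (simp add: a KF_simp presub_mult)
  qed
  then show ?thesis by (simp add: H_theta_U_minus_def)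
qed


section \<open>The filtration through representatives\<close>

lemma theta_KB: "theta (KB (m, w)) = opK m (thB w)"
  by (simp add: KB_simp theta_mult act_Kp thB_def)

lemma theta_KF: "theta (KF (m, w)) = bas (0, m, w)"
  using theta_rho_bas[of 0 m w] unfolding Ew_0 by (simp add: KF_simp)

lemma theta_lin_KB: "theta (lin KB s) = thH s"
  unfolding thH_def linmap_lin_apply[OF linmap_theta] by (rule lin_cong) (auto simp: theta_KB)

text \<open>Representatives of filtration step n - 1. Thus \<open>FA 0\<close> is \<open>J\<close>,
  and \<open>Fil_pred n\<close> corresponds to \<open>FA n\<close> for all n, including n =
  0.\<close>

definition FA :: "nat \<Rightarrow> ('k, 'i gen) ncpoly set" where
  "FA n = {x. \<exists>y\<in>FM n. theta x - y \<in> Nsub}"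

lemma FA_iff: "x \<in> FA n \<longleftrightarrow> (\<exists>s\<in>SS n. x \<simeq>\<^sub>J lin KB s)"
  by (auto simp: FA_def FM_def cg_iff theta_lin_KB)

lemma FA_iff_set: "FA n = {x. \<exists>s\<in>SS n. x \<simeq>\<^sub>J lin KB s}"
  using FA_iff by blast

lemma FA_cg: "x \<in> FA n \<Longrightarrow> y \<simeq>\<^sub>J x \<Longrightarrow> y \<in> FA n"
  using FA_iff cg_trans by blast

lemma FA_subsp: "subsp (FA n)"
proof (rule subspI)
  show "0 \<in> FA n"
    using subsp_0[OF FM_subsp, of n] by (auto simp: FA_def linmap_0[OF linmap_theta] Nsub_0 intro!: bexI[of _ 0])
  show "x + y \<in> FA n" if "x \<in> FA n" "y \<in> FA n" for x y
  proof -
    from that obtain x' y' where "x' \<in> FM n" "theta x - x' \<in> Nsub" "y' \<in> FM n" "theta y - y' \<in> Nsub"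
      by (auto simp: FA_def)
    then have "x' + y' \<in> FM n" "theta (x + y) - (x' + y') \<in> Nsub"
      using subsp_add[OF FM_subsp] subsp_add[OF Nsub_subsp, of "theta x - x'" "theta y - y'"]
      by (simp_all add: linmap_add[OF linmap_theta] algebra_simps)
    then show ?thesis by (auto simp: FA_def)
  qed
  show "smul a x \<in> FA n" if "x \<in> FA n" for a x
  proof -
    from that obtain x' where "x' \<in> FM n" "theta x - x' \<in> Nsub"
      by (auto simp: FA_def)
    then have "smul a x' \<in> FM n" "theta (smul a x) - smul a x' \<in> Nsub"
      using subsp_smul[OF FM_subsp] subsp_smul[OF Nsub_subsp, of "theta x - x'" a]
      by (simp_all add: linmap_smul[OF linmap_theta] smul_diff)
    then show ?thesis by (auto simp: FA_def)
  qed
qed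

lemma FA_KB: "m \<in> Lat \<Longrightarrow> wlen w < n \<Longrightarrow> KB (m, w) \<in> FA n"
  using FM_gen by (auto simp: FA_def theta_KB Nsub_0 intro!: bexI[of _ "opK m (thB w)"])

lemma FA_mono: "n \<le> n' \<Longrightarrow> x \<in> FA n \<Longrightarrow> x \<in> FA n'"
  using FM_mono[of n n'] by (auto simp: FA_def)

lemma FA_0: "x \<in> FA 0 \<longleftrightarrow> x \<in> J"
proof -
  have "SS 0 = {0}" by (auto simp: SS_def)
  then show ?thesis by (simp add: FA_iff cg_def)
qed

text \<open>The strict inequalities cover at once products of two elements of full degree and
  products in which one factor has dropped in degree.\<close>

lemma FA_mult_gen:
  assumes "x \<in> FA a" "y \<in> FA b" "\<And>l k. l < a \<Longrightarrow> k < b \<Longrightarrow> l + k < n"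
  shows "x * y \<in> FA n"
proof -
  obtain s t where s: "s \<in> SS a" "x \<simeq>\<^sub>J lin KB s" and t: "t \<in> SS b" "y \<simeq>\<^sub>J lin KB t"
    using assms(1,2) by (auto simp: FA_iff)
  have g: "KB k * KB k' \<in> FA n" if "k \<in> keys s" "k' \<in> keys t" for k k'
  proof -
    obtain m u m' v where k: "k = (m, u)" "k' = (m', v)" by (cases k; cases k')
    then have b: "m \<in> Lat" "m' \<in> Lat" "wlen u < a" "wlen v < b"
      using that s t by (auto simp: SS_def)
    show ?thesis
      unfolding k KB_simp
      by (rule FA_cg[OF _ KB_mult])
        (use b assms(3) in \<open>auto intro!: subsp_smul[OF FA_subsp] FA_KB Lat_add simp flip: KB_simp\<close>)
  qed
  have "lin KB s * lin KB t = lin (\<lambda>a. lin (\<lambda>b. KB a * KB b) t) s"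
    unfolding linmap_lin_apply[OF linmap_times_right] linmap_lin_apply[OF linmap_times_left]
    by (rule lin_swap)
  also have "\<dots> \<in> FA n"
    by (intro lin_mem FA_subsp g)
  finally show ?thesis
    using FA_cg cg_mult[OF s(2) t(2)] by blast
qed

lemma FA_mult: "x \<in> FA (Suc l) \<Longrightarrow> y \<in> FA (Suc m) \<Longrightarrow> x * y \<in> FA (Suc (l + m))"
  and FA_mult_left: "x \<in> FA l \<Longrightarrow> y \<in> FA (Suc m) \<Longrightarrow> x * y \<in> FA (l + m)"
  and FA_mult_right: "x \<in> FA (Suc l) \<Longrightarrow> y \<in> FA m \<Longrightarrow> x * y \<in> FA (l + m)"
  by (erule FA_mult_gen, assumption, simp)+

lemma Bw_var: "Bw (var i) = Bg i"
  using Bw_step[of i 0] by simp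

lemma FA_Bw: "wlen w < n \<Longrightarrow> Bw w \<in> FA n"
  using FA_KB[OF Lat_0, of w n] by (simp add: KB_simp Kp_0)

lemma FA_Kp: "keys s \<subseteq> Lat \<Longrightarrow> lin Kp s \<in> FA (Suc n)"
  using FA_KB[of _ 0 "Suc n"] by (intro lin_mem FA_subsp) (auto simp: KB_simp)

abbreviation "FIL \<equiv> Fil chi I tau c"
abbreviation "FILP \<equiv> Fil_pred chi I tau c"

lemma Fil_eq: "FIL n = cl ` FA (Suc n)"
proof
  show "FIL n \<subseteq> cl ` FA (Suc n)"
  proof
    fix x assume "x \<in> FIL n"
    then have "(n, x) \<in> fil_pairs chi I tau c" by (simp add: Fil_def)
    then show "x \<in> cl ` FA (Suc n)"
    proof induction
      case (1 h m)
      then show ?case using FA_Kp by (auto simp: H_theta_eq)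
    next
      case (2 m i)
      then show ?case using FA_Bw[of "var i" "Suc (Suc m)"] by (auto simp: B_gen_cl Bw_var)
    next
      case (3 m x y)
      then show ?case using subsp_add[OF FA_subsp] by (auto simp: cl_add)
    next
      case (4 l x m y)
      then show ?case using FA_mult by (auto simp: cl_mult)
    qed
  qed
  let ?S = "{x. (n, cl x) \<in> fil_pairs chi I tau c}"
  have H: "(m, cl x) \<in> fil_pairs chi I tau c" if "x \<in> lin Kp ` {s. keys s \<subseteq> Lat}" for m x
    using that by (intro fil_pairs.intros(1)) (auto simp: H_theta_eq)
  have K: "Kp m \<in> lin Kp ` {s. keys s \<subseteq> Lat}" "smul a 1 \<in> lin Kp ` {s. keys s \<subseteq> Lat}" if "m \<in> Lat" for m a
  proof -
    show "Kp m \<in> lin Kp ` {s. keys s \<subseteq> Lat}"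
      by (rule image_eqI[of _ _ "bas m"]) (use that in auto)
    show "smul a 1 \<in> lin Kp ` {s. keys s \<subseteq> Lat}"
      by (rule image_eqI[of _ _ "Poly_Mapping.single 0 a"]) (auto simp: Kp_0 Lat_0)
  qed
  have S: "subsp ?S"
  proof (rule subspI)
    show "0 \<in> ?S" using H[OF K(2)[OF Lat_0, of 0]] by simp
    show "x + y \<in> ?S" if "x \<in> ?S" "y \<in> ?S" for x y
      using that by (auto intro: fil_pairs.intros(3) simp flip: cl_add)
    show "smul a x \<in> ?S" if "x \<in> ?S" for a x
      using that fil_pairs.intros(4)[OF H[OF K(2)[OF Lat_0, of a], of 0], where m = n and y = "cl x"]
      by (simp add: cl_mult flip: smul_mult_left)
  qed
  have B: "(wlen w, cl (Bw w)) \<in> fil_pairs chi I tau c" for w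
  proof (induction w rule: word_induct)
    case zero
    show ?case using H[OF K(1)[OF Lat_0], of 0] by (simp add: Kp_0)
  next
    case (step i w)
    show ?case
      using fil_pairs.intros(4)[OF fil_pairs.intros(2)[where m = 0 and i = i] step]
      by (simp add: B_gen_cl cl_mult Bw_step)
  qed
  \<comment> \<open>\<open>H_theta\<close> lies in every filtration step, so the factor
    \<open>Kp m\<close> can fill up the missing degree n - |w|.\<close>
  have "KB (m, w) \<in> ?S" if "m \<in> Lat" "wlen w < Suc n" for m w
    using fil_pairs.intros(4)[OF H[OF K(1)[OF that(1)], of "n - wlen w"] B[of w]] that(2)
    by (simp add: cl_mult KB_simp)
  then have "lin KB s \<in> ?S" if "s \<in> SS (Suc n)" for s
    using that by (intro lin_mem S) (auto simp: SS_def)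
  then show "cl ` FA (Suc n) \<subseteq> FIL n"
    unfolding FA_iff_set Fil_def
  proof clarify
    fix x s assume s: "\<And>s. s \<in> SS (Suc n) \<Longrightarrow> lin KB s \<in> ?S" "s \<in> SS (Suc n)"
      and "x \<simeq>\<^sub>J lin KB s"
    then have "cl x = cl (lin KB s)" by (simp add: cl_eq)
    with s show "(n, cl x) \<in> fil_pairs chi I tau c" by simp
  qed
qed

lemma Fil_pred_eq: "FILP n = cl ` FA n"
proof (cases n)
  case 0
  have "cl x = cl 0" if "x \<in> FA 0" for x
    using that by (simp add: FA_0 cl_eq cg_def)
  then have "cl ` FA 0 = {cl 0}"
    using subsp_0[OF FA_subsp, of 0] by blast
  then show ?thesis by (simp add: Fil_pred_def 0 cl_zero)
next
  case (Suc m)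
  then show ?thesis by (simp add: Fil_pred_def Fil_eq)
qed

lemma cl_FA: "cl x \<in> cl ` FA n \<longleftrightarrow> x \<in> FA n"
  using FA_cg cl_eq by auto


section \<open>Leading terms\<close>


text \<open>\<open>Nsub\<close> is graded by the degrees of u and v and by m, because
  \<open>I\<close> is graded; projections to such components therefore descend to
  \<open>U(chi)\<close>.\<close>

lemma Nsub_res:
  assumes "x \<in> Nsub"
  shows "res (\<lambda>(u, m, v). P (wdeg u) m (wdeg v)) x \<in> Nsub"
proof (rule Nsub_linmap[OF assms linmap_res Nsub_subsp])
  fix a m v assume "a \<in> I"
  have "lin (\<lambda>u. res (\<lambda>(u, m, v). P (wdeg u) m (wdeg v)) (bas (u, m, v))) a
      = lin (\<lambda>u. bas (u, m, v)) (res (\<lambda>u. P (wdeg u) m (wdeg v)) a)"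
    unfolding lin_res by (rule lin_cong) (simp add: res_single)
  then show "lin (\<lambda>u. res (\<lambda>(u, m, v). P (wdeg u) m (wdeg v)) (bas (u, m, v))) a \<in> Nsub"
    using Nsub_leftI[OF I_res[OF \<open>a \<in> I\<close>, of "\<lambda>l. P l m (wdeg v)"], of m v] by simp
next
  fix b u m assume "b \<in> I"
  have "lin (\<lambda>v. res (\<lambda>(u, m, v). P (wdeg u) m (wdeg v)) (bas (u, m, v))) b
      = lin (\<lambda>v. bas (u, m, v)) (res (\<lambda>v. P (wdeg u) m (wdeg v)) b)"
    unfolding lin_res by (rule lin_cong) (simp add: res_single)
  then show "lin (\<lambda>v. res (\<lambda>(u, m, v). P (wdeg u) m (wdeg v)) (bas (u, m, v))) b \<in> Nsub"
    using Nsub_rightI[OF I_res[OF \<open>b \<in> I\<close>, of "\<lambda>l. P (wdeg u) m l"], of u m] by simp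
qed

definition lv :: "nat \<Rightarrow> 'i word \<times> (int ^ 'i) \<times> 'i word \<Rightarrow> bool" where
  "lv n = (\<lambda>(u, m, v). int (wlen u) - int (wlen v) = - int n)"

lemma Nsub_lv: "x \<in> Nsub \<Longrightarrow> res (lv n) x \<in> Nsub"
  using Nsub_res[of x "\<lambda>a m b. height (zvec a) - height (zvec b) = - int n"]
  by (simp add: lv_def height_zdeg)

text \<open>\<open>T n\<close> computes the leading term of elements of filtration degree at most \<open>n\<close>: it sends
  \<open>K_m B_w\<close> to \<open>K_m F_w\<close> if \<open>w\<close> has length \<open>n\<close>, and to zero if \<open>w\<close> is shorter.\<close>

definition T :: "nat \<Rightarrow> ('k, 'i gen) ncpoly \<Rightarrow> ('k, 'i gen) ncpoly" where
  "T n x = rho (res (lv n) (theta x))"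

lemma linmap_T [simp, intro]: "linmap (T n)"
  unfolding T_def[abs_def] by (intro linmap_comp[OF linmap_rho] linmap_comp[OF linmap_res] linmap_theta)

lemma theta_T: "theta (T n x) = res (lv n) (theta x)"
  by (simp add: T_def theta_rho)

lemma T_J: "x \<in> J \<Longrightarrow> T n x \<in> J"
  by (simp add: J_iff theta_T Nsub_lv)

lemma T_cg: "x \<simeq>\<^sub>J y \<Longrightarrow> T n x \<simeq>\<^sub>J T n y"
  using T_J[of "x - y" n] by (simp add: cg_def linmap_diff[OF linmap_T])

lemma T_KB:
  assumes "wlen w \<le> n"
  shows "T n (KB (m, w)) = (if wlen w = n then KF (m, w) else 0)"
proof -
  let ?P = "\<lambda>(u, m :: int ^ 'i, v). int (wlen u) - int (wlen v) > - int (wlen w)"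
  have K: "keys (opK m (thB w - bas (0, 0, w))) \<subseteq> Collect ?P"
  proof (rule keys_linmap[of "opK m" "Collect ?P"])
    show "keys (opK m (bas a)) \<subseteq> Collect ?P" if "a \<in> Collect ?P" for a
      using that by (cases a) (auto simp: opK_bas smul_bas split: if_splits)
    show "keys (thB w - bas (0, 0, w)) \<subseteq> Collect ?P"
      using keys_thB_top by blast
  qed simp
  have "res (lv n) (opK m (thB w - bas (0, 0, w))) = 0"
    by (rule res_none) (use K assms in \<open>auto simp: lv_def\<close>)
  moreover have "opK m (thB w) = opK m (thB w - bas (0, 0, w)) + bas (0, m, w)"
    by (simp add: op_diff opK_bas)
  ultimately have "res (lv n) (opK m (thB w)) = (if wlen w = n then bas (0, m, w) else 0)"
    by (simp add: res_add res_single lv_def)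
  then show ?thesis
    using rho_bas[of 0 m w] unfolding Ew_0 by (simp add: T_def theta_KB KF_simp linmap_0[OF linmap_rho])
qed

lemma T_lin_KB: "s \<in> SS (Suc n) \<Longrightarrow> T n (lin KB s) = lin KF (res (\<lambda>(m, w). wlen w = n) s)"
  unfolding linmap_lin_apply[OF linmap_T] lin_res
  by (rule lin_cong) (auto simp: SS_def T_KB)

lemma T_FA: "x \<in> FA n \<Longrightarrow> T n x \<in> J"
proof -
  assume "x \<in> FA n"
  then obtain s where s: "s \<in> SS n" "x \<simeq>\<^sub>J lin KB s" by (auto simp: FA_iff)
  have "res (\<lambda>(m, w). wlen w = n) s = 0"
    by (rule res_none) (use s in \<open>auto simp: SS_def\<close>)
  moreover have "s \<in> SS (Suc n)" using s by (auto simp: SS_def)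
  ultimately have "T n (lin KB s) = 0" by (simp add: T_lin_KB)
  then show ?thesis
    using T_cg[OF s(2), of n] by (simp add: cg_def)
qed

definition prF :: "int ^ 'i \<Rightarrow> ('k, 'i) pbw \<Rightarrow> ('k, 'i) ncpoly" where
  "prF m = lin (\<lambda>(u, m', v). if u = 0 \<and> m' = m then bas v else 0)"

lemma prF_linmap: "linmap (prF m)"
  by (simp add: prF_def)

text \<open>The slice u = 0 for a fixed weight recovers the F part. Generators of
  \<open>Nsub\<close> with the relation on the left disappear, as elements of \<open>I\<close> have
  no constant term.\<close>

lemma prF_Nsub: "x \<in> Nsub \<Longrightarrow> prF m x \<in> I"
proof (erule Nsub_linmap[OF _ _ I_subsp])
  fix a m' v assume "a \<in> I"
  then have "lin (\<lambda>u. prF m (bas (u, m', v))) a = lin (\<lambda>u. 0) a"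
    by (intro lin_cong) (auto simp: prF_def dest: I_length)
  then show "lin (\<lambda>u. prF m (bas (u, m', v))) a \<in> I"
    by (simp add: subsp_0[OF I_subsp])
next
  fix b u m' assume "b \<in> I"
  then show "lin (\<lambda>v. prF m (bas (u, m', v))) b \<in> I"
    by (cases "u = 0"; cases "m' = m") (simp_all add: prF_def subsp_0[OF I_subsp])
qed (simp add: prF_def)

lemma lin_bas_Nsub: "lin (\<lambda>w. bas (0, m, w)) p \<in> Nsub \<longleftrightarrow> p \<in> I"
  using prF_Nsub[of "lin (\<lambda>w. bas (0, m, w)) p" m] Nsub_rightI[of p 0 m]
  by (auto simp: prF_def lin_lin)

lemma F_J: "lin Fw p \<in> J \<longleftrightarrow> p \<in> I"
proof -
  have "theta (Fw w) = bas (0, 0, w)" for w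
    using theta_KF[of 0 w] by (simp add: KF_simp Kp_0)
  then show ?thesis
    by (simp add: J_iff linmap_lin_apply[OF linmap_theta] lin_bas_Nsub)
qed

definition lead_inj :: "nat \<Rightarrow> bool" where
  "lead_inj n \<longleftrightarrow> (\<forall>x\<in>FA (Suc n). T n x \<in> J \<longrightarrow> x \<in> FA n)"

definition relB :: "nat \<Rightarrow> bool" where
  "relB n \<longleftrightarrow> (\<forall>p\<in>I. thomogeneous n p \<longrightarrow> lin Bw p \<in> FA n)"

lemma N_rel_iff: "l \<in> N_rel chi I tau c \<longleftrightarrow> (\<forall>n\<le>l. relB n)"
  unfolding N_rel_def relB_def eval_F eval_B cl_eq_zero F_J Fil_pred_eq cl_FA by blast

text \<open>If p lies in \<open>I\<close>, then p(B) has the leading term p(F) = 0. Conversely, sort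
  the top part of x by the weights m in \<open>Lat\<close>: a vanishing leading term means that each
  slice is a homogeneous element of \<open>I\<close>, and with B in place of F each slice drops by
  assumption.\<close>

lemma lead_inj_relB: "lead_inj n \<longleftrightarrow> relB n"
proof
  assume inj: "lead_inj n"
  show "relB n"
    unfolding relB_def
  proof (intro ballI impI)
    fix p assume p: "p \<in> I" "thomogeneous n p"
    have "lin Bw p \<in> FA (Suc n)"
      by (intro lin_mem FA_subsp FA_Bw) (use p in \<open>simp add: thomogeneous_def\<close>)
    moreover have "T n (lin Bw p) = lin Fw p"
      unfolding linmap_lin_apply[OF linmap_T]
    proof (rule lin_cong)
      fix w assume "w \<in> keys p"
      then have "wlen w = n" using p by (simp add: thomogeneous_def)
      then show "T n (Bw w) = Fw w"
        using T_KB[of w n 0] by (simp add: KB_simp KF_simp Kp_0)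
    qed
    ultimately show "lin Bw p \<in> FA n"
      using inj p by (simp add: lead_inj_def F_J)
  qed
next
  assume B: "relB n"
  show "lead_inj n"
    unfolding lead_inj_def
  proof (intro ballI impI)
    fix x assume x: "x \<in> FA (Suc n)" "T n x \<in> J"
    then obtain s where s: "s \<in> SS (Suc n)" "x \<simeq>\<^sub>J lin KB s" by (auto simp: FA_iff)
    define t where "t = res (\<lambda>(m, w). wlen w = n) s"
    have t: "keys t \<subseteq> {(m, w). m \<in> Lat \<and> wlen w = n}"
      using s(1) by (auto simp: t_def SS_def keys_res)
    have "T n (lin KB s) \<simeq>\<^sub>J 0"
      using cg_trans[OF cg_sym[OF T_cg[OF s(2), of n]], of 0] x(2) by (simp add: cg_def)
    then have N: "lin (\<lambda>k. bas (0, k)) t \<in> Nsub"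
    proof -
      have "theta (KF k) = bas (0, k)" for k by (cases k) (simp add: theta_KF)
      then show ?thesis
        using \<open>T n (lin KB s) \<simeq>\<^sub>J 0\<close>
        by (simp add: T_lin_KB[OF s(1)] cg_def J_iff linmap_lin_apply[OF linmap_theta] t_def[symmetric])
    qed
    define sl where "sl m = lin (\<lambda>(m', w). if m' = m then bas w else 0) t" for m
    have sl: "sl m \<in> I" for m
    proof -
      have "prF m (bas (0, k)) = (if fst k = m then bas (snd k) else 0)" for k
        by (cases k) (simp add: prF_def)
      then show ?thesis
        using prF_Nsub[OF N, of m]
        by (simp add: sl_def linmap_lin_apply[of "prF m"] prF_linmap case_prod_unfold)
    qed
    have slh: "thomogeneous n (sl m)" for m
      unfolding thomogeneous_def sl_def
      using keys_lin[of "\<lambda>(m', w). if m' = m then bas w else 0" t] t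
      by (fastforce split: if_splits)
    have KK: "Kp m * x \<in> FA n" if "m \<in> Lat" "x \<in> FA n" for m x
      using FA_mult_right[of "KB (m, 0)" 0 x n] FA_KB[of m 0 "Suc 0"] that by (simp add: KB_simp)
    have "lin KB (res (\<lambda>k. fst k = m) t) = Kp m * lin Bw (sl m)" for m
      unfolding lin_res sl_def lin_lin linmap_lin_apply[OF linmap_times_left]
      by (rule lin_cong) (auto simp: KB_simp)
    then have "lin KB (res (\<lambda>k. fst k = m) t) \<in> FA n" if "m \<in> fst ` keys t" for m
      using that t B sl slh by (auto simp: relB_def intro!: KK)
    then have "lin KB (\<Sum>m\<in>fst ` keys t. res (\<lambda>k. fst k = m) t) \<in> FA n"
      unfolding lin_sum by (intro subsp_sum FA_subsp)
    then have tF: "lin KB t \<in> FA n"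
      using sum_res_partition[of "fst ` keys t" t fst] by simp
    have "s - t = res (\<lambda>(m, w). wlen w \<noteq> n) s"
      by (rule poly_mapping_eqI) (auto simp: t_def lookup_minus)
    then have "s - t \<in> SS n"
      using s(1) by (auto simp: SS_def keys_res)
    then have "lin KB (s - t) \<in> FA n" using FA_iff cg_refl by blast
    from subsp_add[OF FA_subsp this tF] have "lin KB s \<in> FA n" by (simp add: lin_diff)
    then show "x \<in> FA n" by (rule FA_cg) (rule s(2))
  qed
qed

lemma T_mult:
  assumes "x \<in> FA (Suc l)" "y \<in> FA (Suc k)"
  shows "T (l + k) (x * y) \<simeq>\<^sub>J T l x * T k y"
proof -
  obtain s t where s: "s \<in> SS (Suc l)" "x \<simeq>\<^sub>J lin KB s" and t: "t \<in> SS (Suc k)" "y \<simeq>\<^sub>J lin KB t"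
    using assms by (auto simp: FA_iff)
  have b: "T (l + k) (KB a * KB b) \<simeq>\<^sub>J T l (KB a) * T k (KB b)" if "a \<in> keys s" "b \<in> keys t" for a b
  proof -
    obtain m u n v where ab: "a = (m, u)" "b = (n, v)" by (cases a; cases b)
    then have L: "m \<in> Lat" "n \<in> Lat" "wlen u \<le> l" "wlen v \<le> k"
      using that s t by (auto simp: SS_def)
    have "T (l + k) (KB a * KB b) \<simeq>\<^sub>J T (l + k) (smul (chi n (zdeg u)) (KB (m + n, u + v)))"
      unfolding ab KB_simp by (intro T_cg KB_mult L)
    also have "\<dots> = smul (chi n (zdeg u)) (T (l + k) (KB (m + n, u + v)))"
      by (rule linmap_smul[OF linmap_T])
    also have "\<dots> \<simeq>\<^sub>J T l (KB a) * T k (KB b)"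
    proof (cases "wlen u = l \<and> wlen v = k")
      case True
      then show ?thesis
        using cg_sym[OF KF_mult[of m u n v]] by (simp add: ab T_KB KF_simp del: letters_plus) (simp add: T_KB KF_simp)
    next
      case False
      then have "wlen (u + v) \<noteq> l + k" "wlen (u + v) \<le> l + k" "T l (KB a) * T k (KB b) = 0"
        using L by (auto simp: ab T_KB)
      then show ?thesis by (simp add: T_KB del: letters_plus)
    qed
    finally show ?thesis .
  qed
  have "T (l + k) (x * y) \<simeq>\<^sub>J T (l + k) (lin KB s * lin KB t)"
    by (intro T_cg cg_mult s t)
  also have "\<dots> = lin (\<lambda>b. lin (\<lambda>a. T (l + k) (KB a * KB b)) s) t"
    unfolding linmap_lin_apply[OF linmap_times_right] linmap_lin_apply[OF linmap_times_left]
      linmap_lin_apply[OF linmap_T] by simp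
  also have "\<dots> \<simeq>\<^sub>J lin (\<lambda>b. lin (\<lambda>a. T l (KB a) * T k (KB b)) s) t"
    by (intro cg_lin b)
  also have "\<dots> = T l (lin KB s) * T k (lin KB t)"
    unfolding linmap_lin_apply[OF linmap_times_right] linmap_lin_apply[OF linmap_times_left]
      linmap_lin_apply[OF linmap_T] by simp
  also have "\<dots> \<simeq>\<^sub>J T l x * T k y"
    by (intro cg_mult T_cg cg_sym[OF s(2)] cg_sym[OF t(2)])
  finally show ?thesis .
qed


section \<open>The associated graded algebra\<close>

definition CS :: "nat \<Rightarrow> ('k, 'i gen) ncpoly \<Rightarrow> ('k, 'i) U_elt set" where
  "CS n a = {cl b | b. b - a \<in> FA n}"

definition Gr :: "(nat \<Rightarrow> ('k, 'i gen) ncpoly) \<Rightarrow> nat \<Rightarrow> ('k, 'i) U_elt set" where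
  "Gr a = (\<lambda>m. CS m (a m))"

definition adm :: "(nat \<Rightarrow> ('k, 'i gen) ncpoly) \<Rightarrow> bool" where
  "adm a \<longleftrightarrow> (\<forall>m. a m \<in> FA (Suc m)) \<and> (\<exists>N. \<forall>m\<ge>N. a m = 0)"

abbreviation "gB \<equiv> gr_B chi I tau c"

lemma CS_coset: "FILP n +>\<^bsub>U\<^esub> cl a = CS n a"
proof -
  have "FILP n +>\<^bsub>U\<^esub> cl a = {cl (h + a) | h. h \<in> FA n}"
    by (auto simp: a_r_coset_def r_coset_def Fil_pred_eq cl_add)
  also have "\<dots> = CS n a"
    unfolding CS_def by (auto intro: exI[of _ "_ - a"])
  finally show ?thesis .
qed

lemma cl_CS: "cl x \<in> CS n a \<longleftrightarrow> x - a \<in> FA n"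
proof
  assume "cl x \<in> CS n a"
  then obtain b where b: "x \<simeq>\<^sub>J b" "b - a \<in> FA n" by (auto simp: CS_def cl_eq)
  show "x - a \<in> FA n"
    using FA_cg[OF b(2), of "x - a"] b(1) by (simp add: cg_def)
qed (auto simp: CS_def)

lemma CS_eq: "CS n a = CS n b \<longleftrightarrow> a - b \<in> FA n"
proof
  assume "CS n a = CS n b"
  moreover have "cl a \<in> CS n a" by (simp add: cl_CS subsp_0[OF FA_subsp])
  ultimately show "a - b \<in> FA n" by (simp add: cl_CS)
next
  assume ab: "a - b \<in> FA n"
  have "x - a \<in> FA n \<longleftrightarrow> x - b \<in> FA n" for x
    using subsp_add[OF FA_subsp, of "x - a" n "a - b"] subsp_diff[OF FA_subsp, of "x - b" n "a - b"] ab
    by auto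
  then show "CS n a = CS n b" by (simp add: CS_def)
qed

lemma CS_0: "FILP n = CS n 0"
  by (auto simp: Fil_pred_eq CS_def)

lemma gr_class_Gr: "gr_class chi I tau c m (cl x) = Gr (\<lambda>l. if l = m then x else 0)"
  unfolding gr_class_def Gr_def CS_coset by (rule ext) (simp add: CS_0)

lemma gB_carrier: "carrier gB = Gr ` {a. adm a}"
proof
  show "carrier gB \<subseteq> Gr ` {a. adm a}"
  proof
    fix g assume "g \<in> carrier gB"
    then have g: "\<forall>m. \<exists>x\<in>FIL m. g m = FILP m +>\<^bsub>U\<^esub> x" "finite {m. g m \<noteq> FILP m}"
      by (simp_all add: gr_B_def)
    have "\<exists>x. x \<in> FA (Suc m) \<and> g m = CS m x \<and> (g m = CS m 0 \<longrightarrow> x = 0)" for m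
    proof (cases "g m = CS m 0")
      case True
      then show ?thesis using subsp_0[OF FA_subsp] by blast
    next
      case False
      obtain x where "x \<in> FA (Suc m)" "g m = CS m x"
        using g(1) unfolding Fil_eq by (metis CS_coset imageE)
      with False show ?thesis by blast
    qed
    then obtain a where a: "\<And>m. a m \<in> FA (Suc m)" "\<And>m. g m = CS m (a m)" "\<And>m. g m = CS m 0 \<Longrightarrow> a m = 0"
      by metis
    obtain N where N: "{m. g m \<noteq> FILP m} \<subseteq> {..<N}"
      using g(2) by (auto simp: finite_nat_iff_bounded)
    have "a m = 0" if "N \<le> m" for m
      using N that a(3)[of m] by (fastforce simp: CS_0)
    then have "adm a" using a(1) by (auto simp: adm_def)
    moreover have "g = Gr a" using a(2) by (auto simp: Gr_def)
    ultimately show "g \<in> Gr ` {a. adm a}" by blast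
  qed
  show "Gr ` {a. adm a} \<subseteq> carrier gB"
  proof clarify
    fix a assume a: "adm a"
    then obtain N where N: "\<And>m. N \<le> m \<Longrightarrow> a m = 0" by (auto simp: adm_def)
    have "{m. Gr a m \<noteq> FILP m} \<subseteq> {..<N}"
      using N by (auto simp: Gr_def CS_0)
    then have "finite {m. Gr a m \<noteq> FILP m}" by (rule finite_subset) simp
    moreover have "\<exists>x\<in>FIL m. Gr a m = FILP m +>\<^bsub>U\<^esub> x" for m
      using a by (auto simp: Fil_eq Gr_def CS_coset adm_def intro!: bexI[of _ "cl (a m)"])
    ultimately show "Gr a \<in> carrier gB" by (simp add: gr_B_def)
  qed
qed

lemma gB_add: "Gr a \<oplus>\<^bsub>gB\<^esub> Gr b = Gr (\<lambda>m. a m + b m)"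
proof -
  have "CS m x <+>\<^bsub>U\<^esub> CS m y = CS m (x + y)" for m x y
  proof
    show "CS m x <+>\<^bsub>U\<^esub> CS m y \<subseteq> CS m (x + y)"
    proof
      fix z assume "z \<in> CS m x <+>\<^bsub>U\<^esub> CS m y"
      then obtain d e where de: "d - x \<in> FA m" "e - y \<in> FA m" and z: "z = cl (d + e)"
        by (auto simp: set_add_def set_mult_def CS_def cl_add)
      have "(d + e) - (x + y) \<in> FA m"
        using subsp_add[OF FA_subsp de] by (simp add: algebra_simps)
      then show "z \<in> CS m (x + y)" by (simp add: z cl_CS)
    qed
    show "CS m (x + y) \<subseteq> CS m x <+>\<^bsub>U\<^esub> CS m y"
    proof
      fix z assume "z \<in> CS m (x + y)"
      then obtain d where d: "d - (x + y) \<in> FA m" "z = cl d" by (auto simp: CS_def)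
      have "cl (d - y) \<in> CS m x" "cl y \<in> CS m y" "cl (d - y) \<oplus>\<^bsub>U\<^esub> cl y = z"
        using d subsp_0[OF FA_subsp] by (simp_all add: cl_CS cl_add algebra_simps)
      then show "z \<in> CS m x <+>\<^bsub>U\<^esub> CS m y"
        by (auto simp: set_add_def set_mult_def)
    qed
  qed
  then show ?thesis by (simp add: gr_B_def Gr_def)
qed

lemma gB_mult:
  assumes a: "\<And>m. a m \<in> FA (Suc m)" and b: "\<And>m. b m \<in> FA (Suc m)"
  shows "Gr a \<otimes>\<^bsub>gB\<^esub> Gr b = Gr (\<lambda>m. \<Sum>l\<le>m. a l * b (m - l))"
proof
  fix m
  let ?p = "\<Sum>l\<le>m. a l * b (m - l)"
  let ?X = "{z \<oplus>\<^bsub>U\<^esub> finsum U (\<lambda>l. x l \<otimes>\<^bsub>U\<^esub> y (m - l)) {..m} | x y z.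
           (\<forall>l\<le>m. x l \<in> Gr a l \<and> y l \<in> Gr b l) \<and> z \<in> FILP m}"
  have "?X = CS m ?p"
  proof
    show "?X \<subseteq> CS m ?p"
    proof clarify
      fix x y z assume xy: "\<forall>l\<le>m. x l \<in> Gr a l \<and> y l \<in> Gr b l" and z: "z \<in> FILP m"
      have "\<forall>l. \<exists>d. l \<le> m \<longrightarrow> x l = cl d \<and> d - a l \<in> FA l"
        using xy by (auto simp: Gr_def CS_def)
      then obtain d where d: "\<And>l. l \<le> m \<Longrightarrow> x l = cl (d l) \<and> d l - a l \<in> FA l" by metis
      have "\<forall>l. \<exists>e. l \<le> m \<longrightarrow> y l = cl e \<and> e - b l \<in> FA l"
        using xy by (auto simp: Gr_def CS_def)
      then obtain e where e: "\<And>l. l \<le> m \<Longrightarrow> y l = cl (e l) \<and> e l - b l \<in> FA l" by metis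
      obtain z' where z': "z = cl z'" "z' \<in> FA m" using z by (auto simp: Fil_pred_eq)
      have "finsum U (\<lambda>l. x l \<otimes>\<^bsub>U\<^esub> y (m - l)) {..m} = finsum U (\<lambda>l. cl (d l * e (m - l))) {..m}"
        using d e U_carrier by (intro abelian_monoid.finsum_cong'[OF abelian_group.axioms(1)[OF ring.is_abelian_group[OF ring_U]]])
          (auto simp: cl_mult)
      then have eq: "z \<oplus>\<^bsub>U\<^esub> finsum U (\<lambda>l. x l \<otimes>\<^bsub>U\<^esub> y (m - l)) {..m} = cl (z' + (\<Sum>l\<le>m. d l * e (m - l)))"
        by (simp add: cl_sum cl_add z')
      \<comment> \<open>A change of representatives is split as d e - a b = (d - a) e + a (e - b),
        with d - a and e - b one step lower.\<close>
      have "d l * e (m - l) - a l * b (m - l) \<in> FA m" if l: "l \<le> m" for l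
      proof -
        have dl: "d l - a l \<in> FA l" and el: "e (m - l) - b (m - l) \<in> FA (m - l)"
          using d e l by auto
        have "e (m - l) \<in> FA (Suc (m - l))"
          using subsp_add[OF FA_subsp FA_mono[OF _ el] b[of "m - l"]] by simp
        then have "(d l - a l) * e (m - l) \<in> FA (l + (m - l))"
          by (rule FA_mult_left[OF dl])
        moreover have "a l * (e (m - l) - b (m - l)) \<in> FA (l + (m - l))"
          by (rule FA_mult_right[OF a el])
        ultimately show ?thesis
          using l subsp_add[OF FA_subsp, of "(d l - a l) * e (m - l)" m "a l * (e (m - l) - b (m - l))"]
          by (simp add: algebra_simps)
      qed
      then have "(\<Sum>l\<le>m. d l * e (m - l) - a l * b (m - l)) \<in> FA m"
        by (intro subsp_sum FA_subsp) simp
      from subsp_add[OF FA_subsp z'(2) this]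
      show "z \<oplus>\<^bsub>U\<^esub> finsum U (\<lambda>l. x l \<otimes>\<^bsub>U\<^esub> y (m - l)) {..m} \<in> CS m ?p"
        unfolding eq cl_CS by (simp add: sum_subtractf algebra_simps)
    qed
    show "CS m ?p \<subseteq> ?X"
    proof
      fix q assume "q \<in> CS m ?p"
      then obtain d where d: "d - ?p \<in> FA m" "q = cl d" by (auto simp: CS_def)
      have "finsum U (\<lambda>l. cl (a l) \<otimes>\<^bsub>U\<^esub> cl (b (m - l))) {..m} = cl ?p"
        by (simp add: cl_mult cl_sum)
      then have "q = cl (d - ?p) \<oplus>\<^bsub>U\<^esub> finsum U (\<lambda>l. cl (a l) \<otimes>\<^bsub>U\<^esub> cl (b (m - l))) {..m}"
        by (simp add: d cl_add)
      moreover have "\<forall>l\<le>m. cl (a l) \<in> Gr a l \<and> cl (b l) \<in> Gr b l"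
        by (simp add: Gr_def cl_CS subsp_0[OF FA_subsp])
      moreover have "cl (d - ?p) \<in> FILP m"
        using d by (simp add: Fil_pred_eq)
      ultimately show "q \<in> ?X"
        by (intro CollectI exI[of _ "\<lambda>l. cl (a l)"] exI[of _ "\<lambda>l. cl (b l)"] exI[of _ "cl (d - ?p)"] conjI)
    qed
  qed
  then show "(Gr a \<otimes>\<^bsub>gB\<^esub> Gr b) m = Gr (\<lambda>m. \<Sum>l\<le>m. a l * b (m - l)) m"
    by (simp add: gr_B_def Gr_def)
qed


section \<open>The map from the associated graded algebra\<close>


abbreviation "HU \<equiv> H_theta_U_minus chi I tau"

text \<open>The sum of the leading terms of the components. By \<open>T_FA\<close> the choice of
  representatives does not matter in \<open>U(chi)\<close>.\<close>

definition Phi :: "(nat \<Rightarrow> ('k, 'i) U_elt set) \<Rightarrow> ('k, 'i) U_elt" where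
  "Phi g = cl (\<Sum>m | g m \<noteq> CS m 0. T m (SOME x. g m = CS m x))"

lemma cg_sum: "(\<And>x. x \<in> A \<Longrightarrow> f x \<simeq>\<^sub>J g x) \<Longrightarrow> sum f A \<simeq>\<^sub>J sum g A"
  by (induction A rule: infinite_finite_induct) (auto intro: cg_add)

lemma Phi_Gr:
  assumes "\<And>m. N \<le> m \<Longrightarrow> a m = 0"
  shows "Phi (Gr a) = cl (\<Sum>m<N. T m (a m))"
proof -
  let ?S = "{m. Gr a m \<noteq> CS m 0}"
  let ?x = "\<lambda>m. SOME x. Gr a m = CS m x"
  have S: "?S \<subseteq> {..<N}"
    using assms by (auto simp: Gr_def not_less[symmetric])
  have "T m (?x m) \<simeq>\<^sub>J T m (a m)" for m
  proof -
    have "Gr a m = CS m (?x m)" by (rule someI[of _ "a m"]) (simp add: Gr_def)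
    then have "a m - ?x m \<in> FA m" by (simp add: Gr_def CS_eq)
    from T_FA[OF this] have "T m (a m) \<simeq>\<^sub>J T m (?x m)"
      by (simp add: cg_def linmap_diff[OF linmap_T])
    then show ?thesis by (rule cg_sym)
  qed
  then have "(\<Sum>m\<in>?S. T m (?x m)) \<simeq>\<^sub>J (\<Sum>m\<in>?S. T m (a m))"
    by (rule cg_sum)
  also have "\<dots> = (\<Sum>m<N. if m \<in> ?S then T m (a m) else 0)"
    using S by (intro sum.mono_neutral_cong_left) auto
  \<comment> \<open>A zero coset may have a nonzero representative, but the leading term of that
    representative lies in \<open>J\<close>.\<close>
  also have "\<dots> \<simeq>\<^sub>J (\<Sum>m<N. T m (a m))"
  proof (rule cg_sum)
    fix m
    show "(if m \<in> ?S then T m (a m) else 0) \<simeq>\<^sub>J T m (a m)"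
    proof (cases "m \<in> ?S")
      case False
      then have "a m \<in> FA m" by (simp add: Gr_def CS_eq)
      from T_FA[OF this] have "T m (a m) \<simeq>\<^sub>J 0" by (simp add: cg_def)
      with False show ?thesis by (simp add: cg_sym)
    qed simp
  qed
  finally show ?thesis by (simp add: Phi_def cl_eq)
qed

lemma Phi_gr_class: "Phi (gr_class chi I tau c m (cl x)) = cl (T m x)"
proof -
  have "Phi (Gr (\<lambda>l. if l = m then x else 0)) = cl (\<Sum>l<Suc m. T l (if l = m then x else 0))"
    by (rule Phi_Gr) auto
  also have "(\<Sum>l<Suc m. T l (if l = m then x else 0)) = (\<Sum>l<Suc m. if l = m then T m x else 0)"
    by (rule sum.cong) (auto simp: linmap_0[OF linmap_T])
  also have "\<dots> = T m x" by simp
  finally show ?thesis by (simp add: gr_class_Gr)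
qed

lemma HU_carrier: "carrier HU = cl ` (lin KF ` {s. keys s \<subseteq> Lat \<times> UNIV})"
  by (rule H_theta_U_minus_eq)

lemma HU_mult: "x \<otimes>\<^bsub>HU\<^esub> y = x \<otimes>\<^bsub>U\<^esub> y" and HU_add: "x \<oplus>\<^bsub>HU\<^esub> y = x \<oplus>\<^bsub>U\<^esub> y"
  and HU_one: "\<one>\<^bsub>HU\<^esub> = \<one>\<^bsub>U\<^esub>"
  by (simp_all add: H_theta_U_minus_def)

definition HA :: "('k, 'i gen) ncpoly set" where
  "HA = {x. cl x \<in> carrier HU}"

lemma HA_subsp: "subsp HA"
  unfolding HA_def H_theta_U_minus_def using presub_subsp by (simp add: presub_def)

lemma T_HA: "x \<in> FA (Suc n) \<Longrightarrow> T n x \<in> HA"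
proof -
  assume "x \<in> FA (Suc n)"
  then obtain s where s: "s \<in> SS (Suc n)" "x \<simeq>\<^sub>J lin KB s" by (auto simp: FA_iff)
  have "cl (T n x) = cl (lin KF (res (\<lambda>(m, w). wlen w = n) s))"
    using T_cg[OF s(2), of n] by (simp add: cl_eq T_lin_KB[OF s(1)])
  moreover have "keys (res (\<lambda>(m, w). wlen w = n) s) \<subseteq> Lat \<times> UNIV"
    using s(1) by (auto simp: SS_def keys_res)
  ultimately show ?thesis by (auto simp: HA_def HU_carrier)
qed

lemma adm_add: "adm a \<Longrightarrow> adm b \<Longrightarrow> adm (\<lambda>m. a m + b m)"
proof -
  assume a: "adm a" and b: "adm b"
  then obtain N N' where N: "\<And>m. N \<le> m \<Longrightarrow> a m = 0" "\<And>m. N' \<le> m \<Longrightarrow> b m = 0"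
    by (auto simp: adm_def)
  have "a m + b m = 0" if "max N N' \<le> m" for m
    using N that by simp
  then show ?thesis
    using a b subsp_add[OF FA_subsp] unfolding adm_def by blast
qed

lemma adm_single: "x \<in> FA (Suc m) \<Longrightarrow> adm (\<lambda>l. if l = m then x else 0)"
  unfolding adm_def
  by (intro conjI allI exI[of _ "Suc m"]) (auto simp: subsp_0[OF FA_subsp])

lemma gr_class_carrier: "x \<in> FA (Suc m) \<Longrightarrow> gr_class chi I tau c m (cl x) \<in> carrier gB"
  using adm_single by (auto simp: gB_carrier gr_class_Gr)

lemma one_FA: "1 \<in> FA (Suc n)"
  using FA_Bw[of 0 "Suc n"] by simp

text \<open>The triangle of total degree below N + N' contains the rectangle that supports the
  product; elsewhere \<open>f\<close> vanishes.\<close>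

lemma sum_conv:
  fixes N N' :: nat
  assumes a: "\<And>m. N \<le> m \<Longrightarrow> a m = 0" and b: "\<And>m. N' \<le> m \<Longrightarrow> b m = 0"
    and f: "\<And>l k. a l = 0 \<or> b k = 0 \<Longrightarrow> f l k = (0 :: 'b::comm_monoid_add)"
  shows "(\<Sum>m<N + N'. \<Sum>l\<le>m. f l (m - l)) = (\<Sum>l<N. \<Sum>k<N'. f l k)"
proof -
  have "(\<Sum>m<N + N'. \<Sum>l\<le>m. f l (m - l)) = (\<Sum>(l, k)\<in>{(l, k). l + k < N + N'}. f l k)"
    by (rule sum.triangle_reindex[symmetric])
  also have "\<dots> = (\<Sum>(l, k)\<in>{..<N} \<times> {..<N'}. f l k)"
  proof (rule sum.mono_neutral_right)
    have "{(l, k). l + k < N + N'} \<subseteq> {..<N + N'} \<times> {..<N + N'}" by auto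
    then show "finite {(l, k). l + k < N + N'}" by (rule finite_subset) simp
    show "\<forall>x\<in>{(l, k). l + k < N + N'} - {..<N} \<times> {..<N'}. (case x of (l, k) \<Rightarrow> f l k) = 0"
    proof
      fix x assume x: "x \<in> {(l, k). l + k < N + N'} - {..<N} \<times> {..<N'}"
      obtain l k where lk: "x = (l, k)" by (cases x)
      have "N \<le> l \<or> N' \<le> k" using x lk by auto
      then show "(case x of (l, k) \<Rightarrow> f l k) = 0" using a b f lk by auto
    qed
  qed auto
  also have "\<dots> = (\<Sum>l<N. \<Sum>k<N'. f l k)"
    by (simp add: sum.cartesian_product)
  finally show ?thesis .
qed

lemma gB_one: "\<one>\<^bsub>gB\<^esub> = gr_class chi I tau c 0 (cl 1)"
  by (simp add: gr_B_def cl_one)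

lemma T_0_Kp: "T 0 (lin Kp s) = lin Kp s"
  unfolding linmap_lin_apply[OF linmap_T]
proof (rule lin_cong)
  show "T 0 (Kp m) = Kp m" for m
    using T_KB[of 0 0 m] unfolding KB_simp KF_simp Fw_0 by simp
qed

lemma Phi_hom: "Phi \<in> ring_hom gB HU"
proof (rule ring_hom_memI)
  fix g assume "g \<in> carrier gB"
  then obtain a where a: "adm a" "g = Gr a" by (auto simp: gB_carrier)
  then obtain N where N: "\<And>m. N \<le> m \<Longrightarrow> a m = 0" by (auto simp: adm_def)
  have "(\<Sum>m<N. T m (a m)) \<in> HA"
    using a by (intro subsp_sum HA_subsp T_HA) (simp add: adm_def)
  then show "Phi g \<in> carrier HU"
    using Phi_Gr[of N a] N a by (simp add: HA_def)
  fix h assume "h \<in> carrier gB"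
  then obtain b where b: "adm b" "h = Gr b" by (auto simp: gB_carrier)
  then obtain N' where N': "\<And>m. N' \<le> m \<Longrightarrow> b m = 0" by (auto simp: adm_def)
  have F: "a m \<in> FA (Suc m)" "b m \<in> FA (Suc m)" for m
    using a b by (auto simp: adm_def)
  have PN: "Phi g = cl (\<Sum>m<N. T m (a m))" "Phi h = cl (\<Sum>m<N'. T m (b m))"
    using Phi_Gr[of N a] N Phi_Gr[of N' b] N' a b by simp_all
  show "Phi (g \<oplus>\<^bsub>gB\<^esub> h) = Phi g \<oplus>\<^bsub>HU\<^esub> Phi h"
  proof -
    let ?M = "max N N'"
    have "Phi g = cl (\<Sum>m<?M. T m (a m))" "Phi h = cl (\<Sum>m<?M. T m (b m))"
      using Phi_Gr[of ?M a] N Phi_Gr[of ?M b] N' a b by simp_all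
    moreover have "Phi (g \<oplus>\<^bsub>gB\<^esub> h) = cl (\<Sum>m<?M. T m (a m + b m))"
      using N N' by (simp add: a b gB_add Phi_Gr)
    ultimately show ?thesis
      by (simp add: HU_add cl_add linmap_add[OF linmap_T] sum.distrib)
  qed
  show "Phi (g \<otimes>\<^bsub>gB\<^esub> h) = Phi g \<otimes>\<^bsub>HU\<^esub> Phi h"
  proof -
    have z: "(\<Sum>l\<le>m. a l * b (m - l)) = 0" if "N + N' \<le> m" for m
    proof (rule sum.neutral, rule ballI)
      fix l
      have "N \<le> l \<or> N' \<le> m - l" using that by auto
      then show "a l * b (m - l) = 0" using N N' by auto
    qed
    have "Phi (g \<otimes>\<^bsub>gB\<^esub> h) = cl (\<Sum>m<N + N'. T m (\<Sum>l\<le>m. a l * b (m - l)))"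
      unfolding a b gB_mult[OF F] by (rule Phi_Gr) (rule z)
    also have "\<dots> = cl (\<Sum>m<N + N'. \<Sum>l\<le>m. T l (a l) * T (m - l) (b (m - l)))"
      unfolding cl_eq
    proof (rule cg_sum)
      fix m
      have "T m (a l * b (m - l)) \<simeq>\<^sub>J T l (a l) * T (m - l) (b (m - l))" if "l \<le> m" for l
        using T_mult[OF F(1)[of l] F(2)[of "m - l"]] that by simp
      then show "T m (\<Sum>l\<le>m. a l * b (m - l)) \<simeq>\<^sub>J (\<Sum>l\<le>m. T l (a l) * T (m - l) (b (m - l)))"
        unfolding linmap_sum[OF linmap_T] by (intro cg_sum) simp
    qed
    also have "(\<Sum>m<N + N'. \<Sum>l\<le>m. T l (a l) * T (m - l) (b (m - l))) =
        (\<Sum>l<N. \<Sum>k<N'. T l (a l) * T k (b k))"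
      by (rule sum_conv[of N a N' b]) (auto simp: N N' linmap_0[OF linmap_T])
    also have "\<dots> = (\<Sum>m<N. T m (a m)) * (\<Sum>m<N'. T m (b m))"
      by (simp add: sum_product)
    finally show ?thesis by (simp add: PN HU_mult cl_mult)
  qed
next
  have "T 0 1 = 1" using T_0_Kp[of "bas 0"] by (simp only: lin_single Kp_0 smul_1)
  then show "Phi \<one>\<^bsub>gB\<^esub> = \<one>\<^bsub>HU\<^esub>"
    by (simp add: gB_one Phi_gr_class HU_one cl_one)
qed

lemma Phi_B: "Phi (gr_class chi I tau c 1 (B_gen chi I tau c i)) = U_F chi I i"
proof -
  have "T 1 (Bg i) = gF i"
    using T_KB[of "var i" 1 0] by (simp add: KB_simp KF_simp Kp_0 Bw_var) (simp add: ncvar_def)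
  then show ?thesis by (simp add: B_gen_cl Phi_gr_class U_F_cl)
qed

lemma Phi_H: "h \<in> H_theta chi I tau \<Longrightarrow> Phi (gr_class chi I tau c 0 h) = h"
  by (auto simp: H_theta_eq Phi_gr_class T_0_Kp)

text \<open>Uniqueness for the definite description in \<open>gr_map\<close>. The elements whose
  classes have equal images form subspaces that are compatible with products and contain the
  \<open>B_i\<close> and \<open>H_theta\<close>, hence everything.\<close>

lemma gr_hom_eq:
  assumes f: "f \<in> ring_hom gB HU" and g: "g \<in> ring_hom gB HU"
    and B: "\<And>i. f (gr_class chi I tau c 1 (B_gen chi I tau c i)) = g (gr_class chi I tau c 1 (B_gen chi I tau c i))"
    and H: "\<And>h. h \<in> H_theta chi I tau \<Longrightarrow> f (gr_class chi I tau c 0 h) = g (gr_class chi I tau c 0 h)"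
    and x: "x \<in> carrier gB"
  shows "f x = g x"
proof -
  let ?gc = "\<lambda>m x. gr_class chi I tau c m (cl x)"
  have mult: "?gc (l + m) (x * y) = ?gc l x \<otimes>\<^bsub>gB\<^esub> ?gc m y" if "x \<in> FA (Suc l)" "y \<in> FA (Suc m)" for l m x y
  proof -
    have "(\<Sum>i\<le>n. (if i = l then x else 0) * (if n - i = m then y else 0)) = (if n = l + m then x * y else 0)" for n
    proof (cases "l \<le> n")
      case True
      have "(\<Sum>i\<le>n. (if i = l then x else 0) * (if n - i = m then y else 0))
          = (\<Sum>i\<le>n. if i = l then x * (if n - l = m then y else 0) else 0)"
        by (rule sum.cong) auto
      also have "\<dots> = x * (if n - l = m then y else 0)"
        using True by (simp add: sum.delta)
      finally show ?thesis using True by auto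
    next
      case False
      then show ?thesis by (auto intro!: sum.neutral)
    qed
    then show ?thesis
      unfolding gr_class_Gr
      using gB_mult[of "\<lambda>i. if i = l then x else 0" "\<lambda>i. if i = m then y else 0"] that subsp_0[OF FA_subsp]
      by simp
  qed
  have add: "?gc m (x + y) = ?gc m x \<oplus>\<^bsub>gB\<^esub> ?gc m y" for m x y
    unfolding gr_class_Gr gB_add by (rule arg_cong[of _ _ Gr]) auto
  define Q where "Q m = {x \<in> FA (Suc m). f (?gc m x) = g (?gc m x)}" for m
  have Qmult: "x * y \<in> Q (l + m)" if "x \<in> Q l" "y \<in> Q m" for l m x y
    using that ring_hom_mult[OF f, of "?gc l x" "?gc m y"] ring_hom_mult[OF g, of "?gc l x" "?gc m y"]
      gr_class_carrier
    by (simp add: Q_def mult FA_mult)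
  have Q0: "lin Kp s \<in> Q 0" if "keys s \<subseteq> Lat" for s
    using H[of "cl (lin Kp s)"] FA_Kp[OF that, of 0] that by (auto simp: Q_def H_theta_eq)
  have Qscal: "smul k 1 \<in> Q 0" for k
    using Q0[of "Poly_Mapping.single 0 k"] Lat_0 by (simp add: Kp_0)
  \<comment> \<open>An element of lower degree has zero class, which is also the class of 0 in
    degree 0; that one is covered by the assumption on \<open>H_theta\<close>.\<close>
  have Qlow: "x \<in> Q m" if "x \<in> FA m" for m x
  proof -
    have "?gc m x = ?gc m 0"
      unfolding gr_class_Gr Gr_def using that by (intro ext) (simp add: CS_eq subsp_0[OF FA_subsp])
    moreover have "?gc m 0 = Gr (\<lambda>_. 0)" by (auto simp: gr_class_Gr intro: arg_cong[of _ _ Gr])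
    moreover have "Gr (\<lambda>_. 0) = gr_class chi I tau c 0 (cl 0)"
      by (auto simp: gr_class_Gr intro: arg_cong[of _ _ Gr])
    moreover have "0 \<in> Q 0" using Qscal[of 0] by simp
    ultimately show ?thesis using FA_mono[of m "Suc m" x] that by (simp add: Q_def)
  qed
  have Qs: "subsp (Q m)" for m
  proof (rule subspI)
    show "0 \<in> Q m" by (intro Qlow subsp_0[OF FA_subsp])
    show "x + y \<in> Q m" if "x \<in> Q m" "y \<in> Q m" for x y
      using that ring_hom_add[OF f, of "?gc m x" "?gc m y"] ring_hom_add[OF g, of "?gc m x" "?gc m y"]
        gr_class_carrier subsp_add[OF FA_subsp, of x "Suc m" y]
      by (simp add: Q_def add)
    show "smul k x \<in> Q m" if "x \<in> Q m" for k x
      using Qmult[OF Qscal[of k] that] by (simp flip: smul_mult_left)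
  qed
  have QB: "Bw w \<in> Q (wlen w)" for w
  proof (induction w rule: word_induct)
    case zero
    show ?case using Qscal[of 1] by simp
  next
    case (step i w)
    have "Bg i \<in> Q 1"
      using B[of i] FA_Bw[of "var i" "Suc 1"] by (simp add: Q_def B_gen_cl Bw_var)
    from Qmult[OF this step] show ?case by (simp add: Bw_step)
  qed
  have QKB: "KB (m, w) \<in> Q n" if "m \<in> Lat" "wlen w < Suc n" for m w n
  proof (cases "wlen w = n")
    case True
    then show ?thesis
      using Qmult[OF Q0[of "bas m"] QB[of w]] that by (simp add: KB_simp)
  next
    case False
    then show ?thesis using that by (intro Qlow FA_KB) auto
  qed
  have QA: "x \<in> Q n" if x: "x \<in> FA (Suc n)" for x n
  proof -
    obtain s where s: "s \<in> SS (Suc n)" "x \<simeq>\<^sub>J lin KB s" using x by (auto simp: FA_iff)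
    have "lin KB s \<in> Q n"
      using s(1) by (intro lin_mem Qs) (auto simp: SS_def intro: QKB)
    moreover have "cl x = cl (lin KB s)" using s(2) by (simp add: cl_eq)
    ultimately show ?thesis using x by (simp add: Q_def)
  qed
  obtain a where a: "adm a" "x = Gr a" using x by (auto simp: gB_carrier)
  then obtain N where N: "\<And>m. N \<le> m \<Longrightarrow> a m = 0" by (auto simp: adm_def)
  have aF: "a m \<in> FA (Suc m)" for m using a by (simp add: adm_def)
  have ind: "Gr (\<lambda>m. if m < n then a m else 0) \<in> carrier gB \<and>
      f (Gr (\<lambda>m. if m < n then a m else 0)) = g (Gr (\<lambda>m. if m < n then a m else 0))" for n
  proof (induction n)
    case 0
    have "Gr (\<lambda>m. if m < 0 then a m else 0) = ?gc 0 0"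
      unfolding gr_class_Gr by (rule arg_cong[of _ _ Gr]) auto
    then show ?case
      using QA[OF subsp_0[OF FA_subsp], of 0] gr_class_carrier[OF subsp_0[OF FA_subsp], of 0] by (simp add: Q_def)
  next
    case (Suc n)
    have e: "Gr (\<lambda>m. if m < Suc n then a m else 0) =
        Gr (\<lambda>m. if m < n then a m else 0) \<oplus>\<^bsub>gB\<^esub> ?gc n (a n)"
      unfolding gr_class_Gr gB_add by (rule arg_cong[of _ _ Gr]) auto
    have "adm (\<lambda>m. if m < Suc n then a m else 0)"
      using aF subsp_0[OF FA_subsp] by (auto simp: adm_def intro!: exI[of _ "Suc n"])
    then have c: "Gr (\<lambda>m. if m < Suc n then a m else 0) \<in> carrier gB"
      by (auto simp: gB_carrier)
    have c': "?gc n (a n) \<in> carrier gB" by (rule gr_class_carrier) (rule aF)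
    have "f (?gc n (a n)) = g (?gc n (a n))" using QA[OF aF[of n]] by (simp add: Q_def)
    then show ?case
      using c Suc ring_hom_add[OF f _ c'] ring_hom_add[OF g _ c'] unfolding e by simp
  qed
  have "(\<lambda>m. if m < N then a m else 0) = a"
    by (rule ext) (simp add: N)
  then show ?thesis
    using ind[of N] by (simp only: a(2))
qed

lemma gB_add_closed: "x \<in> carrier gB \<Longrightarrow> y \<in> carrier gB \<Longrightarrow> x \<oplus>\<^bsub>gB\<^esub> y \<in> carrier gB"
  by (auto simp: gB_carrier gB_add adm_add)

lemma gB_mult_closed:
  assumes xy: "x \<in> carrier gB" "y \<in> carrier gB"
  shows "x \<otimes>\<^bsub>gB\<^esub> y \<in> carrier gB"
proof -
  obtain a b where ab: "adm a" "adm b" "x = Gr a" "y = Gr b" using xy by (auto simp: gB_carrier)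
  then obtain N N' where N: "\<And>m. N \<le> m \<Longrightarrow> a m = 0" "\<And>m. N' \<le> m \<Longrightarrow> b m = 0"
    by (auto simp: adm_def)
  have F: "a m \<in> FA (Suc m)" "b m \<in> FA (Suc m)" for m using ab by (auto simp: adm_def)
  have "adm (\<lambda>m. \<Sum>l\<le>m. a l * b (m - l))"
    unfolding adm_def
  proof (intro conjI allI exI[of _ "N + N'"] impI)
    fix m
    show "(\<Sum>l\<le>m. a l * b (m - l)) \<in> FA (Suc m)"
    proof (rule subsp_sum[OF FA_subsp])
      fix l assume "l \<in> {..m}"
      then show "a l * b (m - l) \<in> FA (Suc m)"
        using FA_mult[OF F(1)[of l] F(2)[of "m - l"]] by simp
    qed
    show "(\<Sum>l\<le>m. a l * b (m - l)) = 0" if "N + N' \<le> m"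
    proof (rule sum.neutral, rule ballI)
      fix l
      have "N \<le> l \<or> N' \<le> m - l" using that by auto
      then show "a l * b (m - l) = 0" using N by auto
    qed
  qed
  then show ?thesis
    using gB_mult[of a b] F ab by (auto simp: gB_carrier)
qed

lemma gB_one_closed: "\<one>\<^bsub>gB\<^esub> \<in> carrier gB"
  unfolding gB_one by (rule gr_class_carrier) (rule one_FA)

lemma restrict_Phi_hom: "restrict Phi (carrier gB) \<in> ring_hom gB HU"
  using gB_add_closed gB_mult_closed gB_one_closed ring_hom_add[OF Phi_hom] ring_hom_mult[OF Phi_hom]
    ring_hom_one[OF Phi_hom] ring_hom_closed[OF Phi_hom]
  by (intro ring_hom_memI) auto

lemma gr_map_eq: "gr_map chi I tau c = restrict Phi (carrier gB)"
  unfolding gr_map_def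
proof (rule the_equality)
  have gc: "gr_class chi I tau c 1 (B_gen chi I tau c i) \<in> carrier gB" for i
    using gr_class_carrier[of "Bg i" 1] FA_Bw[of "var i" "Suc 1"] by (simp add: B_gen_cl Bw_var)
  have gc0: "gr_class chi I tau c 0 h \<in> carrier gB" if "h \<in> H_theta chi I tau" for h
    using that gr_class_carrier[OF FA_Kp[of _ 0]] by (auto simp: H_theta_eq)
  show "restrict Phi (carrier gB) \<in> extensional (carrier gB) \<and>
      restrict Phi (carrier gB) \<in> ring_hom gB HU \<and>
      (\<forall>i. restrict Phi (carrier gB) (gr_class chi I tau c 1 (B_gen chi I tau c i)) = U_F chi I i) \<and>
      (\<forall>h\<in>H_theta chi I tau. restrict Phi (carrier gB) (gr_class chi I tau c 0 h) = h)"
  proof (intro conjI allI ballI)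
    show "restrict Phi (carrier gB) \<in> ring_hom gB HU" by (rule restrict_Phi_hom)
  qed (use gc gc0 in \<open>simp_all add: Phi_B Phi_H del: One_nat_def\<close>)
  fix phi
  assume p: "phi \<in> extensional (carrier gB) \<and> phi \<in> ring_hom gB HU \<and>
      (\<forall>i. phi (gr_class chi I tau c 1 (B_gen chi I tau c i)) = U_F chi I i) \<and>
      (\<forall>h\<in>H_theta chi I tau. phi (gr_class chi I tau c 0 h) = h)"
  show "phi = restrict Phi (carrier gB)"
  proof (rule extensionalityI[of _ "carrier gB"])
    fix x assume "x \<in> carrier gB"
    then show "phi x = restrict Phi (carrier gB) x"
      using gr_hom_eq[of phi Phi x] p Phi_hom Phi_B Phi_H by simp
  qed (use p in simp_all)
qed

text \<open>The image of \<open>T n\<close> lies in level -n, so projecting to levels separates the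
  summands of Phi g - Phi h, and each degree can be treated by \<open>lead_inj\<close>.\<close>

lemma Phi_inj:
  assumes inj: "\<And>n. lead_inj n"
  shows "inj_on Phi (carrier gB)"
proof (rule inj_onI)
  fix g h assume "g \<in> carrier gB" "h \<in> carrier gB" and eq: "Phi g = Phi h"
  then obtain a b where ab: "adm a" "adm b" "g = Gr a" "h = Gr b" by (auto simp: gB_carrier)
  then obtain N N' where N: "\<And>m. N \<le> m \<Longrightarrow> a m = 0" "\<And>m. N' \<le> m \<Longrightarrow> b m = 0"
    by (auto simp: adm_def)
  let ?M = "max N N'"
  let ?d = "\<lambda>m. a m - b m"
  have "cl (\<Sum>m<?M. T m (a m)) = cl (\<Sum>m<?M. T m (b m))"
    using eq N Phi_Gr[of ?M a] Phi_Gr[of ?M b] ab by simp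
  then have J: "(\<Sum>m<?M. T m (?d m)) \<in> J"
    by (simp add: cl_eq cg_def linmap_diff[OF linmap_T] sum_subtractf)
  have "?d n \<in> FA n" for n
  proof (cases "n < ?M")
    case False
    then show ?thesis using N subsp_0[OF FA_subsp] by simp
  next
    case True
    have rr: "res (lv n) (res (lv m) x) = (if m = n then res (lv n) x else 0)" for m x
      by (rule poly_mapping_eqI) (auto simp: lv_def split: if_splits)
    have "res (lv n) (theta (\<Sum>m<?M. T m (?d m))) = (\<Sum>m<?M. if m = n then res (lv n) (theta (?d n)) else 0)"
      unfolding linmap_sum[OF linmap_theta] linmap_sum[OF linmap_res] theta_T rr
      by (rule sum.cong) auto
    also have "\<dots> = theta (T n (?d n))"
      using True by (simp add: theta_T)
    finally have E: "res (lv n) (theta (\<Sum>m<?M. T m (?d m))) = theta (T n (?d n))" .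
    have "theta (T n (?d n)) \<in> Nsub"
      unfolding E[symmetric] using J by (intro Nsub_lv) (simp only: J_iff)
    then have "T n (?d n) \<in> J" by (simp add: J_iff)
    moreover have "?d n \<in> FA (Suc n)"
      using ab by (intro subsp_diff FA_subsp) (auto simp: adm_def)
    ultimately show ?thesis using inj by (simp add: lead_inj_def)
  qed
  then show "g = h" unfolding ab Gr_def by (intro ext) (simp add: CS_eq)
qed

lemma Phi_inj_imp:
  assumes inj: "inj_on Phi (carrier gB)"
  shows "lead_inj n"
  unfolding lead_inj_def
proof (intro ballI impI)
  fix x assume x: "x \<in> FA (Suc n)" "T n x \<in> J"
  have "Phi (gr_class chi I tau c n (cl x)) = Phi (gr_class chi I tau c n (cl 0))"
    using x by (simp add: Phi_gr_class cl_eq cg_def linmap_0[OF linmap_T])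
  then have "gr_class chi I tau c n (cl x) = gr_class chi I tau c n (cl 0)"
    using inj_onD[OF inj] gr_class_carrier x subsp_0[OF FA_subsp] by blast
  from fun_cong[OF this, of n] show "x \<in> FA n"
    by (simp add: gr_class_Gr Gr_def CS_eq)
qed

text \<open>K_m F_w is the leading term of K_m B_w, so an element of the target is split by word
  length and lifted.\<close>

lemma Phi_surj: "Phi ` carrier gB = carrier HU"
proof
  show "Phi ` carrier gB \<subseteq> carrier HU"
    using ring_hom_closed[OF Phi_hom] by blast
  show "carrier HU \<subseteq> Phi ` carrier gB"
  proof
    fix y assume "y \<in> carrier HU"
    then obtain s where s: "keys s \<subseteq> Lat \<times> UNIV" "y = cl (lin KF s)" by (auto simp: HU_carrier)
    let ?t = "\<lambda>m. res (\<lambda>k. wlen (snd k) = m) s"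
    let ?a = "\<lambda>m. lin KB (?t m)"
    have fin: "finite ((\<lambda>k. wlen (snd k)) ` keys s)" by simp
    then obtain N where N: "(\<lambda>k. wlen (snd k)) ` keys s \<subseteq> {..<N}"
      by (auto simp: finite_nat_iff_bounded)
    have a0: "?a m = 0" if "N \<le> m" for m
    proof -
      have "?t m = 0" by (rule res_none) (use N that in fastforce)
      then show ?thesis by simp
    qed
    have t: "?t m \<in> SS (Suc m)" for m
      using s by (auto simp: SS_def keys_res)
    have "adm ?a"
      unfolding adm_def using a0 t FA_iff cg_refl by blast
    moreover have "Phi (Gr ?a) = y"
    proof -
      have "T m (?a m) = lin KF (?t m)" for m
      proof -
        have "res (\<lambda>(m', w). wlen w = m) (?t m) = ?t m"
          by (rule res_all) (auto simp: keys_res)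
        then show ?thesis by (simp add: T_lin_KB[OF t])
      qed
      then have "Phi (Gr ?a) = cl (\<Sum>m<N. lin KF (?t m))"
        using Phi_Gr[of N ?a] a0 by simp
      also have "(\<Sum>m<N. lin KF (?t m)) = lin KF (\<Sum>m<N. ?t m)" by (simp add: lin_sum)
      also have "(\<Sum>m<N. ?t m) = s"
        by (rule sum_res_partition[symmetric]) (use N in auto)
      finally show ?thesis by (simp add: s)
    qed
    ultimately show "y \<in> Phi ` carrier gB" by (auto simp: gB_carrier)
  qed
qed

lemma gr_map_iso_iff: "gr_map chi I tau c \<in> ring_iso gB HU \<longleftrightarrow> (\<forall>n. lead_inj n)"
proof -
  have "gr_map chi I tau c \<in> ring_iso gB HU \<longleftrightarrow> bij_betw Phi (carrier gB) (carrier HU)"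
    using restrict_Phi_hom by (simp add: gr_map_eq ring_iso_def bij_betw_restrict_eq)
  also have "\<dots> \<longleftrightarrow> inj_on Phi (carrier gB)"
    using Phi_surj by (simp add: bij_betw_def)
  also have "\<dots> \<longleftrightarrow> (\<forall>n. lead_inj n)"
    using Phi_inj Phi_inj_imp by blast
  finally show ?thesis .
qed

lemma gr_map_iso_N_rel: "gr_map chi I tau c \<in> ring_iso gB HU \<longleftrightarrow> N_rel chi I tau c = UNIV"
  unfolding gr_map_iso_iff lead_inj_relB using N_rel_iff by auto


section \<open>The obstruction and the relations of \<open>B\<close>\<close>


lemma theta_lin_Bw: "theta (lin Bw p) = lin thB p"
  by (simp add: linmap_lin_apply[OF linmap_theta] thB_def[abs_def])

lemma mhomogeneous_wlen: "mhomogeneous l p \<Longrightarrow> w \<in> keys p \<Longrightarrow> int (wlen w) = height (zvec l)"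
  using height_zdeg[of w] by (simp add: mhomogeneous_def)

lemma Bw_ideal_FA:
  assumes "kappa_below n" "p \<in> I" "mhomogeneous l p" "height (zvec l) = int n" "klin p = 0"
  shows "lin Bw p \<in> FA n"
proof -
  have "lin Xw p \<in> Nsub"
    using Xp_homogeneous_ideal[OF assms(1-4)] assms(5) by simp
  moreover have "lin Xw p - lin thB p \<in> FM n"
    using mhomogeneous_wlen[OF assms(3)] assms(4) by (intro Xp_FM) simp
  then have "- (lin Xw p - lin thB p) \<in> FM n"
    by (rule subsp_uminus[OF FM_subsp])
  ultimately show ?thesis
    unfolding FA_def theta_lin_Bw
    by (intro CollectI bexI[of _ "- (lin Xw p - lin thB p)"]) (simp_all add: theta_lin_Bw)
qed

lemma kappa_below_mono: "kappa_below n \<Longrightarrow> m \<le> n \<Longrightarrow> kappa_below m"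
  unfolding kappa_below_def by (meson less_le_trans of_nat_mono)

lemma kappa_below_relB: "kappa_below (Suc n) \<Longrightarrow> relB n"
  unfolding relB_def
proof (intro ballI impI)
  fix p assume n: "kappa_below (Suc n)" and p: "p \<in> I" "thomogeneous n p"
  let ?q = "\<lambda>l. res (\<lambda>w. wdeg w = l) p"
  have "lin Bw (?q l) \<in> FA n" if "l \<in> wdeg ` keys p" for l
  proof (rule Bw_ideal_FA)
    show "kappa_below n" using kappa_below_mono[OF n] by simp
    show q: "?q l \<in> I" "mhomogeneous l (?q l)"
      using p I_hpart by (auto simp: mhomogeneous_def keys_res)
    from that have "\<exists>w\<in>keys p. wdeg w = l" by auto
    then obtain w where "w \<in> keys p" "wdeg w = l" by blast
    then show h: "height (zvec l) = int n"
      using p height_zdeg[of w] by (auto simp: thomogeneous_def)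
    show "klin (?q l) = 0"
      using n q h by (simp add: kappa_below_def)
  qed
  then have "lin Bw (\<Sum>l\<in>wdeg ` keys p. ?q l) \<in> FA n"
    unfolding lin_sum by (intro subsp_sum FA_subsp)
  then show "lin Bw p \<in> FA n"
    using sum_res_partition[of "wdeg ` keys p" p wdeg] by simp
qed

lemma Xw_FM: "wlen w \<le> n \<Longrightarrow> Xw w \<in> FM (Suc n)"
proof -
  assume w: "wlen w \<le> n"
  have "Xw w - thB w \<in> FM (Suc n)"
    using FM_mono[of "wlen w" "Suc n"] Xw_thB[of w] w by auto
  moreover have "thB w \<in> FM (Suc n)" using w by (intro thB_FM) simp
  ultimately show ?thesis
    using subsp_add[OF FM_subsp, of "Xw w - thB w" "Suc n" "thB w"] by simp
qed

text \<open>Applied twice: with k = n and x built from a dropping p(B), to reach a contradiction,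
  and with k = n + 1 and x = X_p, to put K_(- l) into \<open>B\<close>.\<close>

lemma obstruction_FA:
  assumes "kappa_below n" "p \<in> I" "mhomogeneous l p" "height (zvec l) = int n" "klin p \<noteq> 0"
    and "lin Xw p - x \<in> Nsub" "x \<in> FM k"
  shows "Kp (- zvec l) \<in> FA k"
proof -
  have "smul (klin p) (bas (0, - zvec l, 0)) - x \<in> Nsub"
    using subsp_diff[OF Nsub_subsp assms(6) Xp_homogeneous_ideal[OF assms(1-4)]]
    by (simp add: algebra_simps)
  from subsp_smul[OF Nsub_subsp this, of "inverse (klin p)"]
  have "theta (Kp (- zvec l)) - smul (inverse (klin p)) x \<in> Nsub"
    using assms(5) by (simp add: theta_Kp smul_diff)
  then show ?thesis
    using subsp_smul[OF FM_subsp assms(7)] by (auto simp: FA_def)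
qed

lemma bas_notin_Nsub: "bas (0, m, 0) \<notin> Nsub"
proof
  assume "bas (0, m, 0) \<in> Nsub"
  from prF_Nsub[OF this, of m] have "bas 0 \<in> I" by (simp add: prF_def)
  from I_length[OF this, of 0] show False by simp
qed

text \<open>K_m has only level 0, so its leading term in every degree n > 0 vanishes, and
  injectivity of leading terms lowers the step down to \<open>H_theta\<close>. There
  \<open>prF m\<close> compares weights: if m were not in \<open>Lat\<close>, the constant 1 would
  lie in \<open>I\<close>.\<close>

lemma Kp_FA_Lat:
  assumes "\<And>j. j < n \<Longrightarrow> lead_inj j" "Kp m \<in> FA n"
  shows "m \<in> Lat"
proof -
  have "Kp m \<in> FA (Suc 0)"
    using assms
  proof (induction n)
    case 0
    then show ?case using FA_mono[of 0 "Suc 0"] by simp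
  next
    case (Suc n)
    show ?case
    proof (cases "n = 0")
      case True
      then show ?thesis using Suc.prems by simp
    next
      case False
      have "res (lv n) (bas (0, m, 0)) = (0 :: ('k, 'i) pbw)"
        using False by (simp add: res_single lv_def)
      then have "T n (Kp m) \<in> J"
        by (simp add: T_def theta_Kp linmap_0[OF linmap_rho] subsp_0[OF J_subsp])
      then have "Kp m \<in> FA n"
        using Suc.prems by (simp add: lead_inj_def)
      then show ?thesis using Suc by simp
    qed
  qed
  then obtain s where s: "s \<in> SS (Suc 0)" "Kp m \<simeq>\<^sub>J lin KB s" by (auto simp: FA_iff)
  have "thH s = lin (\<lambda>(m', w). bas (0, m', 0)) s"
    unfolding thH_def by (rule lin_cong) (use s in \<open>auto simp: SS_def thB_0 opK_bas\<close>)
  then have N: "bas (0, m, 0) - lin (\<lambda>(m', w). bas (0, m', 0)) s \<in> Nsub"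
    using s(2) by (simp add: cg_iff theta_Kp theta_lin_KB)
  show ?thesis
  proof (rule ccontr)
    assume "m \<notin> Lat"
    then have "prF m (lin (\<lambda>(m', w). bas (0, m', 0)) s) = lin (\<lambda>k. 0) s"
      unfolding linmap_lin_apply[OF prF_linmap]
      by (intro lin_cong) (use s(1) in \<open>auto simp: SS_def prF_def\<close>)
    then have "bas 0 \<in> I"
      using prF_Nsub[OF N, of m] by (simp add: linmap_diff[OF prF_linmap]) (simp add: prF_def)
    from I_length[OF this, of 0] show False by simp
  qed
qed

lemma klin_nonzero_height:
  assumes "p \<in> I" "mhomogeneous l p" "klin p \<noteq> 0"
  shows "2 \<le> height (zvec l)"
proof -
  have "keys p \<noteq> {}" using assms(3) by (auto simp: klin_def)
  then obtain w where "w \<in> keys p" by blast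
  then show ?thesis
    using I_length[OF assms(1)] mhomogeneous_wlen[OF assms(2)] by fastforce
qed

text \<open>The indices fit \<open>kappa_below_relB\<close>: the drop in degrees below n controls
  kappa in the same degrees.\<close>

lemma relB_kappa_below: "(\<And>j. j < n \<Longrightarrow> relB j) \<Longrightarrow> kappa_below n"
proof (induction n)
  case 0
  have "klin p = 0" if "p \<in> I" "mhomogeneous l p" "height (zvec l) < 0" for p l
    using klin_nonzero_height[OF that(1,2)] that(3) by fastforce
  then show ?case by (simp add: kappa_below_def)
next
  case (Suc n)
  then have n: "kappa_below n" by simp
  show ?case
    unfolding kappa_below_def
  proof (intro ballI allI impI)
    fix p l assume p: "p \<in> I" "mhomogeneous l p" "height (zvec l) < int (Suc n)"
    show "klin p = 0"
    proof (cases "height (zvec l) < int n")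
      case True
      then show ?thesis using n p by (simp add: kappa_below_def)
    next
      case False
      with p have h: "height (zvec l) = int n" by simp
      show ?thesis
      proof (rule ccontr)
        assume k: "klin p \<noteq> 0"
        have len: "wlen w = n" if "w \<in> keys p" for w
          using mhomogeneous_wlen[OF p(2) that] h by simp
        have "lin Bw p \<in> FA n"
          using Suc.prems[of n] p len by (simp add: relB_def thomogeneous_def)
        then obtain y where y: "y \<in> FM n" "lin thB p - y \<in> Nsub"
          by (auto simp: FA_def theta_lin_Bw)
        have "lin Xw p - lin thB p \<in> FM n"
          by (rule Xp_FM) (simp add: len)
        from subsp_add[OF FM_subsp this y(1)]
        have "lin Xw p - lin thB p + y \<in> FM n" .
        moreover have "lin Xw p - (lin Xw p - lin thB p + y) \<in> Nsub"
          using y(2) by simp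
        ultimately have "Kp (- zvec l) \<in> FA n"
          by (intro obstruction_FA[OF n p(1,2) h k])
        then have "- zvec l \<in> Lat"
          by (rule Kp_FA_Lat[rotated]) (use Suc.prems lead_inj_relB in auto)
        \<comment> \<open>Words in relations have length at least two, while weights in
          \<open>Lat\<close> have height zero.\<close>
        from height_Lat[OF this] have "height (zvec l) = 0"
          by (simp add: height_uminus)
        with klin_nonzero_height[OF p(1,2) k] show False by simp
      qed
    qed
  qed
qed

lemma all_relB_iff: "(\<forall>n. relB n) \<longleftrightarrow> (\<forall>n. kappa_below n)"
  using kappa_below_relB relB_kappa_below by blast

lemma FA_B_alg: "x \<in> FA n \<Longrightarrow> cl x \<in> B_alg chi I tau c"
proof -
  let ?S = "H_theta chi I tau \<union> range (B_gen chi I tau c)"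
  have "Kp m \<in> presub ?S" if "m \<in> Lat" for m
    using that by (intro presub_incl UnI1) (auto simp: H_theta_eq intro!: image_eqI[of _ _ "bas m"])
  moreover have "Bw w \<in> presub ?S" for w
  proof (induction w rule: word_induct)
    case zero
    show ?case by (simp add: presub_one)
  next
    case (step i w)
    have "Bg i \<in> presub ?S"
      by (rule presub_incl) (simp add: B_gen_cl[symmetric])
    from presub_mult[OF this step] show ?case by (simp add: Bw_step)
  qed
  ultimately have KB: "KB (m, w) \<in> presub ?S" if "m \<in> Lat" for m w
    using that by (simp add: KB_simp presub_mult)
  assume "x \<in> FA n"
  then obtain s where s: "s \<in> SS n" "x \<simeq>\<^sub>J lin KB s" by (auto simp: FA_iff)
  have "lin KB s \<in> presub ?S"
    using s(1) by (intro lin_mem presub_subsp) (auto simp: SS_def intro: KB)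
  then have "x \<in> presub ?S" by (rule presub_cg) (rule cg_sym[OF s(2)])
  then show ?thesis by (simp add: presub_def B_alg_def)
qed

lemma exists_Kp_B_alg:
  assumes "\<not> (\<forall>n. relB n)"
  shows "\<exists>l :: nat ^ 'i. l \<noteq> 0 \<and> cl (Kp (- zvec l)) \<in> B_alg chi I tau c"
proof -
  obtain n where "\<not> kappa_below n" using assms all_relB_iff by blast
  \<comment> \<open>Minimality gives \<open>kappa_below j\<close> for the height j < k of the
    offending p, as \<open>obstruction_FA\<close> requires.\<close>
  define k where "k = (LEAST n. \<not> kappa_below n)"
  have k: "\<not> kappa_below k" and below: "\<And>j. j < k \<Longrightarrow> kappa_below j"
    unfolding k_def using \<open>\<not> kappa_below n\<close> LeastI not_less_Least by metis+
  obtain p l where p: "p \<in> I" "mhomogeneous l p" "height (zvec l) < int k" "klin p \<noteq> 0"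
    using k by (auto simp: kappa_below_def)
  note h = klin_nonzero_height[OF p(1,2,4)]
  define j where "j = nat (height (zvec l))"
  have j: "height (zvec l) = int j" using h by (simp add: j_def)
  have "lin Xw p \<in> FM (Suc j)"
    using mhomogeneous_wlen[OF p(2)] j by (intro lin_mem FM_subsp Xw_FM) simp
  then have "Kp (- zvec l) \<in> FA (Suc j)"
    using obstruction_FA[OF below[of j] p(1,2) j p(4), of "lin Xw p" "Suc j"] p(3) j Nsub_0 by simp
  then have "cl (Kp (- zvec l)) \<in> B_alg chi I tau c" by (rule FA_B_alg)
  moreover have "l \<noteq> 0" using h by (auto simp: height_0)
  ultimately show ?thesis by blast
qed


section \<open>The group-like elements and the projections\<close>

text \<open>The order of factors chosen in \<open>Kp\<close> is immaterial in the commutative ring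
  \<open>U_H\<close>, so the ordered product represents the \<open>finprod\<close>.\<close>

lemma U_Kpow_cl: "U_Kpow chi I l = cl (Kp l)"
proof -
  interpret ring U by (rule ring_U)
  let ?R = "U\<lparr>carrier := U_H chi I\<rparr>"
  let ?f = "\<lambda>i. if 0 \<le> l $ i then U_K chi I i [^]\<^bsub>U\<^esub> nat (l $ i)
          else U_Kinv chi I i [^]\<^bsub>U\<^esub> nat (- (l $ i))"
  have pow: "cl x [^]\<^bsub>U\<^esub> n = cl (x ^ n)" for x and n :: nat
    by (induction n) (simp_all add: cl_one cl_mult power_commutes)
  have f: "?f i = cl (kz i (l $ i))" for i
    by (simp add: U_K_cl U_Kinv_cl pow kz_def)
  let ?P = "presub (range (U_K chi I) \<union> range (U_Kinv chi I))"
  have H: "cl x \<in> U_H chi I \<longleftrightarrow> x \<in> ?P" for x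
    by (simp add: presub_def U_H_def)
  have gen: "gK i \<in> ?P" "gL i \<in> ?P" for i
    by (auto intro!: presub_incl simp flip: U_K_cl U_Kinv_cl)
  have kzH: "cl (kz i n) \<in> U_H chi I" for i n
    unfolding H by (simp add: kz_def presub_power gen)
  have sub: "U_H chi I \<subseteq> carrier U"
    by (auto simp: U_H_eq U_carrier)
  have comm: "x \<otimes>\<^bsub>U\<^esub> y = y \<otimes>\<^bsub>U\<^esub> x" if "x \<in> U_H chi I" "y \<in> U_H chi I" for x y
  proof -
    from that obtain s t where st: "x = cl (lin Kp s)" "y = cl (lin Kp t)" by (auto simp: U_H_eq)
    have "lin Kp s * lin Kp t = lin (\<lambda>b. lin (\<lambda>a. Kp a * Kp b) s) t"
      unfolding linmap_lin_apply[OF linmap_times_right] linmap_lin_apply[OF linmap_times_left] by simp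
    also have "\<dots> \<simeq>\<^sub>J lin (\<lambda>b. lin (\<lambda>a. Kp b * Kp a) s) t"
    proof (intro cg_lin)
      fix a b
      show "Kp a * Kp b \<simeq>\<^sub>J Kp b * Kp a"
        using cg_trans[OF Kp_mult[of a b], of "Kp b * Kp a"] cg_sym[OF Kp_mult[of b a]]
        by (simp add: add.commute)
    qed
    also have "\<dots> = lin (\<lambda>a. lin (\<lambda>b. Kp b * Kp a) t) s"
      by (rule lin_swap)
    also have "\<dots> = lin Kp t * lin Kp s"
      unfolding linmap_lin_apply[OF linmap_times_right] linmap_lin_apply[OF linmap_times_left] by simp
    finally show ?thesis by (simp add: st cl_mult cl_eq)
  qed
  have closed: "x \<otimes>\<^bsub>U\<^esub> y \<in> U_H chi I" if "x \<in> U_H chi I" "y \<in> U_H chi I" for x y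
  proof -
    from that sub have "x \<in> range cl" "y \<in> range cl" unfolding U_carrier by blast+
    then obtain a b where ab: "x = cl a" "y = cl b" by blast
    with that have "a * b \<in> ?P" by (simp add: H presub_mult)
    then show ?thesis by (simp add: ab cl_mult H)
  qed
  have one: "\<one>\<^bsub>U\<^esub> \<in> U_H chi I"
    by (simp add: cl_one H presub_one)
  interpret R: comm_monoid ?R
  proof (rule comm_monoidI)
    fix x y z assume "x \<in> carrier ?R" "y \<in> carrier ?R" "z \<in> carrier ?R"
    then have xyz: "x \<in> U_H chi I" "y \<in> U_H chi I" "z \<in> U_H chi I" by simp_all
    then have c: "x \<in> carrier U" "y \<in> carrier U" "z \<in> carrier U" using sub by blast+
    show "x \<otimes>\<^bsub>?R\<^esub> y \<in> carrier ?R" using closed[OF xyz(1,2)] by simp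
    show "x \<otimes>\<^bsub>?R\<^esub> y \<otimes>\<^bsub>?R\<^esub> z = x \<otimes>\<^bsub>?R\<^esub> (y \<otimes>\<^bsub>?R\<^esub> z)" using m_assoc[OF c] by simp
    show "\<one>\<^bsub>?R\<^esub> \<otimes>\<^bsub>?R\<^esub> x = x" using l_one[OF c(1)] by simp
    show "x \<otimes>\<^bsub>?R\<^esub> y = y \<otimes>\<^bsub>?R\<^esub> x" using comm[OF xyz(1,2)] by simp
  qed (use one in simp)
  have "finprod ?R ?f (set xs) = cl (Kl xs l)" if "distinct xs" for xs
    using that
  proof (induction xs)
    case Nil
    then show ?case by (simp add: cl_one)
  next
    case (Cons a xs)
    then show ?case
      by (simp add: f kzH cl_mult R.finprod_insert Pi_def)
  qed
  from this[of idx] show ?thesis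
    unfolding U_Kpow_def Kp_def by (simp add: idx)
qed

lemma add_span_eq:
  assumes "\<And>s. s \<in> S \<Longrightarrow> \<exists>x. keys x \<subseteq> D \<and> s = cl (rho x)"
    and "\<And>k a. k \<in> D \<Longrightarrow> cl (smul a (rho (bas k))) \<in> S"
  shows "add_span U S = {cl (rho x) | x. keys x \<subseteq> D}"
proof
  interpret ring U by (rule ring_U)
  show "add_span U S \<subseteq> {cl (rho x) | x. keys x \<subseteq> D}"
  proof
    fix y assume "y \<in> add_span U S"
    then show "y \<in> {cl (rho x) | x. keys x \<subseteq> D}"
      unfolding add_span_def
    proof induction
      case one
      show ?case
        by (auto simp: cl_zero linmap_0[OF linmap_rho] intro!: exI[of _ 0])
    next
      case (incl h)
      then show ?case using assms(1) by blast
    next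
      case (inv h)
      then obtain x where x: "keys x \<subseteq> D" "h = cl (rho x)" using assms(1) by blast
      then have "inv\<^bsub>add_monoid U\<^esub> h = cl (rho (- x))"
        using cl_uminus[of "rho x"] by (simp add: a_inv_def linmap_uminus[OF linmap_rho])
      then show ?case using x by (intro CollectI exI[of _ "- x"]) simp
    next
      case (eng h1 h2)
      then obtain x y where "keys x \<subseteq> D" "h1 = cl (rho x)" "keys y \<subseteq> D" "h2 = cl (rho y)" by blast
      then show ?case
        using Poly_Mapping.keys_add[of x y]
        by (intro CollectI exI[of _ "x + y"]) (auto simp: cl_add linmap_add[OF linmap_rho])
    qed
  qed
  show "{cl (rho x) | x. keys x \<subseteq> D} \<subseteq> add_span U S"
  proof clarify
    fix x :: "('k, 'i) pbw" assume x: "keys x \<subseteq> D"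
    have "cl (\<Sum>k\<in>A. smul (coef x k) (rho (bas k))) \<in> add_span U S" if "A \<subseteq> keys x" for A
      using that
    proof (induction A rule: infinite_finite_induct)
      case (insert k A)
      have "cl (smul (coef x k) (rho (bas k))) \<in> add_span U S"
        unfolding add_span_def using insert.prems x by (intro generate.incl assms(2)) auto
      then show ?case
        using insert generate.eng[of _ "add_monoid U" S] by (simp add: add_span_def flip: cl_add)
    qed (use generate.one[of "add_monoid U" S] in \<open>simp_all add: add_span_def cl_zero\<close>)
    from this[of "keys x"] show "cl (rho x) \<in> add_span U S"
      using linmap_eq_lin[OF linmap_rho, of x] by (simp add: lin_def)
  qed
qed

text \<open>A decomposition exists by splitting the normal form along d. It is unique because
  \<open>Nsub\<close> is graded by d, so the normal forms of two decompositions agree componentwise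
  modulo \<open>Nsub\<close>.\<close>

lemma component_eq:
  assumes W: "\<And>j. W j = {cl (rho x) | x. keys x \<subseteq> {k. d k = j}}"
    and N: "\<And>x j. x \<in> Nsub \<Longrightarrow> res (\<lambda>k. d k = j) x \<in> Nsub"
  shows "component U W j (cl a) = cl (rho (res (\<lambda>k. d k = j) (theta a)))"
proof -
  interpret ring U by (rule ring_U)
  let ?r = "\<lambda>j. res (\<lambda>k. d k = j) (theta a)"
  let ?f = "\<lambda>j. cl (rho (?r j))"
  let ?D = "d ` keys (theta a)"
  have fW: "?f i \<in> W i" for i
    unfolding W by (auto simp: keys_res)
  have S: "{i. ?f i \<noteq> \<zero>\<^bsub>U\<^esub>} \<subseteq> ?D"
  proof
    fix i assume "i \<in> {i. ?f i \<noteq> \<zero>\<^bsub>U\<^esub>}"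
    then have "?r i \<noteq> 0" by (auto simp: cl_zero linmap_0[OF linmap_rho])
    then have "keys (?r i) \<noteq> {}" by simp
    then show "i \<in> ?D" by (auto simp: keys_res)
  qed
  then have fin: "finite {i. ?f i \<noteq> \<zero>\<^bsub>U\<^esub>}" by (rule finite_subset) simp
  have sum: "cl a = finsum U ?f {i. ?f i \<noteq> \<zero>\<^bsub>U\<^esub>}"
  proof -
    have "a \<simeq>\<^sub>J rho (theta a)" by (rule cg_sym) (rule rho_theta)
    also have "rho (theta a) = (\<Sum>i\<in>?D. rho (?r i))"
      using sum_res_partition[of ?D "theta a" d] by (simp flip: linmap_sum[OF linmap_rho])
    also have "\<dots> \<simeq>\<^sub>J (\<Sum>i\<in>?D. if ?f i \<noteq> \<zero>\<^bsub>U\<^esub> then rho (?r i) else 0)"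
      by (rule cg_sum) (auto simp: cl_zero cl_eq)
    also have "\<dots> = (\<Sum>i\<in>{i. ?f i \<noteq> \<zero>\<^bsub>U\<^esub>}. rho (?r i))"
      using S by (intro sum.mono_neutral_cong_right) auto
    finally show ?thesis
      using cl_sum[OF fin] by (simp add: cl_eq)
  qed
  show ?thesis
    unfolding component_def
  proof (rule the_equality)
    show "\<exists>f. (\<forall>i. f i \<in> W i) \<and> finite {i. f i \<noteq> \<zero>\<^bsub>U\<^esub>} \<and>
        cl a = finsum U f {i. f i \<noteq> \<zero>\<^bsub>U\<^esub>} \<and> cl (rho (?r j)) = f j"
      using fW fin sum by (intro exI[of _ ?f] conjI allI refl)
    fix y
    assume "\<exists>f. (\<forall>i. f i \<in> W i) \<and> finite {i. f i \<noteq> \<zero>\<^bsub>U\<^esub>} \<and>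
        cl a = finsum U f {i. f i \<noteq> \<zero>\<^bsub>U\<^esub>} \<and> y = f j"
    then obtain f where f: "\<And>i. f i \<in> W i" "finite {i. f i \<noteq> \<zero>\<^bsub>U\<^esub>}"
      "cl a = finsum U f {i. f i \<noteq> \<zero>\<^bsub>U\<^esub>}" "y = f j" by blast
    let ?S = "{i. f i \<noteq> \<zero>\<^bsub>U\<^esub>}"
    have "\<forall>i. \<exists>x. keys x \<subseteq> {k. d k = i} \<and> f i = cl (rho x)"
      using f(1) unfolding W by blast
    then obtain x where x: "\<And>i. keys (x i) \<subseteq> {k. d k = i}" "\<And>i. f i = cl (rho (x i))" by metis
    have "f = (\<lambda>i. cl (rho (x i)))" using x(2) by blast
    then have "cl a = cl (\<Sum>i\<in>?S. rho (x i))"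
      using f(2,3) cl_sum[of ?S "\<lambda>i. rho (x i)"] by simp
    then have "theta a - (\<Sum>i\<in>?S. x i) \<in> Nsub"
      by (simp add: cl_eq cg_iff linmap_sum[OF linmap_theta] theta_rho)
    from N[OF this, of j] have "?r j - (\<Sum>i\<in>?S. res (\<lambda>k. d k = j) (x i)) \<in> Nsub"
      by (simp add: res_diff linmap_sum[OF linmap_res])
    also have "(\<Sum>i\<in>?S. res (\<lambda>k. d k = j) (x i)) = (\<Sum>i\<in>?S. if i = j then x j else 0)"
    proof (rule sum.cong[OF refl])
      fix i
      show "res (\<lambda>k. d k = j) (x i) = (if i = j then x j else 0)"
        using x(1)[of i] by (auto intro!: res_all res_none)
    qed
    also have "\<dots> = (if j \<in> ?S then x j else 0)"
      using f(2) by (simp add: sum.delta)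
    finally have "rho (?r j) \<simeq>\<^sub>J rho (if j \<in> ?S then x j else 0)"
      using rho_Nsub by (simp add: cg_def flip: linmap_diff[OF linmap_rho])
    moreover have "cl (rho (if j \<in> ?S then x j else 0)) = f j"
      using x(2)[of j] by (auto simp: linmap_0[OF linmap_rho] cl_zero)
    ultimately show "y = cl (rho (?r j))"
      unfolding f(4) using cl_eq[of "rho (?r j)" "rho (if j \<in> ?S then x j else 0)"] by simp
  qed
qed

text \<open>Up to a nonzero scalar this is the product of the F_i K_i over the letters of w, with
  the K factors collected on the left.\<close>

definition GG :: "'i word \<Rightarrow> ('k, 'i gen) ncpoly" where
  "GG w = Kp (zdeg w) * Fw w"

lemma GG_mult: "GG a * GG b \<simeq>\<^sub>J smul (chi (zdeg b) (zdeg a)) (GG (a + b))"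
  unfolding GG_def zdeg_plus by (rule KF_mult)

lemma GG_0: "GG 0 = 1"
  unfolding GG_def Fw_0 by (simp add: Kp_0)

lemma GG_var: "gF i * gK i \<simeq>\<^sub>J smul (chi (alpha i) (alpha i)) (GG (var i))"
proof -
  have "gF i * gK i \<simeq>\<^sub>J gF i * Kp (alpha i)"
    by (intro cg_times_left Kp_alpha)
  also have "\<dots> \<simeq>\<^sub>J smul (chi (alpha i) (alpha i)) (GG (var i))"
    using Fw_Kp[of "var i" "alpha i"] unfolding GG_def Fw_var zdeg_var .
  finally show ?thesis .
qed

lemma G_minus_eq: "G_minus chi I = cl ` (lin GG ` {s. keys s \<subseteq> UNIV})"
  unfolding G_minus_def
proof (rule subalg_span)
  let ?S = "range (\<lambda>i. U_F chi I i \<otimes>\<^bsub>U\<^esub> U_K chi I i)"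
  show "\<exists>k. \<exists>d\<in>UNIV. GG a * GG b \<simeq>\<^sub>J smul k (GG d)" for a b
    using GG_mult by blast
  show "1 \<in> range GG" using GG_0 by (metis rangeI)
  show "?S \<subseteq> cl ` lin GG ` {s. keys s \<subseteq> UNIV}"
  proof (rule image_subsetI)
    fix i
    show "U_F chi I i \<otimes>\<^bsub>U\<^esub> U_K chi I i \<in> cl ` lin GG ` {s. keys s \<subseteq> UNIV}"
      unfolding U_F_cl U_K_cl cl_mult
      by (rule cl_span_memI[where a = "var i" and k = "chi (alpha i) (alpha i)"]) (simp_all add: GG_var)
  qed
  have smul_cg: "y \<simeq>\<^sub>J smul (inverse k) x" if "x \<simeq>\<^sub>J smul k y" "k \<noteq> 0" for x y k
    using cg_smul[OF that(1), of "inverse k"] that(2) by (simp add: cg_sym)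
  show "GG a \<in> presub ?S" for a
  proof (induction a rule: word_induct)
    case zero
    show ?case by (simp add: GG_0 presub_one)
  next
    case (step i w)
    have "gF i * gK i \<in> presub ?S"
      by (rule presub_incl) (auto simp: U_F_cl U_K_cl cl_mult)
    then have "GG (var i) \<in> presub ?S"
      using presub_cg[OF subsp_smul[OF presub_subsp] cg_sym[OF smul_cg[OF GG_var]]] by simp
    from presub_mult[OF this step] show ?case
      using presub_cg[OF subsp_smul[OF presub_subsp] cg_sym[OF smul_cg[OF GG_mult]]] by simp
  qed
qed

lemma lin3:
  fixes e k f :: "'x \<Rightarrow> ('k, 'i gen) ncpoly"
  shows "lin e p * x * lin f q = lin (\<lambda>a. lin (\<lambda>b. e a * x * f b) q) p"
proof -
  have "lin e p * x = lin (\<lambda>a. e a * x) p"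
    by (rule linmap_lin_apply[OF linmap_times_right])
  then have "lin e p * x * lin f q = lin (\<lambda>a. e a * x * lin f q) p"
    by (simp add: linmap_lin_apply[OF linmap_times_right])
  also have "\<dots> = lin (\<lambda>a. lin (\<lambda>b. e a * x * f b) q) p"
    by (simp add: linmap_lin_apply[OF linmap_times_left])
  finally show ?thesis .
qed

text \<open>Origin of the degree m - v: the subspace U^+ K_l G^- is spanned by the E_u K_m F_v with
  m - deg v = l.\<close>

lemma Ew_GG: "Ew u * Kp l * GG v \<simeq>\<^sub>J rho (bas (u, l + zdeg v, v))"
proof -
  have "Ew u * Kp l * GG v = Ew u * (Kp l * Kp (zdeg v)) * Fw v"
    by (simp add: GG_def mult.assoc)
  also have "\<dots> \<simeq>\<^sub>J Ew u * Kp (l + zdeg v) * Fw v"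
    by (intro cg_times_left cg_times_right Kp_mult)
  finally show ?thesis by (simp only: rho_bas)
qed

lemma proj_P_cl: "proj_P chi I l (cl a) = cl (rho (res (\<lambda>(u, m, v). m - zdeg v = l) (theta a)))"
proof -
  let ?d = "\<lambda>(u :: 'i word, m, v). m - zdeg v"
  have "proj_P chi I l (cl a) = cl (rho (res (\<lambda>k. ?d k = l) (theta a)))"
    unfolding proj_P_def
  proof (rule component_eq)
    fix l
    let ?S = "{x \<otimes>\<^bsub>U\<^esub> U_Kpow chi I l \<otimes>\<^bsub>U\<^esub> y | x y. x \<in> U_plus chi I \<and> y \<in> G_minus chi I}"
    show "add_span U ?S = {cl (rho x) | x. keys x \<subseteq> {k. ?d k = l}}"
    proof (rule add_span_eq)
      fix s assume "s \<in> ?S"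
      then obtain p q where s: "s = cl (lin Ew p * Kp l * lin GG q)"
        by (auto simp: U_plus_eq G_minus_eq U_Kpow_cl cl_mult)
      have "lin Ew p * Kp l * lin GG q = lin (\<lambda>u. lin (\<lambda>v. Ew u * Kp l * GG v) q) p"
        by (rule lin3)
      also have "\<dots> \<simeq>\<^sub>J lin (\<lambda>u. lin (\<lambda>v. rho (bas (u, l + zdeg v, v))) q) p"
        by (intro cg_lin Ew_GG)
      also have "\<dots> = rho (lin (\<lambda>u. lin (\<lambda>v. bas (u, l + zdeg v, v)) q) p)"
        by (simp add: linmap_lin_apply[OF linmap_rho])
      finally have "s = cl (rho (lin (\<lambda>u. lin (\<lambda>v. bas (u, l + zdeg v, v)) q) p))"
        by (simp add: s cl_eq)
      moreover have "lin (\<lambda>u. lin (\<lambda>v. bas (u, l + zdeg v, v)) q) p \<in> {x :: ('k, 'i) pbw. keys x \<subseteq> {k. ?d k = l}}"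
        by (intro lin_mem subsp_keys) simp
      ultimately show "\<exists>x. keys x \<subseteq> {k. ?d k = l} \<and> s = cl (rho x)" by blast
    next
      fix k a assume "k \<in> {k. ?d k = l}"
      then obtain u m v where k: "k = (u, m, v)" "m = l + zdeg v" by (cases k) auto
      have "smul a (rho (bas k)) \<simeq>\<^sub>J smul a (Ew u * Kp l * GG v)"
        unfolding k by (intro cg_smul cg_sym[OF Ew_GG])
      then have "cl (smul a (rho (bas k))) = cl (smul a (Ew u)) \<otimes>\<^bsub>U\<^esub> U_Kpow chi I l \<otimes>\<^bsub>U\<^esub> cl (GG v)"
        by (simp add: cl_eq U_Kpow_cl cl_mult smul_mult_left)
      moreover have "cl (smul a (Ew u)) \<in> U_plus chi I"
        unfolding U_plus_eq by (rule cl_span_memI[where k = a and a = u]) simp_all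
      moreover have "cl (GG v) \<in> G_minus chi I"
        unfolding G_minus_eq by (rule cl_span_memI[where k = 1 and a = v]) simp_all
      ultimately show "cl (smul a (rho (bas k))) \<in> ?S" by blast
    qed
  next
    fix x l assume "x \<in> Nsub"
    then show "res (\<lambda>k. ?d k = l) x \<in> Nsub"
      using Nsub_res[of x "\<lambda>a m b. m - zvec b = l"] by (simp add: case_prod_unfold)
  qed
  then show ?thesis by (simp add: case_prod_unfold)
qed

lemma proj_pi_cl: "proj_pi chi I (a0, b0) (cl a) =
    cl (rho (res (\<lambda>(u, m, v). (wdeg u, wdeg v) = (a0, b0)) (theta a)))"
proof -
  let ?d = "\<lambda>(u :: 'i word, m :: int ^ 'i, v :: 'i word). (wdeg u, wdeg v)"
  have "proj_pi chi I (a0, b0) (cl a) = cl (rho (res (\<lambda>k. ?d k = (a0, b0)) (theta a)))"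
    unfolding proj_pi_def
  proof (rule component_eq)
    fix l :: "(nat ^ 'i) \<times> (nat ^ 'i)"
    obtain a b where l: "l = (a, b)" by (cases l)
    let ?S = "{x \<otimes>\<^bsub>U\<^esub> h \<otimes>\<^bsub>U\<^esub> y | x h y.
          x \<in> U_plus_deg chi I a \<and> h \<in> U_H chi I \<and> y \<in> U_minus_deg chi I b}"
    have "add_span U ?S = {cl (rho x) | x. keys x \<subseteq> {k. ?d k = l}}"
    proof (rule add_span_eq)
      fix s assume "s \<in> ?S"
      then obtain p t q where s: "s = cl (lin Ew p * lin Kp t * lin Fw q)" "mhomogeneous a p" "mhomogeneous b q"
        by (auto simp: U_plus_deg_def U_minus_deg_def U_H_eq cl_mult eval_E eval_F)
      have "lin Ew p * lin Kp t * lin Fw q = lin (\<lambda>u. lin (\<lambda>v. Ew u * lin Kp t * Fw v) q) p"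
        by (rule lin3)
      also have "\<dots> = lin (\<lambda>u. lin (\<lambda>v. lin (\<lambda>m. rho (bas (u, m, v))) t) q) p"
        unfolding rho_bas
        by (simp add: linmap_lin_apply[OF linmap_times_right] linmap_lin_apply[OF linmap_times_left])
      also have "\<dots> = rho (lin (\<lambda>u. lin (\<lambda>v. lin (\<lambda>m. bas (u, m, v)) t) q) p)"
        by (simp add: linmap_lin_apply[OF linmap_rho])
      finally have "s = cl (rho (lin (\<lambda>u. lin (\<lambda>v. lin (\<lambda>m. bas (u, m, v)) t) q) p))"
        by (simp add: s)
      moreover have "lin (\<lambda>u. lin (\<lambda>v. lin (\<lambda>m. bas (u, m, v)) t) q) p \<in>
          {x :: ('k, 'i) pbw. keys x \<subseteq> {k. ?d k = l}}"
        by (intro lin_mem subsp_keys) (use s in \<open>simp add: l mhomogeneous_def\<close>)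
      ultimately show "\<exists>x. keys x \<subseteq> {k. ?d k = l} \<and> s = cl (rho x)" by blast
    next
      fix k r assume "k \<in> {k. ?d k = l}"
      then obtain u m v where k: "k = (u, m, v)" "wdeg u = a" "wdeg v = b" by (cases k) (auto simp: l)
      have "cl (smul r (rho (bas k))) = cl (lin Ew (Poly_Mapping.single u r)) \<otimes>\<^bsub>U\<^esub> cl (Kp m) \<otimes>\<^bsub>U\<^esub> cl (lin Fw (bas v))"
        unfolding k rho_bas by (simp add: cl_mult smul_mult_left)
      moreover have "cl (lin Ew (Poly_Mapping.single u r)) \<in> U_plus_deg chi I a"
        unfolding U_plus_deg_def eval_E using k by (intro imageI) (simp add: mhomogeneous_def)
      moreover have "cl (lin Fw (bas v)) \<in> U_minus_deg chi I b"
        unfolding U_minus_deg_def eval_F using k by (intro imageI) (simp add: mhomogeneous_def)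
      moreover have "cl (Kp m) \<in> U_H chi I"
        unfolding U_H_eq by (rule cl_span_memI[where k = 1 and a = m]) simp_all
      ultimately show "cl (smul r (rho (bas k))) \<in> ?S" by blast
    qed
    then show "(case l of (a, b) \<Rightarrow> add_span U {x \<otimes>\<^bsub>U\<^esub> h \<otimes>\<^bsub>U\<^esub> y | x h y.
          x \<in> U_plus_deg chi I a \<and> h \<in> U_H chi I \<and> y \<in> U_minus_deg chi I b}) =
        {cl (rho x) | x. keys x \<subseteq> {k. ?d k = l}}"
      by (simp add: l)
  next
    fix x l assume "x \<in> Nsub"
    then show "res (\<lambda>k. ?d k = l) x \<in> Nsub"
      using Nsub_res[of x "\<lambda>a m b. (a, b) = l"] by (simp add: case_prod_unfold)
  qed
  then show ?thesis by (simp add: case_prod_unfold)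
qed

text \<open>The first projection reduces \<open>thB\<close> to \<open>Xw\<close> by
  \<open>res_thB\<close>, and the second keeps u = v = 0, where the coefficient is kappa.\<close>

lemma proj_B:
  assumes "mhomogeneous l p"
  shows "proj_pi chi I (0, 0) (proj_P chi I (- zvec l) (eval_U chi I (B_gen chi I tau c) p)) =
    cl (smul (klin p) (Kp (- zvec l)))"
proof -
  have "res (\<lambda>(u, m, v). m - zdeg v = - zvec l) (lin thB p) = lin Xw p"
    unfolding res_lin
  proof (rule lin_cong)
    fix w assume "w \<in> keys p"
    then have "zvec l = zdeg w" using assms by (simp add: mhomogeneous_def)
    then show "res (\<lambda>(u, m, v). m - zdeg v = - zvec l) (thB w) = Xw w"
      using res_thB[of w] by simp
  qed
  then have "proj_P chi I (- zvec l) (eval_U chi I (B_gen chi I tau c) p) = cl (rho (lin Xw p))"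
    by (simp add: eval_B proj_P_cl theta_lin_Bw)
  moreover have "res (\<lambda>(u, m, v). (wdeg u, wdeg v) = (0, 0)) (lin Xw p) =
      smul (klin p) (bas (0, - zvec l, 0))"
  proof (rule poly_mapping_eqI)
    fix k :: "'i word \<times> (int ^ 'i) \<times> 'i word"
    obtain u m v where k: "k = (u, m, v)" by (cases k)
    have X: "coef (lin Xw p) (0, m, 0) = (if m = - zvec l then klin p else 0)"
    proof -
      have "coef (Xw w) (0, m, 0) = (if m = - zvec l then kappa w else 0)" if "w \<in> keys p" for w
      proof -
        have "zvec l = zdeg w" using assms that by (simp add: mhomogeneous_def)
        then show ?thesis
          using keys_Xw[of 0 m 0 w] by (auto simp: kappa_def in_keys_iff)
      qed
      then have "coef (lin Xw p) (0, m, 0) = (\<Sum>w\<in>keys p. coef p w * (if m = - zvec l then kappa w else 0))"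
        unfolding lin_def lookup_sum by (intro sum.cong refl) simp
      then show ?thesis by (simp add: klin_def)
    qed
    have "wdeg w = 0 \<longleftrightarrow> w = 0" for w :: "'i word" using wdeg_eq_0 by auto
    then show "coef (res (\<lambda>(u, m, v). (wdeg u, wdeg v) = (0, 0)) (lin Xw p)) k =
        coef (smul (klin p) (bas (0, - zvec l, 0))) k"
      using X by (auto simp: k lookup_single when_def)
  qed
  ultimately have "proj_pi chi I (0, 0) (proj_P chi I (- zvec l) (eval_U chi I (B_gen chi I tau c) p)) =
      cl (rho (smul (klin p) (bas (0, - zvec l, 0))))"
    by (simp add: proj_pi_cl theta_rho)
  also have "rho (smul (klin p) (bas (0, - zvec l, 0))) = smul (klin p) (Kp (- zvec l))"
    unfolding linmap_smul[OF linmap_rho] rho_bas Ew_0 Fw_0 by simp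
  finally show ?thesis .
qed

text \<open>K_(- l) is nonzero in \<open>U(chi)\<close>, since 1 is not in \<open>I\<close>.\<close>

lemma proj_B_zero:
  assumes "mhomogeneous l p"
  shows "proj_pi chi I (0, 0) (proj_P chi I (- zvec l) (eval_U chi I (B_gen chi I tau c) p)) = \<zero>\<^bsub>U\<^esub>
    \<longleftrightarrow> klin p = 0"
proof -
  have "klin p = 0" if "smul (klin p) (Kp (- zvec l)) \<in> J"
  proof (rule ccontr)
    assume "klin p \<noteq> 0"
    then have "Kp (- zvec l) \<in> J"
      using subsp_smul[OF J_subsp that, of "inverse (klin p)"] by simp
    then show False
      using bas_notin_Nsub by (simp add: J_iff theta_Kp)
  qed
  then show ?thesis
    by (auto simp: proj_B[OF assms] cl_eq_zero subsp_0[OF J_subsp])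
qed


section \<open>Finitely many generators suffice\<close>

text \<open>\<open>Q\<close> collects the polynomials whose components of length j drop for all j up
  to n; being defined by the filtration, it is an ideal. The induction hypothesis yields
  \<open>kappa_below n\<close>, so \<open>Bw_ideal_FA\<close> puts each generator of height at most
  n into \<open>Q\<close>, and longer ones have no components to check.\<close>

lemma relB_of_generators:
  assumes I: "I = genideal free_ring (fst ` R)"
    and R: "\<And>p l. (p, l) \<in> R \<Longrightarrow> mhomogeneous l p \<and> klin p = 0"
  shows "relB n"
proof (induction n rule: less_induct)
  case (less n)
  have kn: "kappa_below n" by (rule relB_kappa_below) (rule less)
  define Q where "Q = {p :: ('k, 'i) ncpoly. \<forall>j\<le>n. lin Bw (res (\<lambda>w. wlen w = j) p) \<in> FA j}"
  have Qs: "subsp Q"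
    by (rule subspI)
      (auto simp: Q_def res_add res_smul lin_add lin_smul subsp_0[OF FA_subsp] subsp_add[OF FA_subsp]
        subsp_smul[OF FA_subsp])
  \<comment> \<open>Multiplication by a word of length k shifts all lengths by k, so components of
    length below k vanish.\<close>
  have lenres: "res (\<lambda>w. wlen w = j) (lin (\<lambda>w. bas (g w)) p) =
      (if k \<le> j then lin (\<lambda>w. bas (g w)) (res (\<lambda>w. wlen w = j - k) p) else 0)"
    if "\<And>w. wlen (g w) = k + wlen w" for j k and g :: "'i word \<Rightarrow> 'i word" and p :: "('k, 'i) ncpoly"
  proof (cases "k \<le> j")
    case True
    then show ?thesis
      unfolding res_lin lin_res by (auto simp: res_single that intro!: lin_cong)
  next
    case False
    then have "lin (\<lambda>w. res (\<lambda>w. wlen w = j) (bas (g w))) p = lin (\<lambda>w. 0) p"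
      by (intro lin_cong) (simp add: res_single that)
    then show ?thesis using False by (simp add: res_lin)
  qed
  have Ql: "bas u * p \<in> Q" and Qr: "p * bas u \<in> Q" if p: "p \<in> Q" for u p
  proof -
    have el: "bas u * p = lin (\<lambda>w. bas (u + w)) p" for p :: "('k, 'i) ncpoly"
      by (subst linmap_eq_lin[OF linmap_times_left]) (simp add: bas_times_bas)
    have er: "p * bas u = lin (\<lambda>w. bas (w + u)) p" for p :: "('k, 'i) ncpoly"
      by (subst linmap_eq_lin[OF linmap_times_right]) (simp add: bas_times_bas)
    have u: "Bw u \<in> FA (Suc (wlen u))" by (rule FA_Bw) simp
    show "bas u * p \<in> Q"
      unfolding Q_def
    proof (intro CollectI allI impI)
      fix j assume j: "j \<le> n"
      show "lin Bw (res (\<lambda>w. wlen w = j) (bas u * p)) \<in> FA j"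
      proof (cases "wlen u \<le> j")
        case True
        have "lin Bw (res (\<lambda>w. wlen w = j) (bas u * p)) = Bw u * lin Bw (res (\<lambda>w. wlen w = j - wlen u) p)"
          unfolding el using True
          by (simp add: lenres[where k = "wlen u"] lin_lin Bw_plus linmap_lin_apply[OF linmap_times_left])
        moreover have "lin Bw (res (\<lambda>w. wlen w = j - wlen u) p) \<in> FA (j - wlen u)"
          using p j by (simp add: Q_def)
        ultimately show ?thesis
          using FA_mult_right[OF u, of "lin Bw (res (\<lambda>w. wlen w = j - wlen u) p)" "j - wlen u"] True by simp
      next
        case False
        then show ?thesis
          unfolding el by (simp add: lenres[where k = "wlen u"] subsp_0[OF FA_subsp])
      qed
    qed
    show "p * bas u \<in> Q"
      unfolding Q_def
    proof (intro CollectI allI impI)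
      fix j assume j: "j \<le> n"
      show "lin Bw (res (\<lambda>w. wlen w = j) (p * bas u)) \<in> FA j"
      proof (cases "wlen u \<le> j")
        case True
        have "lin Bw (res (\<lambda>w. wlen w = j) (p * bas u)) = lin Bw (res (\<lambda>w. wlen w = j - wlen u) p) * Bw u"
          unfolding er using True
          by (simp add: lenres[where k = "wlen u"] lin_lin Bw_plus linmap_lin_apply[OF linmap_times_right])
        moreover have "lin Bw (res (\<lambda>w. wlen w = j - wlen u) p) \<in> FA (j - wlen u)"
          using p j by (simp add: Q_def)
        ultimately show ?thesis
          using FA_mult_left[OF _ u, of "lin Bw (res (\<lambda>w. wlen w = j - wlen u) p)" "j - wlen u"] True by simp
      next
        case False
        then show ?thesis
          unfolding er by (simp add: lenres[where k = "wlen u"] subsp_0[OF FA_subsp])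
      qed
    qed
  qed
  have "ideal Q free_ring"
    unfolding ideal_free_ring_iff
  proof (intro conjI ballI allI)
    fix p a assume p: "p \<in> Q"
    show "a * p \<in> Q"
      by (rule linmap_mem[OF linmap_times_right Qs]) (rule Ql[OF p])
    show "p * a \<in> Q"
      by (rule linmap_mem[OF linmap_times_left Qs]) (rule Qr[OF p])
  qed (rule Qs)
  moreover have "fst ` R \<subseteq> Q"
  proof clarify
    fix p l assume pl: "(p, l) \<in> R"
    then have p: "mhomogeneous l p" "klin p = 0" using R by auto
    have "fst ` R \<subseteq> I"
      using ring.genideal_self[OF ring_free_ring, of "fst ` R"] I by simp
    then have pI: "p \<in> I" using pl by force
    have "lin Bw (res (\<lambda>w. wlen w = j) p) \<in> FA j" if "j \<le> n" for j
    proof (cases "height (zvec l) = int j")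
      case True
      have "res (\<lambda>w. wlen w = j) p = p"
        using mhomogeneous_wlen[OF p(1)] True by (intro res_all) simp
      moreover have "lin Bw p \<in> FA j"
        by (rule Bw_ideal_FA[OF kappa_below_mono[OF kn that] pI p(1) True p(2)])
      ultimately show ?thesis by simp
    next
      case False
      have "res (\<lambda>w. wlen w = j) p = 0"
        using mhomogeneous_wlen[OF p(1)] False by (intro res_none) auto
      then show ?thesis by (simp add: subsp_0[OF FA_subsp])
    qed
    then show "fst (p, l) \<in> Q" by (simp add: Q_def)
  qed
  ultimately have "I \<subseteq> Q"
    unfolding I by (rule ring.genideal_minimal[OF ring_free_ring])
  show "relB n"
    unfolding relB_def
  proof (intro ballI impI)
    fix p assume p: "p \<in> I" "thomogeneous n p"
    then have "res (\<lambda>w. wlen w = n) p = p"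
      by (intro res_all) (simp add: thomogeneous_def)
    then show "lin Bw p \<in> FA n"
      using p \<open>I \<subseteq> Q\<close> by (force simp: Q_def)
  qed
qed

text \<open>The homogeneous components of given generators lie in the graded ideal \<open>I\<close>
  and generate it; a finite set has finitely many of them.\<close>

lemma homogeneous_generators:
  assumes "finite S" "I = genideal free_ring S"
  obtains R where "finite R" "I = genideal free_ring (fst ` R)"
    "\<And>p l. (p, l) \<in> R \<Longrightarrow> p \<in> I \<and> mhomogeneous l p"
proof
  let ?R = "\<Union>s\<in>S. (\<lambda>l. (res (\<lambda>w. wdeg w = l) s, l)) ` wdeg ` keys s"
  show "finite ?R" using assms(1) by simp
  have SI: "S \<subseteq> I"
    using ring.genideal_self[OF ring_free_ring, of S] assms(2) by simp
  show RI: "p \<in> I \<and> mhomogeneous l p" if "(p, l) \<in> ?R" for p l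
    using that SI I_hpart by (auto simp: mhomogeneous_def keys_res)
  have R: "fst ` ?R \<subseteq> genideal free_ring (fst ` ?R)"
    by (rule ring.genideal_self[OF ring_free_ring]) simp
  have id: "ideal (genideal free_ring (fst ` ?R)) (free_ring :: ('k, 'i) ncpoly ring)"
    by (rule ring.genideal_ideal[OF ring_free_ring]) simp
  have iI: "ideal I free_ring" using biideal unfolding graded_biideal_def by blast
  show "I = genideal free_ring (fst ` ?R)"
  proof
    have "fst ` ?R \<subseteq> I"
    proof
      fix x assume "x \<in> fst ` ?R"
      then obtain y where "y \<in> ?R" "x = fst y" by blast
      then show "x \<in> I" using RI[of x "snd y"] by simp
    qed
    then show "genideal free_ring (fst ` ?R) \<subseteq> I"
      by (rule ring.genideal_minimal[OF ring_free_ring iI])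
    have "S \<subseteq> genideal free_ring (fst ` ?R)"
    proof
      fix s assume s: "s \<in> S"
      have "(\<Sum>l\<in>wdeg ` keys s. res (\<lambda>w. wdeg w = l) s) \<in> genideal free_ring (fst ` ?R)"
      proof (rule subsp_sum)
        show "subsp (genideal free_ring (fst ` ?R))"
          using id unfolding ideal_free_ring_iff by blast
        fix l assume "l \<in> wdeg ` keys s"
        then have "(res (\<lambda>w. wdeg w = l) s, l) \<in> ?R" using s by blast
        then show "res (\<lambda>w. wdeg w = l) s \<in> genideal free_ring (fst ` ?R)"
          using R by force
      qed
      then show "s \<in> genideal free_ring (fst ` ?R)"
        using sum_res_partition[of "wdeg ` keys s" s wdeg] by simp
    qed
    then show "I \<subseteq> genideal free_ring (fst ` ?R)"
      by (subst assms(2)) (rule ring.genideal_minimal[OF ring_free_ring id])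
  qed
qed

lemma all_relB_generators:
  assumes "finite S" "I = genideal free_ring S"
  shows "(\<forall>n. relB n) \<longleftrightarrow> (\<exists>R :: (('k, 'i) ncpoly \<times> (nat ^ 'i)) set. finite R \<and>
     I = genideal free_ring (fst ` R) \<and> (\<forall>(p, l)\<in>R. mhomogeneous l p \<and> klin p = 0))"
proof
  assume "\<forall>n. relB n"
  then have k: "kappa_below n" for n using all_relB_iff by blast
  obtain R where R: "finite R" "I = genideal free_ring (fst ` R)"
    "\<And>p l. (p, l) \<in> R \<Longrightarrow> p \<in> I \<and> mhomogeneous l p"
    using homogeneous_generators[OF assms] by blast
  have "klin p = 0" if "(p, l) \<in> R" for p l
  proof -
    have "height (zvec l) < int (Suc (nat (height (zvec l))))" by simp
    then show ?thesis
      using k R(3)[OF that] unfolding kappa_below_def by blast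
  qed
  then show "\<exists>R. finite R \<and> I = genideal free_ring (fst ` R) \<and> (\<forall>(p, l)\<in>R. mhomogeneous l p \<and> klin p = 0)"
    using R by blast
next
  assume "\<exists>R :: (('k, 'i) ncpoly \<times> (nat ^ 'i)) set. finite R \<and>
     I = genideal free_ring (fst ` R) \<and> (\<forall>(p, l)\<in>R. mhomogeneous l p \<and> klin p = 0)"
  then obtain R :: "(('k, 'i) ncpoly \<times> (nat ^ 'i)) set" where "I = genideal free_ring (fst ` R)"
    "\<forall>(p, l)\<in>R. mhomogeneous l p \<and> klin p = 0" by blast
  then show "\<forall>n. relB n" using relB_of_generators by blast
qed

end

theorem theorem2p13:
  fixes chi :: "int ^ 'i::finite \<Rightarrow> int ^ 'i \<Rightarrow> 'k::field"
    and I :: "('k, 'i) ncpoly set"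
    and tau :: "'i \<Rightarrow> 'i"
    and c :: "'k ^ 'i"
  assumes "bicharacter chi"
    and "\<And>i j. qmat chi i j = qmat chi j i"
    and "graded_biideal chi I"
    and "bij tau" and "tau \<circ> tau = id"
    and "\<And>i j. qmat chi (tau i) (tau j) = qmat chi i j"
    and "tau_hom tau ` I = I"
  shows
    "(gr_map chi I tau c \<in> ring_iso (gr_B chi I tau c) (H_theta_U_minus chi I tau)
        \<longleftrightarrow> N_rel chi I tau c = UNIV)
     \<and> ((\<exists>S. finite S \<and> I = genideal free_ring S) \<longrightarrow>
        (gr_map chi I tau c \<in> ring_iso (gr_B chi I tau c) (H_theta_U_minus chi I tau)
         \<longleftrightarrow> (\<exists>R :: (('k, 'i) ncpoly \<times> (nat ^ 'i)) set. finite R \<and>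
               I = genideal free_ring (fst ` R) \<and>
               (\<forall>(p, l)\<in>R. mhomogeneous l p \<and>
                  proj_pi chi I (0, 0)
                    (proj_P chi I (- zvec l) (eval_U chi I (B_gen chi I tau c) p))
                  = \<zero>\<^bsub>U_alg chi I\<^esub>))))
     \<and> (N_rel chi I tau c \<noteq> UNIV \<longrightarrow>
        (\<exists>l :: nat ^ 'i. l \<noteq> 0 \<and> U_Kpow chi I (- zvec l) \<in> B_alg chi I tau c))"
proof -
  interpret pre_nichols_pair chi I tau c
    by unfold_locales (rule assms)+
  have N: "N_rel chi I tau c = UNIV \<longleftrightarrow> (\<forall>n. relB n)"
    using N_rel_iff by auto
  have "(\<forall>n. relB n) \<longleftrightarrow> (\<exists>R :: (('k, 'i) ncpoly \<times> (nat ^ 'i)) set. finite R \<and>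
      I = genideal free_ring (fst ` R) \<and>
      (\<forall>(p, l)\<in>R. mhomogeneous l p \<and>
        proj_pi chi I (0, 0) (proj_P chi I (- zvec l) (eval_U chi I (B_gen chi I tau c) p))
          = \<zero>\<^bsub>U_alg chi I\<^esub>))" if "finite S" "I = genideal free_ring S" for S
  proof -
    have e: "(mhomogeneous l p \<and>
        proj_pi chi I (0, 0) (proj_P chi I (- zvec l) (eval_U chi I (B_gen chi I tau c) p))
          = \<zero>\<^bsub>U_alg chi I\<^esub>) \<longleftrightarrow> mhomogeneous l p \<and> klin p = 0" for l p
      using proj_B_zero by blast
    show ?thesis
      unfolding e using all_relB_generators[OF that] .
  qed
  moreover have "\<exists>l :: nat ^ 'i. l \<noteq> 0 \<and> U_Kpow chi I (- zvec l) \<in> B_alg chi I tau c"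
    if "\<not> (\<forall>n. relB n)"
    using exists_Kp_B_alg[OF that] by (simp add: U_Kpow_cl)
  ultimately show ?thesis
    unfolding gr_map_iso_N_rel N by blast
qed


end
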